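(* No arithmetic Jørgensen group of elliptic type is commensurable with any non-cocompact arithmetic Kleinian group.
   Context: A Kleinian group is a discrete subgroup of $\mathrm{PSL}_2(\mathbb{C})$. For $X,Y\in\mathrm{PSL}_2(\mathbb{C})$ put $J(X,Y)=|\operatorname{tr}^2X-4|+|\operatorname{tr}[X,Y]-2|$. For a non-elementary Kleinian group $\Gamma$ that can be generated by two elements, $J(\Gamma)=\inf\{J(X,Y):\langle X,Y\rangle=\Gamma\}$; always $J(\Gamma)\ge1$, and $\Gamma$ is a Jørgensen group if $J(\Gamma)=1$. A Jørgensen group is of elliptic type if $\Gamma=\langle X,Y\rangle$ with $J(X,Y)=1$ and $X$ elliptic. "Arithmetic Kleinian group" has the standard meaning (in particular finite covolume). Commensurability is the usual one for Kleinian groups (some conjugate of one meets the other in a subgroup of finite index in both). *)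

theory Defs
  imports
    "HOL-Analysis.Analysis"
    "HOL-Algebra.Embedded_Algebras"
begin

section \<open>The group \<open>PSL\<^sub>2(\<complex>)\<close>\<close>

definition SL2C :: "(complex^2^2) monoid" where
  "SL2C = \<lparr>carrier = {A. det A = 1}, mult = (**), one = mat 1\<rparr>"

definition PSL2C :: "(complex^2^2) set monoid" where
  "PSL2C = SL2C Mod {mat 1, - mat 1}"

definition psl :: "complex^2^2 \<Rightarrow> (complex^2^2) set" where
  "psl A = {mat 1, - mat 1} #>\<^bsub>SL2C\<^esub> A"

lemma psl_eq: "psl A = {A, - A}"
proof -
  have "(- mat 1) ** A = - A"
    by (simp add: vec_eq_iff forall_2 matrix_matrix_mult_def mat_def sum_2)
  then show ?thesis
    by (auto simp: psl_def r_coset_def SL2C_def)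
qed

lemma carrier_PSL2C: "carrier PSL2C = psl ` carrier SL2C"
  by (auto simp: PSL2C_def FactGroup_def RCOSETS_def psl_def)

text \<open>
  The trace of an element of \<open>PSL\<^sub>2(\<complex>)\<close> is defined up to sign; its square and the trace of
  a commutator do not depend on the chosen representatives.
\<close>

definition psl_tr2 :: "(complex^2^2) set \<Rightarrow> complex" where
  "psl_tr2 g = (THE t. \<exists>A\<in>g. t = (trace A)\<^sup>2)"

definition psl_tr_comm :: "(complex^2^2) set \<Rightarrow> (complex^2^2) set \<Rightarrow> complex" where
  "psl_tr_comm g h =
     (THE t. \<exists>A\<in>g. \<exists>B\<in>h. t = trace (A ** B ** matrix_inv A ** matrix_inv B))"

lemma matrix_2_eqI:
  "A $ 1 $ 1 = B $ 1 $ 1 \<Longrightarrow> A $ 1 $ 2 = B $ 1 $ 2 \<Longrightarrow> A $ 2 $ 1 = B $ 2 $ 1 \<Longrightarrow>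
   A $ 2 $ 2 = B $ 2 $ 2 \<Longrightarrow> A = (B :: 'a^2^2)"
  by (simp add: vec_eq_iff forall_2)

lemma psl_tr2_psl: "psl_tr2 (psl A) = (trace A)\<^sup>2"
  by (auto simp: psl_tr2_def psl_eq trace_def sum_2 power2_eq_square algebra_simps)

lemma matrix_inv_eqI:
  fixes A B :: "'a::semiring_1^'n^'n"
  assumes "A ** B = mat 1" "B ** A = mat 1"
  shows "matrix_inv A = B"
proof -
  have "A ** matrix_inv A = mat 1 \<and> matrix_inv A ** A = mat 1"
    unfolding matrix_inv_def by (rule someI[of _ B]) (simp add: assms)
  then show ?thesis
    by (metis assms(2) matrix_mul_assoc matrix_mul_lid matrix_mul_rid)
qed

lemma psl_tr_comm_psl:
  assumes "det A = 1" "det B = 1"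
  shows "psl_tr_comm (psl A) (psl B) = trace (A ** B ** matrix_inv A ** matrix_inv B)"
proof -
  have neg: "(- C) ** D = - (C ** D)" "C ** (- D) = - (C ** D)" for C D :: "complex^2^2"
    by (auto intro!: matrix_2_eqI simp: matrix_matrix_mult_def sum_2)
  have inv: "matrix_inv (- C) = - matrix_inv C" if "det C = 1" for C :: "complex^2^2"
  proof -
    have "invertible C" using that by (simp add: invertible_det_nz)
    then obtain D where D: "C ** D = mat 1" "D ** C = mat 1"
      by (auto simp: invertible_def)
    then have "matrix_inv (- C) = - D" "matrix_inv C = D"
      by (auto intro!: matrix_inv_eqI simp: neg)
    then show ?thesis by simp
  qed
  have "trace (A' ** B' ** matrix_inv A' ** matrix_inv B') =
      trace (A ** B ** matrix_inv A ** matrix_inv B)" if "A' \<in> psl A" "B' \<in> psl B" for A' B'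
    using that assms by (auto simp: psl_eq neg inv)
  moreover have "A \<in> psl A" "B \<in> psl B" by (simp_all add: psl_eq)
  ultimately show ?thesis
    unfolding psl_tr_comm_def by (intro the_equality) blast+
qed

definition psl_elliptic :: "(complex^2^2) set \<Rightarrow> bool" where
  "psl_elliptic g \<longleftrightarrow>
     g \<in> carrier PSL2C \<and> psl_tr2 g \<in> \<real> \<and> 0 \<le> Re (psl_tr2 g) \<and> Re (psl_tr2 g) < 4"

section \<open>Kleinian groups\<close>

definition quotient_topology :: "'a topology \<Rightarrow> ('a \<Rightarrow> 'b) \<Rightarrow> 'b topology" where
  "quotient_topology T f =
     topology (\<lambda>U. U \<subseteq> f ` topspace T \<and> openin T {x \<in> topspace T. f x \<in> U})"

lemma openin_quotient_topology:
  "openin (quotient_topology T f) U \<longleftrightarrow>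
     U \<subseteq> f ` topspace T \<and> openin T {x \<in> topspace T. f x \<in> U}"
proof -
  have "istopology (\<lambda>U. U \<subseteq> f ` topspace T \<and> openin T {x \<in> topspace T. f x \<in> U})"
    unfolding istopology_def
  proof (intro conjI allI impI, goal_cases)
    case (2 S S')
    then have "openin T ({x \<in> topspace T. f x \<in> S} \<inter> {x \<in> topspace T. f x \<in> S'})"
      by blast
    moreover have "{x \<in> topspace T. f x \<in> S} \<inter> {x \<in> topspace T. f x \<in> S'} =
        {x \<in> topspace T. f x \<in> S \<inter> S'}" by blast
    ultimately show ?case by simp
  next
    case (4 K)
    then have "openin T (\<Union>S\<in>K. {x \<in> topspace T. f x \<in> S})" by blast
    moreover have "(\<Union>S\<in>K. {x \<in> topspace T. f x \<in> S}) = {x \<in> topspace T. f x \<in> \<Union>K}" by blast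
    ultimately show ?case by simp
  qed blast+
  then show ?thesis
    unfolding quotient_topology_def by (simp only: topology_inverse')
qed

definition PSL2C_topology :: "(complex^2^2) set topology" where
  "PSL2C_topology = quotient_topology (top_of_set (carrier SL2C)) psl"

definition kleinian_group :: "(complex^2^2) set set \<Rightarrow> bool" where
  "kleinian_group \<Gamma> \<longleftrightarrow>
     subgroup \<Gamma> PSL2C \<and> subtopology PSL2C_topology \<Gamma> = discrete_topology \<Gamma>"

text \<open>
  Hyperbolic 3-space is the upper half-space in \<open>\<complex> \<times> \<real>\<close>, with the Poincare extension of the
  Moebius action on its sphere at infinity. In \<open>complex option\<close>, \<open>None\<close> is the point at infinity.
\<close>

definition hyp3 :: "(complex \<times> real) set" where
  "hyp3 = {p. 0 < snd p}"

definition hyp3_act :: "complex^2^2 \<Rightarrow> complex \<times> real \<Rightarrow> complex \<times> real" where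
  "hyp3_act A p =
     (let a = A $ 1 $ 1; b = A $ 1 $ 2; c = A $ 2 $ 1; d = A $ 2 $ 2;
          z = fst p; t = snd p;
          q = (cmod (c * z + d))\<^sup>2 + (cmod c)\<^sup>2 * t\<^sup>2
      in (((a * z + b) * cnj (c * z + d) + a * cnj c * of_real (t\<^sup>2)) / of_real q, t / q))"

definition moebius :: "complex^2^2 \<Rightarrow> complex option \<Rightarrow> complex option" where
  "moebius A w =
     (let a = A $ 1 $ 1; b = A $ 1 $ 2; c = A $ 2 $ 1; d = A $ 2 $ 2
      in case w of
           None \<Rightarrow> (if c = 0 then None else Some (a / c))
         | Some z \<Rightarrow> (if c * z + d = 0 then None else Some ((a * z + b) / (c * z + d))))"

text \<open>
  Both actions are unchanged under \<open>A \<mapsto> - A\<close>, so the orbit of \<open>p\<close> under a subgroup \<open>\<Gamma>\<close> of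
  \<open>PSL\<^sub>2(\<complex>)\<close> is its orbit under the preimage \<open>\<Union>\<Gamma>\<close> of \<open>\<Gamma>\<close> in \<open>SL\<^sub>2(\<complex>)\<close>.
\<close>

definition psl_orbit ::
    "(complex^2^2 \<Rightarrow> 'p \<Rightarrow> 'p) \<Rightarrow> (complex^2^2) set set \<Rightarrow> 'p \<Rightarrow> 'p set" where
  "psl_orbit act \<Gamma> p = (\<lambda>A. act A p) ` (\<Union>\<Gamma>)"

definition elementary :: "(complex^2^2) set set \<Rightarrow> bool" where
  "elementary \<Gamma> \<longleftrightarrow>
     (\<exists>p\<in>hyp3. finite (psl_orbit hyp3_act \<Gamma> p)) \<or> (\<exists>w. finite (psl_orbit moebius \<Gamma> w))"

definition cocompact :: "(complex^2^2) set set \<Rightarrow> bool" where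
  "cocompact \<Gamma> \<longleftrightarrow>
     compact_space (quotient_topology (top_of_set hyp3) (psl_orbit hyp3_act \<Gamma>))"

definition finite_index :: "('a, 'b) monoid_scheme \<Rightarrow> 'a set \<Rightarrow> 'a set \<Rightarrow> bool" where
  "finite_index G H K \<longleftrightarrow> H \<subseteq> K \<and> finite (rcosets\<^bsub>G\<lparr>carrier := K\<rparr>\<^esub> H)"

definition commensurable :: "(complex^2^2) set set \<Rightarrow> (complex^2^2) set set \<Rightarrow> bool" where
  "commensurable \<Gamma> \<Delta> \<longleftrightarrow>
     (\<exists>g\<in>carrier PSL2C.
        let \<Gamma>' = g <#\<^bsub>PSL2C\<^esub> \<Gamma> #>\<^bsub>PSL2C\<^esub> inv\<^bsub>PSL2C\<^esub> g
        in finite_index PSL2C (\<Gamma>' \<inter> \<Delta>) \<Gamma>' \<and> finite_index PSL2C (\<Gamma>' \<inter> \<Delta>) \<Delta>)"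

section \<open>Joergensen groups\<close>

definition jorgensen_number :: "(complex^2^2) set \<Rightarrow> (complex^2^2) set \<Rightarrow> real" where
  "jorgensen_number g h = cmod (psl_tr2 g - 4) + cmod (psl_tr_comm g h - 2)"

definition generating_pairs ::
    "(complex^2^2) set set \<Rightarrow> ((complex^2^2) set \<times> (complex^2^2) set) set" where
  "generating_pairs \<Gamma> =
     {(g, h). g \<in> carrier PSL2C \<and> h \<in> carrier PSL2C \<and> generate PSL2C {g, h} = \<Gamma>}"

definition jorgensen_group :: "(complex^2^2) set set \<Rightarrow> bool" where
  "jorgensen_group \<Gamma> \<longleftrightarrow>
     kleinian_group \<Gamma> \<and> \<not> elementary \<Gamma> \<and> generating_pairs \<Gamma> \<noteq> {} \<and>
     (INF (g, h)\<in>generating_pairs \<Gamma>. jorgensen_number g h) = 1"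

definition jorgensen_group_elliptic_type :: "(complex^2^2) set set \<Rightarrow> bool" where
  "jorgensen_group_elliptic_type \<Gamma> \<longleftrightarrow>
     jorgensen_group \<Gamma> \<and>
     (\<exists>(g, h)\<in>generating_pairs \<Gamma>. jorgensen_number g h = 1 \<and> psl_elliptic g)"

section \<open>Number fields and quaternion algebras\<close>

definition field_ring :: "'a::field ring" where
  "field_ring = \<lparr>carrier = UNIV, mult = (*), one = 1, zero = 0, add = (+)\<rparr>"

definition number_field :: "complex set \<Rightarrow> bool" where
  "number_field k \<longleftrightarrow>
     subfield k field_ring \<and> ring.finite_dimension field_ring \<rat> k"

definition ring_of_integers :: "complex set \<Rightarrow> complex set" where
  "ring_of_integers k = {x \<in> k. algebraic_int x}"

definition field_embeddings :: "complex set \<Rightarrow> (complex \<Rightarrow> 'a::field) set" where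
  "field_embeddings k =
     ring_hom (field_ring\<lparr>carrier := k\<rparr>) field_ring \<inter> extensional k"

text \<open>A complex place is a pair of complex conjugate embeddings with non-real image.\<close>

definition complex_places :: "complex set \<Rightarrow> (complex \<Rightarrow> complex) set set" where
  "complex_places k =
     {{\<sigma>, restrict (cnj \<circ> \<sigma>) k} | \<sigma>. \<sigma> \<in> field_embeddings k \<and> \<not> \<sigma> ` k \<subseteq> \<real>}"

lemma vector_4 [simp]:
  "(vector [x, y, z, w] :: ('a::zero)^4) $ 1 = x"
  "(vector [x, y, z, w] :: ('a::zero)^4) $ 2 = y"
  "(vector [x, y, z, w] :: ('a::zero)^4) $ 3 = z"
  "(vector [x, y, z, w] :: ('a::zero)^4) $ 4 = w"
  unfolding vector_def by simp_all

text \<open>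
  The quaternion algebra with Hilbert symbol \<open>(a, b / k)\<close>; the vector \<open>x\<close> stands for
  \<open>x$1 + x$2 i + x$3 j + x$4 ij\<close>, where \<open>i\<^sup>2 = a\<close>, \<open>j\<^sup>2 = b\<close> and \<open>ij = - ji\<close>.
\<close>

definition quat_mult :: "'a::field \<Rightarrow> 'a \<Rightarrow> 'a^4 \<Rightarrow> 'a^4 \<Rightarrow> 'a^4" where
  "quat_mult a b x y = vector
     [x$1 * y$1 + a * x$2 * y$2 + b * x$3 * y$3 - a * b * x$4 * y$4,
      x$1 * y$2 + x$2 * y$1 - b * x$3 * y$4 + b * x$4 * y$3,
      x$1 * y$3 + x$3 * y$1 + a * x$2 * y$4 - a * x$4 * y$2,
      x$1 * y$4 + x$4 * y$1 + x$2 * y$3 - x$3 * y$2]"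

definition quat_algebra :: "'a::field set \<Rightarrow> 'a \<Rightarrow> 'a \<Rightarrow> ('a^4) ring" where
  "quat_algebra k a b =
     \<lparr>carrier = {x. \<forall>i. x $ i \<in> k}, mult = quat_mult a b, one = axis 1 1, zero = 0, add = (+)\<rparr>"

definition quat_conj :: "'a::field^4 \<Rightarrow> 'a^4" where
  "quat_conj x = vector [x$1, - x$2, - x$3, - x$4]"

definition quat_norm :: "'a::field \<Rightarrow> 'a \<Rightarrow> 'a^4 \<Rightarrow> 'a" where
  "quat_norm a b x = quat_mult a b x (quat_conj x) $ 1"

text \<open>
  Ramification at the real place \<open>\<sigma>\<close>: the algebra \<open>A \<otimes>\<^sub>k \<real>\<close>, which is \<open>(\<sigma> a, \<sigma> b / \<real>)\<close>,
  is a division algebra.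
\<close>

definition ramified_at_real_place :: "complex \<Rightarrow> complex \<Rightarrow> (complex \<Rightarrow> real) \<Rightarrow> bool" where
  "ramified_at_real_place a b \<sigma> \<longleftrightarrow>
     (let A = quat_algebra UNIV (\<sigma> a) (\<sigma> b) in Units A = carrier A - {\<zero>\<^bsub>A\<^esub>})"

definition lin_span :: "'a::field set \<Rightarrow> ('a^4) set \<Rightarrow> ('a^4) set" where
  "lin_span S V = {\<Sum>v\<in>F. c v *s v | F c. finite F \<and> F \<subseteq> V \<and> c ` F \<subseteq> S}"

definition quat_order :: "complex set \<Rightarrow> complex \<Rightarrow> complex \<Rightarrow> (complex^4) set \<Rightarrow> bool" where
  "quat_order k a b R \<longleftrightarrow>
     subring R (quat_algebra k a b) \<and>
     (\<exists>B. finite B \<and> R = lin_span (ring_of_integers k) B) \<and>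
     lin_span k R = carrier (quat_algebra k a b)"

definition M2C :: "(complex^2^2) ring" where
  "M2C = \<lparr>carrier = UNIV, mult = (**), one = mat 1, zero = 0, add = (+)\<rparr>"

definition quat_embedding ::
    "complex set \<Rightarrow> complex \<Rightarrow> complex \<Rightarrow> (complex^4 \<Rightarrow> complex^2^2) \<Rightarrow> bool" where
  "quat_embedding k a b \<rho> \<longleftrightarrow>
     \<rho> \<in> ring_hom (quat_algebra k a b) M2C \<and>
     inj_on \<rho> (carrier (quat_algebra k a b)) \<and>
     (\<forall>c\<in>k. \<forall>x\<in>carrier (quat_algebra k a b). \<rho> (c *s x) = mat c ** \<rho> x)"

section \<open>Arithmetic Kleinian groups\<close>

text \<open>
  The field \<open>k\<close> is taken as a subfield of \<open>\<complex>\<close> through its unique complex place, hence the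
  condition that it is not contained in \<open>\<real>\<close>: a \<open>k\<close>-embedding into \<open>M\<^sub>2(\<complex>)\<close> is linear with
  respect to this inclusion. Finite covolume is a consequence of the definition.
\<close>

definition arithmetic_kleinian_group :: "(complex^2^2) set set \<Rightarrow> bool" where
  "arithmetic_kleinian_group \<Gamma> \<longleftrightarrow>
     kleinian_group \<Gamma> \<and>
     (\<exists>k a b R \<rho>.
        number_field k \<and> card (complex_places k) = 1 \<and> \<not> k \<subseteq> \<real> \<and>
        a \<in> k - {0} \<and> b \<in> k - {0} \<and>
        (\<forall>\<sigma>\<in>field_embeddings k. ramified_at_real_place a b \<sigma>) \<and>
        quat_order k a b R \<and> quat_embedding k a b \<rho> \<and>
        commensurable \<Gamma> (psl ` \<rho> ` {x \<in> R. quat_norm a b x = 1}))"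

end

theory Submission
  imports Defs "HOL-Computational_Algebra.Fundamental_Theorem_Algebra"
begin

text \<open>
  Let \<open>\<Gamma> = \<langle>X, Y\<rangle>\<close> with \<open>X\<close> elliptic and \<open>J(X, Y) = 1\<close>, and suppose that \<open>\<Gamma>\<close> is commensurable with the
  non-cocompact arithmetic group \<open>\<Delta>\<close>. The contradiction comes from \<open>tr\<^sup>2 X\<close> being a rational integer.
  Since \<open>X\<close> is elliptic, \<open>0 \<le> tr\<^sup>2 X < 4\<close>, so \<open>\<bar>tr\<^sup>2 X - 4\<bar> \<ge> 1\<close> if \<open>tr\<^sup>2 X\<close> is an integer, and \<open>J(X, Y) = 1\<close> leaves
  only \<open>tr\<^sup>2 X = 3\<close> and \<open>tr [X, Y] = 2\<close>. Then \<open>X\<close> and \<open>Y\<close> fix a common point of the sphere at infinity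
  (\<open>common_fixed_point\<close>), and \<open>\<Gamma>\<close> is elementary, which a Joergensen group is not.

  Integrality of the trace: let \<open>\<Delta>\<close> be commensurable with the norm one units of the order \<open>R\<close> in the
  quaternion algebra \<open>A = (a, b / k)\<close>. As \<open>\<Delta>\<close> is not cocompact, \<open>A\<close> has zero divisors
  (\<open>noncocompact_imp_zero_divisor\<close>). Hence \<open>k\<close> has no real place, because \<open>A\<close> ramifies at all of them,
  so \<open>k\<close> is imaginary quadratic and its real algebraic integers are rational. A conjugate \<open>Z\<close> of \<open>X\<close>
  commensurates the units. A power of \<open>Z\<close> is a unit, so \<open>tr Z\<close> is an algebraic integer. The algebra
  contains nilpotents \<open>E, F\<close> with \<open>EF + FE = 1\<close>; the unipotent units \<open>1 + n E\<close> show that conjugation by \<open>Z\<close>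
  maps \<open>E\<close> and \<open>F\<close> into \<open>A\<close>. As \<open>tr\<^sup>2 Z\<close> is the trace of the conjugation by \<open>Z\<close> on \<open>M\<^sub>2(\<complex>)\<close>, it can be computed
  in \<open>A\<close> and lies in \<open>k\<close> (\<open>commensurator_trace_sq\<close>).

  The remaining input is Godement's criterion in this case: the norm one units of an order in a
  division algebra act cocompactly (\<open>division_imp_cobounded\<close>). For \<open>g \<in> SL\<^sub>2(\<complex>)\<close> a pigeonhole argument in the
  spirit of Minkowski gives a nonzero \<open>r \<in> R\<close> such that \<open>g\<^sup>-\<^sup>1 r\<close> is bounded independently of \<open>g\<close> and \<open>r\<close> is bounded
  at the real places. The norm of \<open>r\<close> is then bounded at all places, so it takes only finitely many values, which are
  nonzero in a division algebra. Elements of \<open>R\<close> of a given nonzero norm fall into finitely many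
  classes modulo units, so \<open>g\<close> is a unit times a bounded matrix.

  Everything about number fields is done with a primitive element \<open>\<theta>\<close>: an embedding is the choice of a
  root of the minimal polynomial of \<open>\<theta>\<close>.
\<close>

(* these names denote operations on complex polynomials below *)
hide_const (open) up_ring.coeff up_ring.monom module.smult

section \<open>Polynomials over subrings of the complex numbers\<close>

definition csubring :: "complex set \<Rightarrow> bool" where
  "csubring S \<longleftrightarrow> 1 \<in> S \<and> (\<forall>x\<in>S. \<forall>y\<in>S. x - y \<in> S \<and> x * y \<in> S)"

definition csubfield :: "complex set \<Rightarrow> bool" where
  "csubfield S \<longleftrightarrow> csubring S \<and> (\<forall>x\<in>S. inverse x \<in> S)"

text \<open>
  Number fields are subsets of \<open>\<complex>\<close> here, so a polynomial over such a field is a complex polynomial whose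
  coefficients satisfy a membership condition. This keeps all evaluations inside one polynomial ring.
\<close>

definition poly_over :: "complex set \<Rightarrow> complex poly \<Rightarrow> bool" where
  "poly_over S p \<longleftrightarrow> (\<forall>i. coeff p i \<in> S)"

lemma csubring_closed:
  assumes "csubring S"
  shows "0 \<in> S" "1 \<in> S" "x \<in> S \<Longrightarrow> - x \<in> S" "x \<in> S \<Longrightarrow> y \<in> S \<Longrightarrow> x + y \<in> S"
    "x \<in> S \<Longrightarrow> y \<in> S \<Longrightarrow> x - y \<in> S" "x \<in> S \<Longrightarrow> y \<in> S \<Longrightarrow> x * y \<in> S"
proof -
  show 1: "1 \<in> S" and d: "x \<in> S \<Longrightarrow> y \<in> S \<Longrightarrow> x - y \<in> S"
    and "x \<in> S \<Longrightarrow> y \<in> S \<Longrightarrow> x * y \<in> S" for x y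
    using assms by (auto simp: csubring_def)
  show 0: "0 \<in> S" using d[OF 1 1] by simp
  show m: "- x \<in> S" if "x \<in> S" for x using d[OF 0 that] by simp
  show "x + y \<in> S" if "x \<in> S" "y \<in> S" for x y using d[OF that(1) m[OF that(2)]] by simp
qed

lemma csubring_sum: "csubring S \<Longrightarrow> (\<And>i. i \<in> A \<Longrightarrow> f i \<in> S) \<Longrightarrow> sum f A \<in> S"
  by (induction A rule: infinite_finite_induct) (auto intro: csubring_closed)

lemma csubring_prod: "csubring S \<Longrightarrow> (\<And>i. i \<in> A \<Longrightarrow> f i \<in> S) \<Longrightarrow> prod f A \<in> S"
  by (induction A rule: infinite_finite_induct) (auto intro: csubring_closed)

lemma csubring_power: "csubring S \<Longrightarrow> x \<in> S \<Longrightarrow> x ^ n \<in> S"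
  by (induction n) (auto intro: csubring_closed)

lemma csubring_of_nat: "csubring S \<Longrightarrow> of_nat n \<in> S"
  by (induction n) (auto intro: csubring_closed)

lemma csubring_of_int: "csubring S \<Longrightarrow> of_int n \<in> S"
  by (cases n) (auto intro!: csubring_closed csubring_of_nat simp del: of_nat_Suc)

lemma csubfield_csubring: "csubfield S \<Longrightarrow> csubring S"
  by (simp add: csubfield_def)

lemma csubfield_divide: "csubfield S \<Longrightarrow> x \<in> S \<Longrightarrow> y \<in> S \<Longrightarrow> x / y \<in> S"
  by (auto simp: csubfield_def divide_inverse intro: csubring_closed)

lemma Rats_subset_csubfield: "csubfield S \<Longrightarrow> \<rat> \<subseteq> S"
  by (auto elim!: Rats_cases' intro!: csubfield_divide csubring_of_int dest: csubfield_csubring)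

lemma csubring_Ints: "csubring \<int>" and csubfield_Rats: "csubfield \<rat>"
  by (auto simp: csubring_def csubfield_def)

lemma cnj_Rats: "q \<in> \<rat> \<Longrightarrow> cnj q = q"
  by (auto elim!: Rats_cases')

lemma poly_over_closed:
  assumes "csubring S"
  shows "poly_over S 0" "poly_over S 1" "poly_over S p \<Longrightarrow> poly_over S q \<Longrightarrow> poly_over S (p + q)"
    "poly_over S p \<Longrightarrow> poly_over S q \<Longrightarrow> poly_over S (p - q)"
    "poly_over S p \<Longrightarrow> poly_over S q \<Longrightarrow> poly_over S (p * q)"
    "poly_over S p \<Longrightarrow> c \<in> S \<Longrightarrow> poly_over S (smult c p)"
    "c \<in> S \<Longrightarrow> poly_over S (monom c n)"
    "poly_over S p \<Longrightarrow> c \<in> S \<Longrightarrow> poly_over S (pCons c p)"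
  using csubring_closed[OF assms]
  by (auto simp: poly_over_def coeff_mult coeff_pCons csubring_sum[OF assms] coeff_1
      split: nat.splits)

lemma poly_over_sum: "csubring S \<Longrightarrow> (\<And>i. i \<in> A \<Longrightarrow> poly_over S (f i)) \<Longrightarrow> poly_over S (sum f A)"
  by (induction A rule: infinite_finite_induct) (auto intro: poly_over_closed)

lemma poly_over_pcompose:
  assumes "csubring S" "poly_over S p" "poly_over S q"
  shows "poly_over S (pcompose p q)"
  using assms(2)
proof (induction p)
  case 0
  then show ?case using assms by (simp add: poly_over_closed)
next
  case (pCons a p)
  have "a \<in> S" using pCons.prems by (metis coeff_pCons_0 poly_over_def)
  moreover have "poly_over S p" using pCons.prems by (metis coeff_pCons_Suc poly_over_def)
  ultimately show ?case
    using pCons.IH assms by (auto simp: pcompose_pCons intro!: poly_over_closed)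
qed

lemma poly_over_mono: "poly_over S p \<Longrightarrow> S \<subseteq> T \<Longrightarrow> poly_over T p"
  by (auto simp: poly_over_def)

lemma poly_in_csubring:
  assumes "csubring S" "poly_over S p" "x \<in> S"
  shows "poly p x \<in> S"
  using assms by (auto simp: poly_altdef poly_over_def intro!: csubring_sum csubring_power csubring_closed)

lemma poly_over_division:
  assumes "csubfield K" "poly_over K h" "h \<noteq> 0"
  shows "poly_over K p \<Longrightarrow> \<exists>q r. poly_over K q \<and> poly_over K r \<and> p = q * h + r \<and> (r = 0 \<or> degree r < degree h)"
proof (induction "degree p" arbitrary: p rule: less_induct)
  case less
  note cl = poly_over_closed[OF csubfield_csubring[OF assms(1)]]
  show ?case
  proof (cases "p = 0 \<or> degree p < degree h")
    case True
    then show ?thesis using less.prems cl by (intro exI[of _ 0] exI[of _ p]) auto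
  next
    case False
    define c where "c = lead_coeff p / lead_coeff h"
    define m where "m = monom c (degree p - degree h)"
    have c: "c \<in> K" unfolding c_def
      using less.prems assms by (intro csubfield_divide) (auto simp: poly_over_def)
    then have m: "poly_over K m" using cl by (simp add: m_def)
    have c0: "c \<noteq> 0" using False assms by (auto simp: c_def)
    have "m \<noteq> 0" using c0 by (simp add: m_def)
    have "degree m = degree p - degree h" unfolding m_def by (rule degree_monom_eq[OF c0])
    with \<open>m \<noteq> 0\<close> have deg: "degree (m * h) = degree p" using False assms(3)
      by (simp add: degree_mult_eq)
    \<comment> \<open>the multiple \<open>m h\<close> cancels the leading term of \<open>p\<close>\<close>
    have lc: "coeff (m * h) (degree p) = coeff p (degree p)"
    proof -
      have "coeff (m * h) (degree p) = lead_coeff (m * h)" by (simp add: deg)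
      also have "\<dots> = c * lead_coeff h" 
        unfolding lead_coeff_mult by (simp add: m_def degree_monom_eq c0)
      finally show ?thesis using assms by (simp add: c_def)
    qed
    have p': "poly_over K (p - m * h)" using less.prems m assms cl by simp
    show ?thesis
    proof (cases "p - m * h = 0 \<or> degree h = 0 \<and> degree p = 0")
      case True
      then have "p = m * h"
      proof
        assume "degree h = 0 \<and> degree p = 0"
        then obtain a b where "h = [:a:]" "p = [:b:]" by (metis degree_eq_zeroE)
        then show ?thesis using assms(3) by (simp add: m_def c_def monom_0)
      qed simp
      then show ?thesis using m cl by (intro exI[of _ m] exI[of _ 0]) auto
    next
      case False
      have "degree (p - m * h) < degree p"
      proof (rule ccontr)
        assume "\<not> ?thesis"
        moreover have "degree (p - m * h) \<le> degree p" using deg by (metis degree_diff_le order_refl)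
        ultimately have "degree (p - m * h) = degree p" by simp
        then have "lead_coeff (p - m * h) = 0" using lc by simp
        then show False using False by (simp only: leading_coeff_0_iff) simp
      qed
      from less.hyps[OF this p'] obtain q r where
        "poly_over K q" "poly_over K r" "p - m * h = q * h + r" "r = 0 \<or> degree r < degree h" by blast
      then show ?thesis using m cl
        by (intro exI[of _ "q + m"] exI[of _ r]) (auto simp: algebra_simps)
    qed
  qed
qed

section \<open>Integrality\<close>

lemma monic_mult_minus_smaller:
  fixes p q r s :: "complex poly"
  assumes "degree p = d" "degree q = d" "lead_coeff p = 1" "lead_coeff q = 1" "degree r < d" "degree s < d"
  shows "degree (p * q - r * s) = 2 * d" "lead_coeff (p * q - r * s) = 1"
proof -
  have "degree (r * s) < 2 * d" using degree_mult_le[of r s] assms by linarith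
  moreover have "degree (p * q) = 2 * d" using assms by (subst degree_mult_eq) auto
  moreover have "coeff (p * q) (2 * d) = 1"
    using calculation assms by (metis lead_coeff_mult mult_1)
  ultimately have lt: "degree (- (r * s)) < degree (p * q)" and c: "coeff (p * q) (2 * d) = 1" by auto
  show "degree (p * q - r * s) = 2 * d"
    using degree_add_eq_left[OF lt] \<open>degree (p * q) = 2 * d\<close> by simp
  then show "lead_coeff (p * q - r * s) = 1"
    using c lt \<open>degree (p * q) = 2 * d\<close> by (simp add: coeff_eq_0)
qed

text \<open>
  Gaussian elimination without divisions, on a matrix with monic diagonal entries of degree \<open>d\<close> and
  off-diagonal entries of smaller degree. Replacing \<open>p\<^sub>i\<^sub>j\<close> by \<open>p\<^sub>i\<^sub>j p\<^sub>l\<^sub>l - p\<^sub>i\<^sub>l p\<^sub>l\<^sub>j\<close> removes the unknown \<open>v l\<close> and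
  preserves this shape with \<open>2 d\<close> in place of \<open>d\<close>. It plays the role of the Cayley-Hamilton theorem for
  matrices whose size is not a type.
\<close>

lemma fraction_free_elimination:
  fixes v :: "'i \<Rightarrow> complex"
  assumes S: "csubring S" and "finite I" "i0 \<notin> I" "d > 0"
    and "\<And>i j. i \<in> insert i0 I \<Longrightarrow> j \<in> insert i0 I \<Longrightarrow> poly_over S (p i j)"
    and "\<And>i. i \<in> insert i0 I \<Longrightarrow> lead_coeff (p i i) = 1 \<and> degree (p i i) = d"
    and "\<And>i j. i \<in> insert i0 I \<Longrightarrow> j \<in> insert i0 I \<Longrightarrow> i \<noteq> j \<Longrightarrow> degree (p i j) < d"
    and "\<And>i. i \<in> insert i0 I \<Longrightarrow> (\<Sum>j\<in>insert i0 I. poly (p i j) x * v j) = 0"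
  shows "\<exists>q. poly_over S q \<and> lead_coeff q = 1 \<and> poly q x * v i0 = 0"
  using assms(2-)
proof (induction I arbitrary: d p rule: finite_induct)
  case empty
  then show ?case by (intro exI[of _ "p i0 i0"]) auto
next
  case (insert l I)
  define p' where "p' i j = p i j * p l l - p i l * p l j" for i j
  have "\<exists>q. poly_over S q \<and> lead_coeff q = 1 \<and> poly q x * v i0 = 0"
  proof (rule insert.IH[of "2 * d" p'])
    show "i0 \<notin> I" "2 * d > 0" using insert by auto
    show "poly_over S (p' i j)" if "i \<in> Set.insert i0 I" "j \<in> Set.insert i0 I" for i j
      using that insert.prems(3) by (auto simp: p'_def intro!: poly_over_closed S)
    show "lead_coeff (p' i i) = 1 \<and> degree (p' i i) = 2 * d" if "i \<in> Set.insert i0 I" for i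
    proof -
      have "i \<noteq> l" using that insert.prems(1) insert.hyps by auto
      then have "degree (p i l) < d" "degree (p l i) < d" "lead_coeff (p i i) = 1" "degree (p i i) = d"
        "lead_coeff (p l l) = 1" "degree (p l l) = d" using that insert.prems(4,5) by auto
      then show ?thesis unfolding p'_def using monic_mult_minus_smaller by blast
    qed
    show "degree (p' i j) < 2 * d" if "i \<in> Set.insert i0 I" "j \<in> Set.insert i0 I" "i \<noteq> j" for i j
    proof -
      have "degree (p i j) < d" "degree (p l l) = d" "degree (p i l) < d" "degree (p l j) < d"
        using that insert.prems(1,4,5) insert.hyps by auto
      then show ?thesis unfolding p'_def
        using degree_mult_le[of "p i j" "p l l"] degree_mult_le[of "p i l" "p l j"]
        by (intro degree_diff_less) linarith+
    qed
    show "(\<Sum>j\<in>Set.insert i0 I. poly (p' i j) x * v j) = 0" if i: "i \<in> Set.insert i0 I" for i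
    proof -
      let ?J = "Set.insert i0 I"
      have e: "(\<Sum>j\<in>?J. poly (p i' j) x * v j) = - poly (p i' l) x * v l" if "i' \<in> Set.insert l ?J" for i'
      proof -
        have "Set.insert i0 (Set.insert l I) = Set.insert l ?J" by blast
        moreover have "l \<notin> ?J" using insert by auto
        ultimately show ?thesis
          using insert.prems(6)[of i'] that insert.hyps by (simp add: add_eq_0_iff)
      qed
      have "(\<Sum>j\<in>?J. poly (p' i j) x * v j) =
          poly (p l l) x * (\<Sum>j\<in>?J. poly (p i j) x * v j) - poly (p i l) x * (\<Sum>j\<in>?J. poly (p l j) x * v j)"
        unfolding sum_distrib_left sum_subtractf[symmetric] by (simp add: p'_def algebra_simps)
      then show ?thesis using e[of i] e[of l] i by simp
    qed
  qed
  then show ?case .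
qed

text \<open>
  The elimination above applied to \<open>x - c\<close>, where \<open>c\<close> is the matrix of the multiplication by \<open>x\<close> on the
  \<open>S\<close>-module spanned by the \<open>v i\<close>.
\<close>

lemma monic_root_if_eigenvalue:
  fixes v :: "'i \<Rightarrow> complex"
  assumes S: "csubring S" and "finite I" "i0 \<in> I" "v i0 \<noteq> 0"
    and "\<And>i. i \<in> I \<Longrightarrow> \<exists>c. (\<forall>j\<in>I. c j \<in> S) \<and> x * v i = (\<Sum>j\<in>I. c j * v j)"
  shows "\<exists>q. poly_over S q \<and> lead_coeff q = 1 \<and> poly q x = 0"
proof -
  from assms(5) obtain c where c: "\<And>i j. i \<in> I \<Longrightarrow> j \<in> I \<Longrightarrow> c i j \<in> S"
      "\<And>i. i \<in> I \<Longrightarrow> x * v i = (\<Sum>j\<in>I. c i j * v j)" by metis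
  define p where "p i j = (if i = j then [:- c i j, 1:] else [:- c i j:])" for i j
  define I' where "I' = I - {i0}"
  have I: "I = insert i0 I'" using assms(3) by (auto simp: I'_def)
  have "\<exists>q. poly_over S q \<and> lead_coeff q = 1 \<and> poly q x * v i0 = 0"
  proof (rule fraction_free_elimination[of S I' i0 1 p])
    show "finite I'" "i0 \<notin> I'" using assms by (auto simp: I'_def)
    show "(\<Sum>j\<in>insert i0 I'. poly (p i j) x * v j) = 0" if "i \<in> insert i0 I'" for i
    proof -
      have "poly (p i j) x * v j = (if j = i then x * v j else 0) - c i j * v j" for j
        by (simp add: p_def algebra_simps)
      then show ?thesis unfolding I[symmetric]
        using c(2)[of i] that assms(2) I by (simp add: sum_subtractf sum.delta)
    qed
  qed (use c I S in \<open>auto simp: p_def intro!: poly_over_closed csubring_closed\<close>)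
  then show ?thesis using assms(4) by auto
qed

lemma algebraic_int_if_eigenvalue:
  fixes v :: "'i \<Rightarrow> complex"
  assumes "finite I" "i0 \<in> I" "v i0 \<noteq> 0"
    and "\<And>i. i \<in> I \<Longrightarrow> \<exists>c. (\<forall>j\<in>I. c j \<in> \<int>) \<and> x * v i = (\<Sum>j\<in>I. c j * v j)"
  shows "algebraic_int x"
  using monic_root_if_eigenvalue[OF csubring_Ints assms] by (auto simp: poly_over_def intro: algebraic_int.intros)

lemma algebraic_int_power_reduce:
  fixes x :: complex
  assumes "algebraic_int x"
  obtains n c where "n > 0" "\<And>i. c i \<in> \<int>" "x ^ n = (\<Sum>i<n. c i * x ^ i)"
proof -
  from assms obtain p where p: "lead_coeff p = 1" "\<forall>i. coeff p i \<in> \<int>" "poly p x = 0"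
    by (auto elim: algebraic_int.cases)
  show ?thesis
  proof (rule that[of "degree p" "\<lambda>i. - coeff p i"])
    show "degree p > 0"
    proof (rule ccontr)
      assume "\<not> degree p > 0"
      then obtain a where "p = [:a:]" by (metis degree_eq_zeroE gr0I)
      then show False using p by simp
    qed
    have "poly p x = (\<Sum>i<degree p. coeff p i * x ^ i) + x ^ degree p"
      using p(1) by (simp add: poly_altdef lessThan_Suc_atMost[symmetric])
    then show "x ^ degree p = (\<Sum>i<degree p. - coeff p i * x ^ i)"
      using p(3) by (simp add: sum_negf eq_neg_iff_add_eq_0 add.commute)
  qed (use p in auto)
qed

text \<open>
  If \<open>x\<^sup>m\<close> and \<open>y\<^sup>n\<close> are integral combinations of lower powers, then \<open>x\<close> and \<open>y\<close>, and with them \<open>x + y\<close> and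
  \<open>x y\<close>, map the module \<open>L\<close> spanned over \<open>\<int>\<close> by the \<open>x\<^sup>i y\<^sup>j\<close> with \<open>i < m\<close> and \<open>j < n\<close> into itself.
\<close>

lemma algebraic_int_add_mult:
  fixes x y :: complex
  assumes "algebraic_int x" "algebraic_int y"
  shows "algebraic_int (x + y)" "algebraic_int (x * y)"
proof -
  obtain m a where a: "m > 0" "\<And>i. a i \<in> \<int>" "x ^ m = (\<Sum>i<m. a i * x ^ i)"
    using algebraic_int_power_reduce[OF assms(1)] by blast
  obtain n b where b: "n > 0" "\<And>i. b i \<in> \<int>" "y ^ n = (\<Sum>i<n. b i * y ^ i)"
    using algebraic_int_power_reduce[OF assms(2)] by blast
  define I where "I = {..<m} \<times> {..<n}"
  define v where "v = (\<lambda>(i, j). x ^ i * y ^ j)"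
  define L where "L = {z. \<exists>c. (\<forall>j\<in>I. c j \<in> \<int>) \<and> z = (\<Sum>j\<in>I. c j * v j)}"
  have fI: "finite I" by (simp add: I_def)
  have L_add: "z + w \<in> L" if zw: "z \<in> L" "w \<in> L" for z w
  proof -
    from zw obtain c d where "\<forall>j\<in>I. c j \<in> \<int>" "z = (\<Sum>j\<in>I. c j * v j)"
      "\<forall>j\<in>I. d j \<in> \<int>" "w = (\<Sum>j\<in>I. d j * v j)" by (auto simp: L_def)
    then show ?thesis unfolding L_def
      by (auto intro!: exI[of _ "\<lambda>j. c j + d j"] simp: sum.distrib algebra_simps)
  qed
  have L_cmult: "e * z \<in> L" if zw: "z \<in> L" "e \<in> \<int>" for z e
  proof -
    from zw obtain c where "\<forall>j\<in>I. c j \<in> \<int>" "z = (\<Sum>j\<in>I. c j * v j)" by (auto simp: L_def)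
    then show ?thesis using zw(2) unfolding L_def
      by (auto intro!: exI[of _ "\<lambda>j. e * c j"] simp: sum_distrib_left algebra_simps)
  qed
  have L_sum: "sum f A \<in> L" if "\<And>i. i \<in> A \<Longrightarrow> f i \<in> L" for f and A :: "nat set"
    using that
  proof (induction A rule: infinite_finite_induct)
    case (insert z A) then show ?case by (simp add: L_add)
  qed (auto simp: L_def intro!: exI[of _ "\<lambda>_. 0"])
  have L_v: "v i \<in> L" if i: "i \<in> I" for i
    using i fI unfolding L_def by (auto intro!: exI[of _ "\<lambda>j. if j = i then 1 else 0"] simp: if_distrib[of "\<lambda>t. t * _"] cong: if_cong)
  have xv: "x * v i \<in> L" if iI: "i \<in> I" for i
  proof -
    obtain i1 i2 where i: "i = (i1, i2)" "i1 < m" "i2 < n" using iI by (auto simp: I_def)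
    show ?thesis
    proof (cases "Suc i1 < m")
      case True
      then have "x * v i = v (Suc i1, i2)" by (simp add: v_def i)
      then show ?thesis using True i by (simp add: L_v I_def)
    next
      case False
      then have "Suc i1 = m" using i by simp
      then have "x * v i = x ^ m * y ^ i2" by (auto simp: v_def i)
      also have "\<dots> = (\<Sum>l<m. a l * v (l, i2))" by (simp add: a(3) v_def sum_distrib_right mult.assoc)
      finally show ?thesis using i a by (auto intro!: L_sum L_cmult L_v simp: I_def)
    qed
  qed
  have yv: "y * v i \<in> L" if iI: "i \<in> I" for i
  proof -
    obtain i1 i2 where i: "i = (i1, i2)" "i1 < m" "i2 < n" using iI by (auto simp: I_def)
    show ?thesis
    proof (cases "Suc i2 < n")
      case True
      then have "y * v i = v (i1, Suc i2)" by (simp add: v_def i)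
      then show ?thesis using True i by (simp add: L_v I_def)
    next
      case False
      then have "Suc i2 = n" using i by simp
      then have "y * v i = x ^ i1 * y ^ n" by (auto simp: v_def i)
      also have "\<dots> = (\<Sum>l<n. b l * v (i1, l))" by (simp add: b(3) v_def sum_distrib_left mult.left_commute)
      finally show ?thesis using i b by (auto intro!: L_sum L_cmult L_v simp: I_def)
    qed
  qed
  have L_y: "y * z \<in> L" if z: "z \<in> L" for z
  proof -
    from z obtain c where c: "\<forall>j\<in>I. c j \<in> \<int>" "z = (\<Sum>j\<in>I. c j * v j)" by (auto simp: L_def)
    then have "y * z = (\<Sum>j\<in>I. c j * (y * v j))" by (simp add: sum_distrib_left algebra_simps)
    moreover have "(\<Sum>j\<in>B. c j * (y * v j)) \<in> L" if "B \<subseteq> I" for B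
      using finite_subset[OF that fI] that
    proof (induction B rule: finite_induct)
      case empty then show ?case by (auto simp: L_def intro!: exI[of _ "\<lambda>_. 0"])
    next
      case (insert z B) then show ?case using c by (auto intro!: L_add L_cmult yv simp del: split_paired_All)
    qed
    ultimately show ?thesis by simp
  qed
  have i0: "(0, 0) \<in> I" "v (0, 0) \<noteq> 0" using a b by (auto simp: I_def v_def)
  show "algebraic_int (x + y)"
    using L_add[OF xv yv] by (intro algebraic_int_if_eigenvalue[where I = I and v = v, OF fI i0]) (auto simp: L_def algebra_simps)
  show "algebraic_int (x * y)"
    using L_y[OF xv] by (intro algebraic_int_if_eigenvalue[where I = I and v = v, OF fI i0]) (auto simp: L_def algebra_simps)
qed

lemma csubring_algebraic_int: "csubring {x. algebraic_int x}"
proof -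
  have "algebraic_int (x - y)" if "algebraic_int x" "algebraic_int y" for x y :: complex
    using algebraic_int_add_mult(1)[of x "- y"] that by auto
  then show ?thesis
    by (auto simp: csubring_def algebraic_int_add_mult)
qed

lemma algebraic_int_power_imp:
  fixes x :: complex
  assumes "algebraic_int (x ^ n)" "n > 0"
  shows "algebraic_int x"
  by (rule algebraic_int_root[OF assms(1), of "monom 1 n"]) (use assms in \<open>auto simp: poly_monom degree_monom_eq\<close>)

section \<open>Minimal polynomials and primitive elements\<close>

definition is_minpoly :: "complex set \<Rightarrow> complex poly \<Rightarrow> complex \<Rightarrow> bool" where
  "is_minpoly K m x \<longleftrightarrow> poly_over K m \<and> lead_coeff m = 1 \<and> poly m x = 0 \<and>
     (\<forall>p. poly_over K p \<and> poly p x = 0 \<and> degree p < degree m \<longrightarrow> p = 0)"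

lemma is_minpolyD:
  assumes "is_minpoly K m x"
  shows "poly_over K m" "lead_coeff m = 1" "poly m x = 0" "m \<noteq> 0" "degree m > 0"
    "poly_over K p \<Longrightarrow> poly p x = 0 \<Longrightarrow> degree p < degree m \<Longrightarrow> p = 0"
proof -
  show 1: "poly_over K m" "lead_coeff m = 1" "poly m x = 0"
    "poly_over K p \<Longrightarrow> poly p x = 0 \<Longrightarrow> degree p < degree m \<Longrightarrow> p = 0"
    using assms by (auto simp: is_minpoly_def)
  show 2: "m \<noteq> 0" using 1 by auto
  show "degree m > 0"
  proof (rule ccontr)
    assume "\<not> degree m > 0"
    then obtain a where "m = [:a:]" by (metis degree_eq_zeroE gr0I)
    then show False using 1 2 by simp
  qed
qed

lemma is_minpoly_exists:
  assumes K: "csubfield K" and "poly_over K p" "p \<noteq> 0" "poly p x = 0"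
  obtains m where "is_minpoly K m x" "degree m \<le> degree p"
proof -
  define P where "P q \<longleftrightarrow> poly_over K q \<and> q \<noteq> 0 \<and> poly q x = 0" for q
  define q where "q = arg_min degree P"
  have P: "P p" using assms by (simp add: P_def)
  have q: "P q" and q_min: "P r \<Longrightarrow> degree q \<le> degree r" for r
    unfolding q_def using P by (auto intro: arg_min_natI arg_min_nat_le)
  define m where "m = smult (inverse (lead_coeff q)) q"
  have lc: "lead_coeff q \<noteq> 0" using q by (simp add: P_def)
  have dm: "degree m = degree q" using lc by (simp add: m_def)
  have "is_minpoly K m x"
    unfolding is_minpoly_def
  proof (intro conjI allI impI)
    show "poly_over K m" unfolding m_def
      using q K by (intro poly_over_closed) (auto simp: P_def csubfield_def poly_over_def)
    show "lead_coeff m = 1" using lc by (simp add: m_def)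
    show "poly m x = 0" using q by (simp add: m_def P_def)
    show "r = 0" if "poly_over K r \<and> poly r x = 0 \<and> degree r < degree m" for r
      using q_min[of r] that dm by (auto simp: P_def)
  qed
  then show ?thesis using that q_min[OF P] dm by simp
qed

lemma is_minpoly_dvd:
  assumes K: "csubfield K" and m: "is_minpoly K m x" and p: "poly_over K p" "poly p x = 0"
  obtains q where "poly_over K q" "p = q * m"
proof -
  note mD = is_minpolyD[OF m]
  obtain q r where qr: "poly_over K q" "poly_over K r" "p = q * m + r" "r = 0 \<or> degree r < degree m"
    using poly_over_division[OF K mD(1,4) p(1)] by blast
  have "poly r x = 0" using qr(3) p mD(3) by simp
  then have "r = 0" using mD(6)[OF qr(2)] qr(4) by auto
  then show ?thesis using that qr by simp
qed

text \<open>
  A minimal polynomial is irreducible: if \<open>m = q n\<close> with \<open>n\<close> the minimal polynomial of the root \<open>z\<close>, then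
  \<open>q\<close> has smaller degree and cannot vanish at \<open>x\<close>, so \<open>n\<close> does.
\<close>

lemma is_minpoly_conjugate:
  assumes K: "csubfield K" and m: "is_minpoly K m x" and z: "poly m z = 0"
  shows "is_minpoly K m z"
proof -
  note mD = is_minpolyD[OF m]
  obtain n where n: "is_minpoly K n z" "degree n \<le> degree m"
    using is_minpoly_exists[OF K mD(1,4) z] by blast
  note nD = is_minpolyD[OF n(1)]
  obtain q where q: "poly_over K q" "m = q * n" using is_minpoly_dvd[OF K n(1) mD(1) z] by blast
  have "q \<noteq> 0" "n \<noteq> 0" using q mD(4) by auto
  then have deg: "degree m = degree q + degree n" using q by (simp add: degree_mult_eq)
  have "poly q x \<noteq> 0" using mD(6)[OF q(1)] deg nD(5) \<open>q \<noteq> 0\<close> by auto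
  then have "poly n x = 0" using mD(3) q by simp
  then have "degree n = degree m" using mD(6)[OF nD(1)] nD(4) n(2) by force
  then show ?thesis using nD mD z by (auto simp: is_minpoly_def)
qed

text \<open>
  The derivative has smaller degree, and \<open>m\<close> is also the minimal polynomial of its root \<open>z\<close>.
\<close>

lemma is_minpoly_simple_roots:
  assumes K: "csubfield K" and m: "is_minpoly K m x" and z: "poly m z = 0"
  shows "poly (pderiv m) z \<noteq> 0"
proof
  assume 0: "poly (pderiv m) z = 0"
  note mD = is_minpolyD[OF is_minpoly_conjugate[OF assms]]
  have "poly_over K (pderiv m)"
    using mD(1) csubfield_csubring[OF K] csubring_of_nat[of K]
    by (auto simp: poly_over_def coeff_pderiv simp del: of_nat_Suc intro!: csubring_closed)
  then have "pderiv m = 0" using mD(6)[OF _ 0] mD(5) by (simp add: degree_pderiv)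
  then show False using mD(5) by (simp add: pderiv_eq_0_iff)
qed

lemma is_minpoly_card_roots:
  assumes K: "csubfield K" and m: "is_minpoly K m x"
  shows "card {z. poly m z = 0} = degree m" "finite {z. poly m z = 0}"
proof -
  note mD = is_minpolyD[OF m]
  show fin: "finite {z. poly m z = 0}" using mD(4) by (rule poly_roots_finite)
  have "rsquarefree m" using is_minpoly_simple_roots[OF K m] by (auto simp: rsquarefree_roots)
  then have "m = (\<Prod>z|poly m z = 0. [:- z, 1:])"
    using complex_poly_decompose_rsquarefree[of m] mD(2) by simp
  then have "degree m = degree (\<Prod>z|poly m z = 0. [:- z, 1:])" by simp
  also have "\<dots> = (\<Sum>z|poly m z = 0. degree [:- z, 1:])" by (rule degree_prod_eq_sum_degree) auto
  finally show "card {z. poly m z = 0} = degree m" by simp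
qed

text \<open>
  The classical proof of the primitive element theorem: for generic \<open>c\<close>, the minimal polynomial of
  \<open>y\<close> over \<open>\<rat>(x + c y)\<close> divides both the minimal polynomial of \<open>y\<close> over \<open>\<rat>\<close> and a shifted minimal
  polynomial of \<open>x\<close>, and these have only the root \<open>y\<close> in common.
\<close>

lemma primitive_element_pair:
  assumes f: "is_minpoly \<rat> f x" and g: "is_minpoly \<rat> g y"
  obtains c :: nat where "\<And>K. csubfield K \<Longrightarrow> x + of_nat c * y \<in> K \<Longrightarrow> y \<in> K"
proof -
  \<comment> \<open>the values of \<open>c\<close> for which \<open>x + c y = a + c b\<close> for other conjugates \<open>a, b\<close>\<close>
  define Bad where "Bad = (\<lambda>(a, b). (a - x) / (y - b)) ` ({a. poly f a = 0} \<times> {b. poly g b = 0})"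
  have "finite Bad" unfolding Bad_def
    using is_minpoly_card_roots(2)[OF csubfield_Rats] f g by blast
  then have "finite {c::nat. of_nat c \<in> Bad}"
    using finite_vimageI[OF _ inj_of_nat, of Bad] by (simp add: vimage_def)
  then obtain c :: nat where c: "of_nat c \<notin> Bad"
    by (metis (no_types, lifting) ex_new_if_finite infinite_UNIV_nat mem_Collect_eq)
  have "y \<in> K" if K: "csubfield K" and t: "x + of_nat c * y \<in> K" for K
  proof -
    note R = csubfield_csubring[OF K]
    define t where "t = x + of_nat c * y"
    define f' where "f' = pcompose f [:t, - of_nat c:]"
    have RK: "\<rat> \<subseteq> K" by (rule Rats_subset_csubfield[OF K])
    have gK: "poly_over K g" and fK: "poly_over K f"
      using is_minpolyD(1)[OF f] is_minpolyD(1)[OF g] RK poly_over_mono by auto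
    have f'K: "poly_over K f'" unfolding f'_def
      using that(2) csubring_of_nat[OF R] poly_over_closed[OF R] csubring_closed[OF R]
      by (intro poly_over_pcompose[OF R fK]) (auto simp: t_def)
    have "poly f' y = 0" using is_minpolyD(3)[OF f] by (simp add: f'_def poly_pcompose t_def algebra_simps)
    obtain h where h: "is_minpoly K h y"
      using is_minpoly_exists[OF K gK] is_minpolyD(3,4)[OF g] by blast
    obtain q1 where q1: "g = q1 * h" using is_minpoly_dvd[OF K h gK] is_minpolyD(3)[OF g] by blast
    obtain q2 where q2: "f' = q2 * h" using is_minpoly_dvd[OF K h f'K \<open>poly f' y = 0\<close>] by blast
    have "{z. poly h z = 0} = {y}"
    proof (intro subset_antisym subsetI)
      fix b assume "b \<in> {z. poly h z = 0}"
      then have "poly g b = 0" "poly f (t - of_nat c * b) = 0"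
        using q1 q2 by (auto simp: f'_def poly_pcompose algebra_simps dest!: arg_cong[of _ _ "\<lambda>p. poly p b"])
      then have "(t - of_nat c * b - x) / (y - b) \<in> Bad"
        unfolding Bad_def by (intro image_eqI[of _ _ "(t - of_nat c * b, b)"]) auto
      moreover have "t - of_nat c * b - x = of_nat c * (y - b)" by (simp add: t_def algebra_simps)
      ultimately show "b \<in> {y}" using c by (auto simp: divide_simps split: if_splits)
    qed (use is_minpolyD(3)[OF h] in auto)
    then have "degree h = 1" using is_minpoly_card_roots(1)[OF K h] by simp
    then have "h = [:coeff h 0, 1:]"
      using is_minpolyD(2)[OF h] by (intro poly_eqI) (auto simp: coeff_pCons coeff_eq_0 split: nat.splits)
    then have "poly h y = coeff h 0 + y" by (metis mult.commute mult_1 poly_0 poly_pCons add.right_neutral mult_zero_right)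
    then have "y = - coeff h 0" using is_minpolyD(3)[OF h] by (simp add: eq_neg_iff_add_eq_0 add.commute)
    then show ?thesis using is_minpolyD(1)[OF h] csubring_closed(3)[OF R] by (simp add: poly_over_def)
  qed
  then show ?thesis using that by blast
qed

definition adjoin :: "complex \<Rightarrow> complex set" where
  "adjoin x = {poly p x | p. poly_over \<rat> p}"

lemma adjoin_least: "csubfield K \<Longrightarrow> x \<in> K \<Longrightarrow> adjoin x \<subseteq> K"
  using poly_over_mono[OF _ Rats_subset_csubfield]
  by (auto simp: adjoin_def intro!: poly_in_csubring csubfield_csubring)

lemma adjoin_self: "x \<in> adjoin x"
  by (auto simp: adjoin_def poly_over_def coeff_pCons split: nat.splits intro!: exI[of _ "[:0, 1:]"])

lemma csubring_adjoin: "csubring (adjoin x)"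
  unfolding csubring_def adjoin_def
proof (intro conjI ballI)
  note cl = poly_over_closed[OF csubfield_csubring[OF csubfield_Rats]]
  show "1 \<in> {poly p x |p. poly_over \<rat> p}" using cl(2) by (auto intro!: exI[of _ 1])
  show "a - b \<in> {poly p x |p. poly_over \<rat> p}" "a * b \<in> {poly p x |p. poly_over \<rat> p}"
    if "a \<in> {poly p x |p. poly_over \<rat> p}" "b \<in> {poly p x |p. poly_over \<rat> p}" for a b
    using that cl(4,5) by (auto simp flip: poly_diff poly_mult)
qed

text \<open>
  If \<open>a + x q(x) = 0\<close> with \<open>a \<noteq> 0\<close>, then the inverse of \<open>x\<close> is \<open>- q(x) / a\<close>.
\<close>

lemma csubring_inverse_algebraic:
  assumes S: "csubring S" "\<rat> \<subseteq> S" and x: "x \<in> S" and p: "poly_over \<rat> p" "p \<noteq> 0" "poly p x = 0"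
  shows "inverse x \<in> S"
proof (cases "x = 0")
  case False
  obtain m where m: "is_minpoly \<rat> m x" using is_minpoly_exists[OF csubfield_Rats p] by blast
  note mD = is_minpolyD[OF m]
  obtain a q where aq: "m = pCons a q" by (cases m)
  have Q: "a \<in> \<rat>" "poly_over \<rat> q" using mD(1) aq
    by (auto simp: poly_over_def coeff_pCons dest: spec[of _ 0] spec[of _ "Suc _"])
  have "q \<noteq> 0" using mD(5) aq by auto
  then have "poly q x \<noteq> 0" using mD(6)[OF Q(2)] aq by auto
  then have "a \<noteq> 0" using mD(3) aq False by auto
  have "x * (poly q x * inverse (- a)) = 1" using mD(3) aq \<open>a \<noteq> 0\<close>
    by (simp add: field_simps eq_neg_iff_add_eq_0 neg_eq_iff_add_eq_0 add.commute)
  then have "inverse x = poly q x * inverse (- a)" by (metis inverse_unique)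
  then show ?thesis using Q S x
    by (auto intro!: csubring_closed poly_in_csubring intro: poly_over_mono)
qed (use csubring_closed[OF S(1)] in auto)

text \<open>
  Generation is expressed by the subfields that contain \<open>t\<close>: in this form the two-generator case can be
  iterated, since \<open>y\<close> and \<open>t + c y\<close> give back \<open>t\<close>.
\<close>

lemma primitive_element_finite:
  assumes "csubring K" "finite B" "B \<subseteq> K" "\<And>x. x \<in> K \<Longrightarrow> \<exists>p. poly_over \<rat> p \<and> p \<noteq> 0 \<and> poly p x = 0"
  shows "\<exists>t\<in>K. \<forall>L. csubfield L \<and> t \<in> L \<longrightarrow> B \<subseteq> L"
  using assms(2,3)
proof (induction B rule: finite_induct)
  case empty
  then show ?case using csubring_closed(1)[OF assms(1)] by blast
next
  case (insert y B)
  then obtain t where t: "t \<in> K" "\<And>L. csubfield L \<Longrightarrow> t \<in> L \<Longrightarrow> B \<subseteq> L" by blast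
  obtain f g where "is_minpoly \<rat> f t" "is_minpoly \<rat> g y"
    using assms(4)[OF t(1)] assms(4)[of y] insert.prems is_minpoly_exists[OF csubfield_Rats] by (metis insert_subset)
  then obtain c :: nat where c: "\<And>L. csubfield L \<Longrightarrow> t + of_nat c * y \<in> L \<Longrightarrow> y \<in> L"
    using primitive_element_pair by blast
  show ?case
  proof (intro bexI[of _ "t + of_nat c * y"] allI impI)
    show "t + of_nat c * y \<in> K"
      using t insert.prems by (auto intro!: csubring_closed csubring_of_nat assms(1))
    fix L assume L: "csubfield L \<and> t + of_nat c * y \<in> L"
    then have y: "y \<in> L" using c by blast
    have R: "csubring L" using L csubfield_csubring by blast
    then have "of_nat c * y \<in> L" using y by (intro csubring_closed csubring_of_nat)
    then have "t + of_nat c * y - of_nat c * y \<in> L" using csubring_closed(5)[OF R] L by blast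
    then have "t \<in> L" by simp
    then show "Set.insert y B \<subseteq> L" using t(2) L y by simp
  qed
qed

lemma Rats_subset_adjoin: "\<rat> \<subseteq> adjoin x"
proof
  fix q :: complex assume "q \<in> \<rat>"
  then show "q \<in> adjoin x" unfolding adjoin_def
    by (auto intro!: exI[of _ "[:q:]"] simp: poly_over_def coeff_pCons split: nat.splits)
qed

lemma primitive_element:
  assumes K: "csubfield K" and alg: "\<And>x. x \<in> K \<Longrightarrow> \<exists>p. poly_over \<rat> p \<and> p \<noteq> 0 \<and> poly p x = 0"
    and B: "finite B" "B \<subseteq> K" "\<And>L. csubfield L \<Longrightarrow> B \<subseteq> L \<Longrightarrow> K \<subseteq> L"
  obtains t where "t \<in> K" "K = adjoin t"
proof -
  obtain t where t: "t \<in> K" "\<And>L. csubfield L \<Longrightarrow> t \<in> L \<Longrightarrow> B \<subseteq> L"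
    using primitive_element_finite[OF csubfield_csubring[OF K] B(1,2) alg] by blast
  have sub: "adjoin t \<subseteq> K" by (rule adjoin_least[OF K t(1)])
  have "csubfield (adjoin t)"
    unfolding csubfield_def
    using alg sub csubring_adjoin Rats_subset_adjoin by (meson csubring_inverse_algebraic subsetD)
  then have "K \<subseteq> adjoin t" using t(2) adjoin_self B(3) by blast
  then show ?thesis using that t sub by blast
qed

lemma clear_denominators:
  assumes "poly_over \<rat> p"
  obtains N :: nat where "N > 0" "poly_over \<int> (smult (of_nat N) p)"
proof -
  have "\<exists>N::nat. N > 0 \<and> poly_over \<int> (smult (of_nat N) p)"
    using assms
  proof (induction p)
    case 0
    then show ?case by (intro exI[of _ 1]) (simp add: poly_over_def)
  next
    case (pCons a p)
    have "poly_over \<rat> p" "a \<in> \<rat>" using pCons.prems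
      by (auto simp: poly_over_def coeff_pCons dest: spec[of _ 0] spec[of _ "Suc _"])
    then obtain N :: nat where N: "N > 0" "poly_over \<int> (smult (of_nat N) p)" using pCons.IH by blast
    obtain c d :: int where cd: "d > 0" "a = of_int c / of_int d" using \<open>a \<in> \<rat>\<close> by (metis Rats_cases')
    have "of_nat (nat d) * a = of_int c" using cd by simp
    then have e: "of_nat (N * nat d) * a = of_nat N * of_int c" by simp
    have "poly_over \<int> (pCons (of_nat (N * nat d) * a) (smult (of_nat (nat d)) (smult (of_nat N) p)))"
      using N(2) unfolding e by (intro poly_over_closed(8) poly_over_closed(6)[of _ "smult (of_nat N) p"] csubring_Ints) auto
    then show ?case using N cd by (intro exI[of _ "N * nat d"]) (simp add: mult.commute)
  qed
  then show ?thesis using that by blast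
qed

text \<open>
  If \<open>N m\<close> is integral for the minimal polynomial \<open>m\<close>, then \<open>N x\<close> maps the span of
  \<open>1, x, \<dots>, x\<^bsup>n - 1\<^esup>\<close> over \<open>\<int>\<close> into itself.
\<close>

lemma algebraic_integer_multiple:
  assumes p: "poly_over \<rat> p" "p \<noteq> 0" "poly p x = 0"
  obtains N :: nat where "N > 0" "algebraic_int (of_nat N * x)"
proof -
  obtain m where m: "is_minpoly \<rat> m x" using is_minpoly_exists[OF csubfield_Rats p] by blast
  note mD = is_minpolyD[OF m]
  obtain N :: nat where N: "N > 0" "poly_over \<int> (smult (of_nat N) m)" using clear_denominators[OF mD(1)] by blast
  define n where "n = degree m"
  have n: "n > 0" using mD by (simp add: n_def)
  have "algebraic_int (of_nat N * x)"
  proof (rule algebraic_int_if_eigenvalue[where I = "{..<n}" and v = "\<lambda>i. x ^ i" and ?i0.0 = 0])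
    fix i assume i: "i \<in> {..<n}"
    show "\<exists>c. (\<forall>j\<in>{..<n}. c j \<in> \<int>) \<and> of_nat N * x * x ^ i = (\<Sum>j\<in>{..<n}. c j * x ^ j)"
    proof (cases "Suc i < n")
      case True
      then show ?thesis
        by (intro exI[of _ "\<lambda>j. if j = Suc i then of_nat N else 0"]) (auto simp: if_distrib[of "\<lambda>t. t * _"] cong: if_cong)
    next
      case False
      have "poly m x = (\<Sum>j<n. coeff m j * x ^ j) + x ^ n"
        using mD(2) by (simp add: poly_altdef n_def lessThan_Suc_atMost[symmetric])
      then have e: "x ^ n = - (\<Sum>j<n. coeff m j * x ^ j)" using mD(3) by (simp add: eq_neg_iff_add_eq_0 add.commute)
      have "Suc i = n" using i False by simp
      then have "of_nat N * x * x ^ i = of_nat N * x ^ n" by auto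
      also have "\<dots> = (\<Sum>j<n. (- (of_nat N * coeff m j)) * x ^ j)"
        unfolding e by (simp add: sum_distrib_left sum_negf mult.assoc)
      finally show ?thesis using N(2)
        by (intro exI[of _ "\<lambda>j. - (of_nat N * coeff m j)"]) (simp add: poly_over_def)
    qed
  qed (use n in auto)
  then show ?thesis using that N by blast
qed

section \<open>Embeddings and integers of a number field with a chosen primitive element\<close>

text \<open>
  The constant coefficient of an integral polynomial of least degree that vanishes at \<open>x\<close> is nonzero and
  a multiple of \<open>x\<close>.
\<close>

lemma algebraic_int_cofactor:
  assumes S: "csubring S" "x \<in> S" and x: "algebraic_int x" "x \<noteq> 0"
  obtains w c where "w \<in> S" "c \<noteq> 0" "x * w = of_int c"
proof -
  define P where "P p \<longleftrightarrow> poly_over \<int> p \<and> p \<noteq> 0 \<and> poly p x = 0" for p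
  define p where "p = arg_min degree P"
  have "\<exists>p. P p" using x(1) by (auto simp: P_def poly_over_def elim!: algebraic_int.cases)
  then have p: "P p" and p_min: "P r \<Longrightarrow> degree p \<le> degree r" for r
    unfolding p_def by (auto intro: arg_min_natI arg_min_nat_le)
  obtain a q where aq: "p = pCons a q" by (cases p)
  have Z: "a \<in> \<int>" "poly_over \<int> q" using p aq
    by (auto simp: P_def poly_over_def coeff_pCons dest: spec[of _ 0] spec[of _ "Suc _"])
  have "a \<noteq> 0"
  proof
    assume "a = 0"
    then have "P q" using p aq Z x(2) by (auto simp: P_def)
    then show False using p_min[of q] aq by (auto simp: P_def)
  qed
  obtain c where c: "a = of_int c" using Z(1) by (auto elim: Ints_cases)
  have "\<int> \<subseteq> S" using csubring_of_int[OF S(1)] by (auto elim!: Ints_cases)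
  then have "- poly q x \<in> S"
    using Z(2) S poly_over_mono by (intro csubring_closed poly_in_csubring) auto
  moreover have "x * (- poly q x) = of_int c"
    using p aq c by (simp add: P_def eq_neg_iff_add_eq_0 neg_eq_iff_add_eq_0 add.commute)
  ultimately show ?thesis using that \<open>a \<noteq> 0\<close> c by auto
qed

lemma lagrange_interpolation:
  fixes p :: "complex poly"
  assumes "finite A" "degree p < card A"
  shows "p = (\<Sum>z\<in>A. smult (poly p z / (\<Prod>w\<in>A - {z}. z - w)) (\<Prod>w\<in>A - {z}. [:- w, 1:]))" (is "p = ?q")
proof (rule poly_eqI_degree)
  show "poly p x = poly ?q x" if "x \<in> A" for x
  proof -
    have "poly ?q x = (\<Sum>z\<in>A. if z = x then poly p x else 0)"
      unfolding poly_sum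
    proof (intro sum.cong refl)
      fix z assume "z \<in> A"
      have "(\<Prod>w\<in>A - {z}. x - w) = 0" if "z \<noteq> x"
        using that assms \<open>x \<in> A\<close> by auto
      moreover have "(\<Prod>w\<in>A - {x}. x - w) \<noteq> 0" using assms by auto
      ultimately show "poly (smult (poly p z / (\<Prod>w\<in>A - {z}. z - w)) (\<Prod>w\<in>A - {z}. [:- w, 1:])) x =
          (if z = x then poly p x else 0)"
        by (auto simp: poly_prod)
    qed
    then show ?thesis using assms that by simp
  qed
  show "degree p < card A" by fact
  have A: "card A > 0" using assms by simp
  have "degree ?q \<le> card A - 1"
  proof (intro degree_sum_le assms)
    fix z assume "z \<in> A"
    have "degree (\<Prod>w\<in>A - {z}. [:- w, 1:]) \<le> (\<Sum>w\<in>A - {z}. degree [:- w, 1:])"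
      using degree_prod_sum_le[of "A - {z}" "\<lambda>w. [:- w, 1:]"] assms by (simp add: o_def)
    then show "degree (smult (poly p z / (\<Prod>w\<in>A - {z}. z - w)) (\<Prod>w\<in>A - {z}. [:- w, 1:])) \<le> card A - 1"
      using assms \<open>z \<in> A\<close> by (intro order_trans[OF degree_smult_le]) simp
  qed
  then show "degree ?q < card A" using A by simp
qed

text \<open>
  A number field with an integral primitive element. The roots of \<open>m\<close> parametrise the embeddings into \<open>\<complex>\<close>:
  the embedding that belongs to \<open>z\<close> evaluates at \<open>z\<close> the polynomial that represents an element.
\<close>

locale primitive_field =
  fixes k :: "complex set" and \<theta> :: complex and m :: "complex poly"
  assumes k_eq: "k = adjoin \<theta>" and int_theta: "algebraic_int \<theta>" and minpoly: "is_minpoly \<rat> m \<theta>"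
begin

definition conjugates :: "complex set" where "conjugates = {z. poly m z = 0}"

definition rep :: "complex \<Rightarrow> complex poly" where
  "rep x = (SOME p. poly_over \<rat> p \<and> degree p < degree m \<and> poly p \<theta> = x)"

definition emb :: "complex \<Rightarrow> complex \<Rightarrow> complex" where
  "emb z x = poly (rep x) z"

lemmas mD = is_minpolyD[OF minpoly]

lemma finite_conjugates: "finite conjugates" and card_conjugates: "card conjugates = degree m"
  using is_minpoly_card_roots[OF csubfield_Rats minpoly] by (auto simp: conjugates_def)

lemma theta_conjugate: "\<theta> \<in> conjugates"
  using mD(3) by (simp add: conjugates_def)

lemma rep: "poly_over \<rat> (rep x)" "degree (rep x) < degree m" "poly (rep x) \<theta> = x" if x: "x \<in> k"
proof -
  obtain p where p: "poly_over \<rat> p" "poly p \<theta> = x" using x by (auto simp: k_eq adjoin_def)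
  obtain q r where qr: "poly_over \<rat> r" "p = q * m + r" "r = 0 \<or> degree r < degree m"
    using poly_over_division[OF csubfield_Rats mD(1,4) p(1)] by blast
  have "poly r \<theta> = x" "degree r < degree m" using qr p mD(3,5) by auto
  then have "\<exists>p. poly_over \<rat> p \<and> degree p < degree m \<and> poly p \<theta> = x" using qr(1) by blast
  from someI_ex[OF this] show "poly_over \<rat> (rep x)" "degree (rep x) < degree m" "poly (rep x) \<theta> = x"
    by (auto simp: rep_def)
qed

lemma poly_theta_in: "poly_over \<rat> p \<Longrightarrow> poly p \<theta> \<in> k"
  by (auto simp: k_eq adjoin_def)

lemma csubring_k: "csubring k"
  by (simp add: k_eq csubring_adjoin)

lemma theta_in_k: "\<theta> \<in> k"
  by (simp add: k_eq adjoin_self)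

lemma emb_poly:
  assumes z: "z \<in> conjugates" and p: "poly_over \<rat> p"
  shows "emb z (poly p \<theta>) = poly p z"
proof -
  note r = rep[OF poly_theta_in[OF p]]
  have "poly_over \<rat> (p - rep (poly p \<theta>))"
    using p r by (intro poly_over_closed csubfield_csubring csubfield_Rats)
  moreover have "poly (p - rep (poly p \<theta>)) \<theta> = 0" using r by simp
  ultimately obtain q where "p - rep (poly p \<theta>) = q * m"
    using is_minpoly_dvd[OF csubfield_Rats minpoly] by blast
  then have "poly (p - rep (poly p \<theta>)) z = 0" using z by (simp add: conjugates_def)
  then show ?thesis by (simp add: emb_def)
qed

lemma emb_theta_id: "x \<in> k \<Longrightarrow> emb \<theta> x = x"
  by (simp add: emb_def rep)

lemma emb_theta: "z \<in> conjugates \<Longrightarrow> emb z \<theta> = z"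
  using emb_poly[of z "[:0, 1:]"] by (simp add: poly_over_def coeff_pCons split: nat.splits)

lemma emb_rat: "z \<in> conjugates \<Longrightarrow> q \<in> \<rat> \<Longrightarrow> emb z q = q"
  using emb_poly[of z "[:q:]"] by (simp add: poly_over_def coeff_pCons split: nat.splits)

lemma emb_hom:
  assumes z: "z \<in> conjugates" and "x \<in> k" "y \<in> k"
  shows "emb z (x + y) = emb z x + emb z y" "emb z (x - y) = emb z x - emb z y"
    "emb z (x * y) = emb z x * emb z y"
proof -
  note cl = poly_over_closed[OF csubfield_csubring[OF csubfield_Rats]]
  note r = rep[OF assms(2)] rep[OF assms(3)]
  show "emb z (x + y) = emb z x + emb z y" "emb z (x - y) = emb z x - emb z y"
    "emb z (x * y) = emb z x * emb z y"
    using emb_poly[OF z cl(3)[OF r(1,4)]] emb_poly[OF z cl(4)[OF r(1,4)]] emb_poly[OF z cl(5)[OF r(1,4)]] r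
    by (auto simp: emb_def)
qed

lemma emb_sum:
  assumes z: "z \<in> conjugates"
  shows "(\<And>i. i \<in> A \<Longrightarrow> f i \<in> k) \<Longrightarrow> emb z (sum f A) = (\<Sum>i\<in>A. emb z (f i))"
proof (induction A rule: infinite_finite_induct)
  case (insert a A)
  then show ?case by (simp add: emb_hom(1)[OF z] csubring_sum[OF csubring_k])
qed (auto simp: emb_rat[OF z])

lemma emb_integral:
  assumes z: "z \<in> conjugates" and x: "x \<in> k" "algebraic_int x"
  shows "algebraic_int (emb z x)"
proof -
  obtain p where p: "lead_coeff p = 1" "\<forall>i. coeff p i \<in> \<int>" "poly p x = 0"
    using x(2) by (auto elim: algebraic_int.cases)
  have pQ: "poly_over \<rat> p" unfolding poly_over_def
    using p(2) by (metis Ints_cases Rats_of_int)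
  note r = rep[OF x(1)]
  have "poly_over \<rat> (pcompose p (rep x))"
    by (rule poly_over_pcompose[OF csubfield_csubring[OF csubfield_Rats] pQ r(1)])
  from emb_poly[OF z this] have "emb z 0 = poly p (emb z x)" using r(3) p(3) by (simp add: poly_pcompose emb_def)
  then have "poly p (emb z x) = 0" using emb_rat[OF z] by simp
  then show ?thesis using p by (auto intro: algebraic_int.intros)
qed

lemma rep_interpolation:
  assumes x: "x \<in> k"
  shows "rep x = (\<Sum>z\<in>conjugates. smult (emb z x / (\<Prod>w\<in>conjugates - {z}. z - w)) (\<Prod>w\<in>conjugates - {z}. [:- w, 1:]))"
  unfolding emb_def using rep(2)[OF x] by (intro lagrange_interpolation finite_conjugates) (simp add: card_conjugates)

text \<open>
  By interpolation through the conjugates, the coefficients of \<open>rep x\<close> become algebraic integers after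
  multiplication by the product \<open>D\<close> of the differences of conjugates. A multiple \<open>N\<close> of \<open>D\<close> is a rational
  integer, and rational algebraic integers are integers.
\<close>

lemma common_denominator:
  obtains N :: int where "N \<noteq> 0" "\<And>x i. x \<in> k \<Longrightarrow> algebraic_int x \<Longrightarrow> of_int N * coeff (rep x) i \<in> \<int>"
proof -
  let ?AI = "{x::complex. algebraic_int x}"
  let ?d = "\<lambda>z. \<Prod>w\<in>conjugates - {z}. z - w"
  note AI = csubring_algebraic_int
  define D where "D = (\<Prod>z\<in>conjugates. ?d z)"
  have conj_int: "z \<in> ?AI" if "z \<in> conjugates" for z
    using emb_integral[OF that theta_in_k int_theta] emb_theta[OF that] by simp
  have d: "?d z \<in> ?AI" if "z \<in> conjugates" for z
    using that conj_int by (intro csubring_prod[OF AI] csubring_closed[OF AI]) auto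
  have D: "D \<in> ?AI" unfolding D_def by (intro csubring_prod[OF AI] d)
  have "D \<noteq> 0" using finite_conjugates by (simp add: D_def)
  then obtain w N where w: "w \<in> ?AI" "N \<noteq> 0" "D * w = of_int N"
    using algebraic_int_cofactor[OF AI D] D by blast
  have "of_int N * coeff (rep x) i \<in> \<int>" if x: "x \<in> k" "algebraic_int x" for x i
  proof -
    have "D * coeff (rep x) i = (\<Sum>z\<in>conjugates. emb z x * (\<Prod>z'\<in>conjugates - {z}. ?d z') *
        coeff (\<Prod>w\<in>conjugates - {z}. [:- w, 1:]) i)"
    proof -
      have "D / ?d z = (\<Prod>z'\<in>conjugates - {z}. ?d z')" if "z \<in> conjugates" for z
        using that finite_conjugates by (simp add: D_def prod.remove[OF finite_conjugates that])
      then have "D * (emb z x / ?d z * c) = emb z x * (\<Prod>z'\<in>conjugates - {z}. ?d z') * c" if "z \<in> conjugates" for z c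
        using that by (metis (no_types, lifting) mult.assoc mult.commute times_divide_eq_right)
      then show ?thesis
        by (subst rep_interpolation[OF x(1)]) (simp only: coeff_sum coeff_smult sum_distrib_left cong: sum.cong)
    qed
    also have "\<dots> \<in> ?AI"
    proof (intro csubring_sum[OF AI] csubring_closed[OF AI] csubring_prod[OF AI])
      fix z assume z: "z \<in> conjugates"
      show "emb z x \<in> ?AI" using emb_integral[OF z] x by simp
      have "poly_over ?AI (\<Prod>w\<in>B. [:- w, 1:])" if "finite B" "B \<subseteq> conjugates" for B
        using that
      proof (induction B rule: finite_induct)
        case (insert w B)
        then have "poly_over ?AI [:- w, 1:]"
          using conj_int[of w] by (intro poly_over_closed[OF AI] csubring_closed[OF AI]) auto
        then show ?case using insert by (simp add: poly_over_closed(5)[OF AI] del: mult_pCons_left)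
      qed (simp add: poly_over_closed(2)[OF AI])
      then show "coeff (\<Prod>w\<in>conjugates - {z}. [:- w, 1:]) i \<in> ?AI"
        using finite_conjugates by (auto simp: poly_over_def)
    qed (use conj_int in auto)
    finally have "w * (D * coeff (rep x) i) \<in> ?AI" using w(1) csubring_closed(6)[OF AI] by blast
    moreover have "w * (D * coeff (rep x) i) = of_int N * coeff (rep x) i" by (simp add: w(3)[symmetric])
    ultimately have "algebraic_int (of_int N * coeff (rep x) i)" by simp
    moreover have "of_int N * coeff (rep x) i \<in> \<rat>" using rep(1)[OF x(1)] by (auto simp: poly_over_def)
    ultimately show ?thesis by (intro rational_algebraic_int_is_int)
  qed
  then show ?thesis using that w(2) by blast
qed

lemma finite_bounded_coeffs:
  assumes N: "N \<noteq> (0::int)"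
  shows "finite {x \<in> k. \<forall>i. of_int N * coeff (rep x) i \<in> \<int> \<and> cmod (coeff (rep x) i) \<le> B}"
proof -
  define L :: "complex set" where "L = {of_int a / of_int N | a::int. \<bar>of_int a\<bar> \<le> \<bar>of_int N\<bar> * B}"
  have "finite {a::int. \<bar>of_int a\<bar> \<le> \<bar>of_int N\<bar> * B}"
    by (rule finite_subset[of _ "{- \<lceil>\<bar>of_int N\<bar> * B\<rceil> .. \<lceil>\<bar>of_int N\<bar> * B\<rceil>}"]) (auto, linarith+)
  then have "finite L" unfolding L_def by (simp add: setcompr_eq_image)
  then have "finite (PiE {..<degree m} (\<lambda>_. L))" by (intro finite_PiE) auto
  moreover have "{x \<in> k. \<forall>i. of_int N * coeff (rep x) i \<in> \<int> \<and> cmod (coeff (rep x) i) \<le> B} \<subseteq>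
      (\<lambda>c. \<Sum>i<degree m. c i * \<theta> ^ i) ` PiE {..<degree m} (\<lambda>_. L)"
  proof
    fix x assume x: "x \<in> {x \<in> k. \<forall>i. of_int N * coeff (rep x) i \<in> \<int> \<and> cmod (coeff (rep x) i) \<le> B}"
    have "coeff (rep x) i \<in> L" for i
    proof -
      obtain a where a: "of_int N * coeff (rep x) i = of_int a" using x by (auto elim: Ints_cases)
      then have e: "coeff (rep x) i = of_int a / of_int N" using N by (simp add: field_simps)
      have "\<bar>of_int a\<bar> \<le> \<bar>of_int N\<bar> * B"
      proof -
        have "\<bar>of_int a\<bar> = cmod (of_int N * coeff (rep x) i)" unfolding a by simp
        also have "\<dots> = \<bar>of_int N\<bar> * cmod (coeff (rep x) i)" by (simp add: norm_mult)
        also have "\<dots> \<le> \<bar>of_int N\<bar> * B" using x by (intro mult_left_mono) auto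
        finally show ?thesis .
      qed
      then show ?thesis using e by (auto simp: L_def)
    qed
    moreover have "x = (\<Sum>i<degree m. coeff (rep x) i * \<theta> ^ i)"
    proof -
      have xk: "x \<in> k" using x by blast
      have "x = poly (rep x) \<theta>" using rep(3)[OF xk] by simp
      also have "\<dots> = (\<Sum>i\<le>degree (rep x). coeff (rep x) i * \<theta> ^ i)" by (rule poly_altdef)
      also have "\<dots> = (\<Sum>i<degree m. coeff (rep x) i * \<theta> ^ i)"
        using rep(2)[OF xk] by (intro sum.mono_neutral_left) (auto simp: coeff_eq_0)
      finally show ?thesis .
    qed
    ultimately show "x \<in> (\<lambda>c. \<Sum>i<degree m. c i * \<theta> ^ i) ` PiE {..<degree m} (\<lambda>_. L)"
      by (intro image_eqI[of _ _ "restrict (coeff (rep x)) {..<degree m}"]) auto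
  qed
  ultimately show ?thesis using finite_surj by blast
qed

text \<open>
  Bounds at all places bound the coefficients of \<open>rep x\<close>, again by interpolation, and these have a common
  denominator.
\<close>

lemma finite_integers_bounded:
  "finite {x \<in> k. algebraic_int x \<and> (\<forall>z\<in>conjugates. cmod (emb z x) \<le> B)}"
proof -
  obtain N :: int where N: "N \<noteq> 0" "\<And>x i. x \<in> k \<Longrightarrow> algebraic_int x \<Longrightarrow> of_int N * coeff (rep x) i \<in> \<int>"
    using common_denominator by blast
  define b where "b i z = cmod (coeff (smult (1 / (\<Prod>w\<in>conjugates - {z}. z - w)) (\<Prod>w\<in>conjugates - {z}. [:- w, 1:])) i)" for i z
  define C where "C = (\<Sum>i<degree m. \<Sum>z\<in>conjugates. b i z)"
  have b0: "b i z \<ge> 0" for i z by (simp add: b_def)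
  have "cmod (coeff (rep x) i) \<le> \<bar>B\<bar> * C" if x: "x \<in> k" and bd: "\<forall>z\<in>conjugates. cmod (emb z x) \<le> B" for x i
  proof (cases "i < degree m")
    case True
    have "coeff (rep x) i = (\<Sum>z\<in>conjugates. emb z x * coeff (smult (1 / (\<Prod>w\<in>conjugates - {z}. z - w)) (\<Prod>w\<in>conjugates - {z}. [:- w, 1:])) i)"
      by (subst rep_interpolation[OF x]) (simp add: coeff_sum)
    also have "cmod \<dots> \<le> (\<Sum>z\<in>conjugates. \<bar>B\<bar> * b i z)"
    proof (rule sum_norm_le)
      fix z assume z: "z \<in> conjugates"
      have "cmod (emb z x) \<le> \<bar>B\<bar>" using bd z by force
      then show "cmod (emb z x * coeff (smult (1 / (\<Prod>w\<in>conjugates - {z}. z - w)) (\<Prod>w\<in>conjugates - {z}. [:- w, 1:])) i) \<le> \<bar>B\<bar> * b i z"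
        unfolding b_def norm_mult by (intro mult_right_mono) auto
    qed
    also have "\<dots> = \<bar>B\<bar> * (\<Sum>z\<in>conjugates. b i z)" by (simp add: sum_distrib_left)
    also have "\<dots> \<le> \<bar>B\<bar> * C" unfolding C_def using True b0
      by (intro mult_left_mono member_le_sum) (auto intro: sum_nonneg)
    finally show ?thesis .
  next
    case False
    then have "coeff (rep x) i = 0" using rep(2)[OF x] by (simp add: coeff_eq_0)
    moreover have "C \<ge> 0" unfolding C_def using b0 by (intro sum_nonneg) auto
    ultimately show ?thesis by simp
  qed
  then show ?thesis
    using N(2) by (intro finite_subset[OF _ finite_bounded_coeffs[OF N(1), of "\<bar>B\<bar> * C"]]) auto
qed

text \<open>
  Subtracting the integral parts of the coefficients leaves an integer with coefficients in \<open>[0, 1)\<close>, and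
  there are only finitely many of these.
\<close>

lemma ring_of_integers_finitely_generated:
  obtains G where "finite G" "G \<subseteq> ring_of_integers k"
    "\<And>x. x \<in> ring_of_integers k \<Longrightarrow> \<exists>c :: complex \<Rightarrow> int. x = (\<Sum>g\<in>G. of_int (c g) * g)"
proof -
  obtain N :: int where N: "N \<noteq> 0" "\<And>x i. x \<in> k \<Longrightarrow> algebraic_int x \<Longrightarrow> of_int N * coeff (rep x) i \<in> \<int>"
    using common_denominator by blast
  define F where "F = {x \<in> k. algebraic_int x \<and> (\<forall>i. cmod (coeff (rep x) i) \<le> 1)}"
  define T where "T = (\<lambda>i. \<theta> ^ i) ` {..<degree m}"
  have F: "finite F"
    using N(2) unfolding F_def by (intro finite_subset[OF _ finite_bounded_coeffs[OF N(1), of 1]]) auto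
  let ?S = "k \<inter> {x. algebraic_int x}"
  have S: "csubring ?S" using csubring_k csubring_algebraic_int by (auto simp: csubring_def)
  have thS: "\<theta> ^ i \<in> ?S" for i using csubring_power[OF S, of \<theta>] theta_in_k int_theta by blast
  have inj: "inj_on (\<lambda>i. \<theta> ^ i) {..<degree m}"
  proof (rule inj_onI, rule ccontr)
    fix i j assume ij: "i \<in> {..<degree m}" "j \<in> {..<degree m}" "\<theta> ^ i = \<theta> ^ j" "i \<noteq> j"
    let ?p = "monom 1 i - monom 1 j :: complex poly"
    have "poly_over \<rat> ?p" by (intro poly_over_closed csubfield_csubring[OF csubfield_Rats]) auto
    moreover have "degree ?p < degree m" using ij degree_monom_le[of "1::complex"] by (intro degree_diff_less) (auto simp: degree_monom_eq)
    moreover have "poly ?p \<theta> = 0" using ij by (simp add: poly_monom)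
    ultimately have "?p = 0" using mD(6) by blast
    then show False using ij(4) by (metis coeff_monom eq_iff_diff_eq_0 zero_neq_one)
  qed
  show ?thesis
  proof (rule that[of "F \<union> T"])
    show "finite (F \<union> T)" "F \<union> T \<subseteq> ring_of_integers k"
      using F thS by (auto simp: T_def F_def ring_of_integers_def)
    fix x assume x: "x \<in> ring_of_integers k"
    then have xk: "x \<in> k" and xi: "algebraic_int x" by (auto simp: ring_of_integers_def)
    define fl where "fl i = \<lfloor>Re (coeff (rep x) i)\<rfloor>" for i
    define y where "y = x - (\<Sum>i<degree m. of_int (fl i) * \<theta> ^ i)"
    have yS: "y \<in> ?S" unfolding y_def
      using xk xi thS by (intro csubring_closed[OF S] csubring_sum[OF S] csubring_of_int[OF S]) auto
    have p: "rep y = rep x - (\<Sum>i<degree m. monom (of_int (fl i)) i)"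
    proof (rule ccontr)
      let ?p = "rep y - (rep x - (\<Sum>i<degree m. monom (of_int (fl i)) i))"
      assume "rep y \<noteq> rep x - (\<Sum>i<degree m. monom (of_int (fl i)) i)"
      then have "?p \<noteq> 0" by simp
      moreover have "poly_over \<rat> ?p" using rep(1)[OF xk] rep(1)[of y] yS
        by (intro poly_over_closed csubfield_csubring[OF csubfield_Rats] poly_over_sum) auto
      moreover have "degree (\<Sum>i<degree m. monom (of_int (fl i)) i :: complex poly) < degree m"
        using mD(5) by (intro degree_sum_less) (auto intro: le_less_trans[OF degree_monom_le])
      then have "degree ?p < degree m" using rep(2)[OF xk] rep(2)[of y] yS by (intro degree_diff_less) auto
      moreover have "poly ?p \<theta> = 0" using rep(3)[OF xk] rep(3)[of y] yS by (simp add: y_def poly_sum poly_monom)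
      ultimately show False using mD(6) by blast
    qed
    have "y \<in> F"
      unfolding F_def
    proof (intro CollectI conjI allI)
      fix i
      have c: "coeff (rep y) i = (if i < degree m then coeff (rep x) i - of_int (fl i) else coeff (rep x) i)"
        unfolding p by (simp add: coeff_sum if_distrib cong: if_cong)
      have "\<rat> \<subseteq> (\<real> :: complex set)" by (auto elim!: Rats_cases')
      then have "coeff (rep x) i \<in> \<real>" using rep(1)[OF xk] by (auto simp: poly_over_def)
      then obtain q where q: "coeff (rep x) i = of_real q" by (auto elim: Reals_cases)
      show "cmod (coeff (rep y) i) \<le> 1"
      proof (cases "i < degree m")
        case True
        have "coeff (rep y) i = of_real (q - of_int \<lfloor>q\<rfloor>)" using c True q by (simp add: fl_def)
        then have "cmod (coeff (rep y) i) = \<bar>q - of_int \<lfloor>q\<rfloor>\<bar>" by (simp only: norm_of_real)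
        then show ?thesis by linarith
      next
        case False
        then show ?thesis using c rep(2)[OF xk] by (simp add: coeff_eq_0)
      qed
    qed (use yS in auto)
    define d :: "complex \<Rightarrow> int" where "d g = (if g \<in> T then fl (the_inv_into {..<degree m} (\<lambda>i. \<theta> ^ i) g) else 0)" for g
    have "(\<Sum>i<degree m. of_int (fl i) * \<theta> ^ i) = (\<Sum>g\<in>T. of_int (d g) * g)"
      unfolding T_def sum.reindex[OF inj]
      by (intro sum.cong refl) (simp add: d_def T_def the_inv_into_f_f[OF inj])
    also have "\<dots> = (\<Sum>g\<in>F \<union> T. of_int (d g) * g)"
      using F by (intro sum.mono_neutral_left) (auto simp: d_def T_def)
    also have "y = (\<Sum>g\<in>F \<union> T. of_int (if g = y then 1 else 0) * g)"
      using F \<open>y \<in> F\<close> by (simp add: if_distrib[of "\<lambda>t. of_int t * _"] T_def cong: if_cong)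
    ultimately have "x = (\<Sum>g\<in>F \<union> T. of_int ((if g = y then 1 else 0) + d g) * g)"
      by (simp add: y_def sum.distrib algebra_simps)
    then show "\<exists>c :: complex \<Rightarrow> int. x = (\<Sum>g\<in>F \<union> T. of_int (c g) * g)"
      by (intro exI[of _ "\<lambda>g. (if g = y then 1 else 0) + d g"])
  qed
qed

end

section \<open>A pigeonhole principle for integer points\<close>

lemma card_bounded_ints:
  assumes "x \<ge> 0"
  shows "finite {a::int. \<bar>of_int a\<bar> \<le> x}" "real (card {a::int. \<bar>of_int a\<bar> \<le> x}) \<le> 2 * x + 1"
proof -
  have e: "{a::int. \<bar>of_int a\<bar> \<le> x} = {- \<lfloor>x\<rfloor>..\<lfloor>x\<rfloor>}"
    by (auto simp: abs_le_iff le_floor_iff) linarith+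
  show "finite {a::int. \<bar>of_int a\<bar> \<le> x}" unfolding e by simp
  have "real (card {a::int. \<bar>of_int a\<bar> \<le> x}) = real_of_int (2 * \<lfloor>x\<rfloor> + 1)"
    unfolding e using assms by simp
  also have "\<dots> \<le> 2 * x + 1" by simp
  finally show "real (card {a::int. \<bar>of_int a\<bar> \<le> x}) \<le> 2 * x + 1" .
qed

text \<open>
  A volume-free form of Minkowski's theorem. There are \<open>N\<^sup>n\<close> points \<open>s\<close>, where \<open>n\<close> is the cardinality of
  \<open>I\<close> and of \<open>J\<close>. The values of \<open>G j\<close> fill at most about \<open>2 C N / \<delta> j\<close> cells of side \<open>\<delta> j\<close>, so for
  large \<open>N\<close> the number of boxes is about \<open>N\<^sup>n \<Prod> (2 C / \<delta> j) \<le> N\<^sup>n / 2\<^sup>n\<close>, and two points share a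
  box. Arbitrary functions \<open>G j\<close> are allowed, bounded up to a constant \<open>E j\<close>, in order to cover skewed
  boxes, whose position in one direction depends on the cell in another one.
\<close>

lemma pigeonhole_boxes:
  fixes G :: "'j \<Rightarrow> ('i \<Rightarrow> nat) \<Rightarrow> real"
  assumes fin: "finite I" "finite J" and card: "card J = card I" "card I > 0"
    and pos: "C > 0" "\<And>j. j \<in> J \<Longrightarrow> \<delta> j > 0" "\<And>j. j \<in> J \<Longrightarrow> E j \<ge> 0"
    and vol: "(\<Prod>j\<in>J. \<delta> j) \<ge> (4 * C) ^ card J"
    and bd: "\<And>N s j. s \<in> PiE I (\<lambda>_. {..<N}) \<Longrightarrow> j \<in> J \<Longrightarrow> \<bar>G j s\<bar> \<le> C * real N + E j"
  obtains N s s' where "s \<in> PiE I (\<lambda>_. {..<N})" "s' \<in> PiE I (\<lambda>_. {..<N})" "s \<noteq> s'"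
    "\<And>j. j \<in> J \<Longrightarrow> \<lfloor>G j s / \<delta> j\<rfloor> = \<lfloor>G j s' / \<delta> j\<rfloor>"
proof -
  define F where "F j = 2 * E j / \<delta> j + 3" for j
  have "((\<lambda>N. \<Prod>j\<in>J. 2 * C / \<delta> j + F j / real N) \<longlonglongrightarrow> (\<Prod>j\<in>J. 2 * C / \<delta> j + 0))"
    by (intro tendsto_prod tendsto_add tendsto_const lim_const_over_n)
  moreover have "(\<Prod>j\<in>J. 2 * C / \<delta> j + 0) < 1"
  proof -
    have n: "card J > 0" using card by simp
    have "(2 * C) ^ card J < (4 * C) ^ card J" using pos(1) n by (intro power_strict_mono) auto
    then have "(2 * C) ^ card J < (\<Prod>j\<in>J. \<delta> j)" using vol by linarith
    moreover have "(\<Prod>j\<in>J. \<delta> j) > 0" using pos(2) by (intro prod_pos) auto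
    ultimately show ?thesis by (simp add: prod_dividef)
  qed
  ultimately have "\<forall>\<^sub>F N in sequentially. (\<Prod>j\<in>J. 2 * C / \<delta> j + F j / real N) < 1"
    by (rule order_tendstoD)
  moreover have "\<forall>\<^sub>F N in sequentially. N > (0::nat)" by (rule eventually_gt_at_top)
  ultimately have "\<forall>\<^sub>F N in sequentially. (\<Prod>j\<in>J. 2 * C / \<delta> j + F j / real N) < 1 \<and> N > 0"
    by (rule eventually_conj)
  then obtain N :: nat where N: "(\<Prod>j\<in>J. 2 * C / \<delta> j + F j / real N) < 1" "N > 0"
    using eventually_happens'[OF sequentially_bot] by blast
  define x where "x j = (C * real N + E j) / \<delta> j + 1" for j
  have x0: "x j \<ge> 0" if "j \<in> J" for j using pos(1) pos(2,3)[OF that] by (simp add: x_def)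
  define P where "P = PiE J (\<lambda>j. {a::int. \<bar>of_int a\<bar> \<le> x j})"
  define f where "f s = (\<lambda>j\<in>J. \<lfloor>G j s / \<delta> j\<rfloor>)" for s
  let ?S = "PiE I (\<lambda>_. {..<N})"
  have "f ` ?S \<subseteq> P"
  proof clarify
    fix s assume s: "s \<in> ?S"
    have "\<bar>of_int \<lfloor>G j s / \<delta> j\<rfloor>\<bar> \<le> x j" if j: "j \<in> J" for j
    proof -
      have "\<bar>G j s / \<delta> j\<bar> \<le> (C * real N + E j) / \<delta> j"
        using bd[OF s j] pos(2)[OF j] by (simp add: divide_right_mono)
      then show ?thesis unfolding x_def by linarith
    qed
    then show "f s \<in> P" by (auto simp: f_def P_def)
  qed
  moreover have finP: "finite P" unfolding P_def using fin x0 card_bounded_ints(1) by (intro finite_PiE) auto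
  ultimately have "card (f ` ?S) \<le> card P" by (rule card_mono[rotated])
  moreover have "real (card P) < real (card ?S)"
  proof -
    have "real (card P) = (\<Prod>j\<in>J. real (card {a::int. \<bar>of_int a\<bar> \<le> x j}))"
      unfolding P_def using fin by (simp add: card_PiE)
    also have "\<dots> \<le> (\<Prod>j\<in>J. real N * (2 * C / \<delta> j + F j / real N))"
    proof (intro prod_mono conjI)
      fix j assume j: "j \<in> J"
      have "real (card {a::int. \<bar>of_int a\<bar> \<le> x j}) \<le> 2 * x j + 1" by (rule card_bounded_ints[OF x0[OF j]])
      also have "\<dots> = real N * (2 * C / \<delta> j + F j / real N)"
        using N(2) pos(2)[OF j] by (simp add: x_def F_def field_simps)
      finally show "real (card {a::int. \<bar>of_int a\<bar> \<le> x j}) \<le> real N * (2 * C / \<delta> j + F j / real N)" .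
    qed simp
    also have "\<dots> = real N ^ card J * (\<Prod>j\<in>J. 2 * C / \<delta> j + F j / real N)"
      by (simp add: prod.distrib)
    also have "\<dots> < real N ^ card J * 1" using N by (intro mult_strict_left_mono) auto
    also have "\<dots> = real (card ?S)" using fin card by (simp add: card_PiE)
    finally show ?thesis .
  qed
  ultimately have "card (f ` ?S) < card ?S" by linarith
  then have "\<not> inj_on f ?S" using pigeonhole by blast
  then obtain s s' where s: "s \<in> ?S" "s' \<in> ?S" "s \<noteq> s'" "f s = f s'" by (auto simp: inj_on_def)
  have "\<lfloor>G j s / \<delta> j\<rfloor> = \<lfloor>G j s' / \<delta> j\<rfloor>" if "j \<in> J" for j
    using s(4) that by (auto simp: f_def dest: fun_cong[of _ _ j])
  then show ?thesis using that s by blast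
qed

lemma complex_close:
  assumes "\<bar>Re x\<bar> < d" "\<bar>Im x\<bar> < d"
  shows "cmod x \<le> 2 * d"
proof -
  have "cmod x \<le> \<bar>Re x\<bar> + \<bar>Im x\<bar>" by (rule cmod_le)
  then show ?thesis using assms by simp
qed

lemma same_floor_imp_close:
  assumes "\<lfloor>x / d\<rfloor> = \<lfloor>y / d\<rfloor>" "d > (0::real)"
  shows "\<bar>x - y\<bar> < d"
proof -
  have "\<bar>x / d - y / d\<bar> < 1" using assms(1) by linarith
  then have "\<bar>(x - y) / d\<bar> < 1" by (simp add: diff_divide_distrib)
  then show ?thesis using assms(2) by (simp add: abs_divide)
qed

section \<open>Matrices and the groups \<open>SL\<^sub>2(\<complex>)\<close> and \<open>PSL\<^sub>2(\<complex>)\<close>\<close>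

definition mk2 :: "complex \<Rightarrow> complex \<Rightarrow> complex \<Rightarrow> complex \<Rightarrow> complex^2^2" where
  "mk2 a b c d = vector [vector [a, b], vector [c, d]]"

lemma mk2_nth [simp]:
  "mk2 a b c d $ 1 $ 1 = a" "mk2 a b c d $ 1 $ 2 = b" "mk2 a b c d $ 2 $ 1 = c" "mk2 a b c d $ 2 $ 2 = d"
  by (simp_all add: mk2_def)

lemma mat2_mult_nth: "((A :: complex^2^2) ** B) $ i $ j = A $ i $ 1 * B $ 1 $ j + A $ i $ 2 * B $ 2 $ j"
  by (simp add: matrix_matrix_mult_def sum_2)

lemma mat_nth2 [simp]:
  "(mat c :: complex^2^2) $ 1 $ 1 = c" "(mat c :: complex^2^2) $ 1 $ 2 = 0"
  "(mat c :: complex^2^2) $ 2 $ 1 = 0" "(mat c :: complex^2^2) $ 2 $ 2 = c"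
  by (simp_all add: mat_def)

lemma trace2: "trace (A :: complex^2^2) = A $ 1 $ 1 + A $ 2 $ 2"
  by (simp add: trace_def sum_2)

definition adj2 :: "complex^2^2 \<Rightarrow> complex^2^2" where
  "adj2 A = mk2 (A $ 2 $ 2) (- A $ 1 $ 2) (- A $ 2 $ 1) (A $ 1 $ 1)"

lemma adj2_nth [simp]:
  "adj2 A $ 1 $ 1 = A $ 2 $ 2" "adj2 A $ 1 $ 2 = - A $ 1 $ 2"
  "adj2 A $ 2 $ 1 = - A $ 2 $ 1" "adj2 A $ 2 $ 2 = A $ 1 $ 1"
  by (simp_all add: adj2_def)

lemma adj2_mult: "A ** adj2 A = mat (det A)" "adj2 A ** A = mat (det A)"
  by (auto intro!: matrix_2_eqI simp: mat2_mult_nth det_2 algebra_simps)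

lemma det_adj2: "det (adj2 A) = det A"
  by (simp add: det_2 algebra_simps)

lemma adj2_cancel:
  assumes "det A = 1"
  shows "A ** (adj2 A ** B) = B" "adj2 A ** (A ** B) = B" "(B ** A) ** adj2 A = B" "(B ** adj2 A) ** A = B"
  using adj2_mult[of A] assms by (simp_all add: matrix_mul_assoc) (simp_all add: matrix_mul_assoc[symmetric])

lemma matrix_inv_adj2: "det A = 1 \<Longrightarrow> matrix_inv A = adj2 A"
  using adj2_mult[of A] by (intro matrix_inv_eqI) auto

lemma mult_minus2 [simp]: "(- A) ** B = - (A ** B)" "A ** (- B) = - (A ** B)" for A B :: "complex^2^2"
  by (auto intro!: matrix_2_eqI simp: mat2_mult_nth)

lemma det_minus2 [simp]: "det (- A) = det A" for A :: "complex^2^2"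
  by (simp add: det_2)

lemma trace_minus2 [simp]: "trace (- A) = - trace A" for A :: "complex^2^2"
  by (simp add: trace2)

lemma carrier_SL2C [simp]: "A \<in> carrier SL2C \<longleftrightarrow> det A = 1"
  and mult_SL2C [simp]: "A \<otimes>\<^bsub>SL2C\<^esub> B = A ** B"
  and one_SL2C [simp]: "\<one>\<^bsub>SL2C\<^esub> = mat 1"
  by (auto simp: SL2C_def)

lemma group_SL2C: "group SL2C"
proof (rule groupI)
  show "\<exists>y\<in>carrier SL2C. y \<otimes>\<^bsub>SL2C\<^esub> x = \<one>\<^bsub>SL2C\<^esub>" if "x \<in> carrier SL2C" for x
    using that adj2_mult[of x] by (intro bexI[of _ "adj2 x"]) (auto simp: det_adj2)
qed (auto simp: det_mul matrix_mul_assoc)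

lemma normal_pm1: "{mat 1, - mat 1} \<lhd> SL2C"
proof -
  interpret group SL2C by (rule group_SL2C)
  have sub: "subgroup {mat 1, - mat 1} SL2C"
  proof (rule subgroupI)
    show "inv\<^bsub>SL2C\<^esub> a \<in> {mat 1, - mat 1}" if "a \<in> {mat 1, - mat 1}" for a
      using that by (auto intro: inv_equality)
  qed auto
  show ?thesis
    unfolding normal_inv_iff
  proof (intro conjI ballI sub)
    fix x h assume x: "x \<in> carrier SL2C" and h: "h \<in> {mat 1, - mat 1 :: complex^2^2}"
    then have "x ** inv\<^bsub>SL2C\<^esub> x = mat 1" using r_inv[OF x] by simp
    then show "x \<otimes>\<^bsub>SL2C\<^esub> h \<otimes>\<^bsub>SL2C\<^esub> inv\<^bsub>SL2C\<^esub> x \<in> {mat 1, - mat 1}"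
      using h by auto
  qed
qed

lemma group_PSL2C: "group PSL2C"
  unfolding PSL2C_def by (rule normal.factorgroup_is_group[OF normal_pm1])

lemma psl_mult: "det A = 1 \<Longrightarrow> det B = 1 \<Longrightarrow> psl A \<otimes>\<^bsub>PSL2C\<^esub> psl B = psl (A ** B)"
  using normal.rcos_sum[OF normal_pm1, of A B] by (simp add: PSL2C_def FactGroup_def psl_def)

lemma psl_one: "\<one>\<^bsub>PSL2C\<^esub> = psl (mat 1)"
  by (simp add: PSL2C_def FactGroup_def psl_eq)

lemma psl_in_carrier [simp]: "det A = 1 \<Longrightarrow> psl A \<in> carrier PSL2C"
  by (auto simp: carrier_PSL2C)

lemma psl_inv: "det A = 1 \<Longrightarrow> inv\<^bsub>PSL2C\<^esub> psl A = psl (adj2 A)"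
  by (rule group.inv_equality[OF group_PSL2C])
    (auto simp: psl_mult psl_one det_adj2 adj2_mult)

lemma carrier_PSL2C_cases:
  assumes "g \<in> carrier PSL2C"
  obtains A where "det A = 1" "g = psl A"
  using assms by (auto simp: carrier_PSL2C)

lemma psl_eq_iff: "psl A = psl B \<longleftrightarrow> A = B \<or> A = - B"
  by (auto simp: psl_eq doubleton_eq_iff)

text \<open>
  The preimage in \<open>SL\<^sub>2(\<complex>)\<close>, so that elements of a subgroup of \<open>PSL\<^sub>2(\<complex>)\<close> can be handled as matrices.
\<close>

definition lift_set :: "(complex^2^2) set set \<Rightarrow> (complex^2^2) set" where
  "lift_set \<Gamma> = {A. det A = 1 \<and> psl A \<in> \<Gamma>}"

lemma Union_eq_lift_set:
  assumes "\<Gamma> \<subseteq> carrier PSL2C"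
  shows "\<Union>\<Gamma> = lift_set \<Gamma>"
proof (intro subset_antisym subsetI)
  fix A assume "A \<in> \<Union>\<Gamma>"
  then obtain g where g: "g \<in> \<Gamma>" "A \<in> g" by blast
  then obtain B where B: "det B = 1" "g = psl B" using assms by (auto elim: carrier_PSL2C_cases)
  then have "A = B \<or> A = - B" using g by (simp add: psl_eq)
  then show "A \<in> lift_set \<Gamma>" using B g by (auto simp: lift_set_def psl_eq insert_commute)
qed (auto simp: lift_set_def psl_eq)

definition mpow :: "complex^2^2 \<Rightarrow> nat \<Rightarrow> complex^2^2" where
  "mpow A n = A [^]\<^bsub>SL2C\<^esub> n"

lemma mpow_0 [simp]: "mpow A 0 = mat 1" and mpow_Suc [simp]: "mpow A (Suc n) = mpow A n ** A"
  by (simp_all add: mpow_def nat_pow_def)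

lemma det_mpow [simp]: "det A = 1 \<Longrightarrow> det (mpow A n) = 1"
  by (induction n) (auto simp: det_mul)

lemma mpow_mult: "mpow (mpow A m) n = mpow A (m * n)"
proof (induction n)
  case (Suc n)
  have "mpow A i ** mpow A j = mpow A (i + j)" for i j
    by (induction j) (auto simp: matrix_mul_assoc)
  then show ?case using Suc by (simp add: add.commute)
qed simp

lemma psl_mpow:
  assumes "det A = 1"
  shows "psl A [^]\<^bsub>PSL2C\<^esub> (n::nat) = psl (mpow A n)"
  using assms by (induction n) (auto simp: nat_pow_def psl_mult psl_one)

definition conjugate_by :: "complex^2^2 \<Rightarrow> complex^2^2 \<Rightarrow> complex^2^2" where
  "conjugate_by g A = g ** A ** adj2 g"

lemma conjugate_by_simps:
  assumes "det g = 1"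
  shows "conjugate_by g (A ** B) = conjugate_by g A ** conjugate_by g B"
    "conjugate_by (adj2 g) (conjugate_by g A) = A" "conjugate_by g (conjugate_by (adj2 g) A) = A"
    "det (conjugate_by g A) = det A" "conjugate_by g (mat 1) = mat 1"
    "conjugate_by g (mpow A n) = mpow (conjugate_by g A) n"
    "trace (conjugate_by g A) = trace A"
proof -
  have adj: "adj2 (adj2 g) = g" by (rule matrix_2_eqI) auto
  note s = conjugate_by_def matrix_mul_assoc
  have c: "M ** adj2 g ** g = M" "M ** g ** adj2 g = M" for M
    using assms adj2_mult[of g] by (simp_all flip: matrix_mul_assoc)
  have c': "adj2 g ** g = mat 1" "g ** adj2 g = mat 1" using assms adj2_mult[of g] by auto
  show 1: "conjugate_by g (A ** B) = conjugate_by g A ** conjugate_by g B" for A B by (simp add: s c)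
  show "conjugate_by (adj2 g) (conjugate_by g A) = A" "conjugate_by g (conjugate_by (adj2 g) A) = A"
    by (simp_all add: s adj c c')
  show "det (conjugate_by g A) = det A" using assms by (simp add: s det_mul det_adj2)
  show 2: "conjugate_by g (mat 1) = mat 1" by (simp add: s c')
  show "conjugate_by g (mpow A n) = mpow (conjugate_by g A) n" by (induction n) (simp_all add: 1 2)
  have "trace (conjugate_by g A) = trace (adj2 g ** (g ** A))" unfolding conjugate_by_def by (rule trace_mul_sym)
  then show "trace (conjugate_by g A) = trace A" by (simp add: matrix_mul_assoc c')
qed

lemma conjugate_by_mult:
  assumes "det g = 1" "det h = 1"
  shows "conjugate_by (g ** h) A = conjugate_by g (conjugate_by h A)"
    "conjugate_by g (conjugate_by h A) = conjugate_by (conjugate_by g h) (conjugate_by g A)"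
proof -
  have adj: "adj2 (A ** B) = adj2 B ** adj2 A" for A B
    by (rule matrix_2_eqI) (simp_all add: mat2_mult_nth algebra_simps)
  show 1: "conjugate_by (g ** h) A = conjugate_by g (conjugate_by h A)" for g h A
    by (simp add: conjugate_by_def adj matrix_mul_assoc)
  have "conjugate_by (conjugate_by g h) (conjugate_by g A) = conjugate_by (conjugate_by g h ** g) A"
    by (simp add: 1)
  also have "conjugate_by g h ** g = g ** h"
    unfolding conjugate_by_def using adj2_cancel(4)[OF assms(1)] .
  finally show "conjugate_by g (conjugate_by h A) = conjugate_by (conjugate_by g h) (conjugate_by g A)"
    by (simp add: 1)
qed

section \<open>Commensurability\<close>

text \<open>
  The cosets \<open>H x\<^sup>n\<close> cannot all be different.
\<close>

lemma finite_index_power: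
  assumes "group G" "subgroup K G" "subgroup H G" "finite_index G H K" "x \<in> K"
  obtains n :: nat where "n > 0" "x [^]\<^bsub>G\<^esub> n \<in> H"
proof -
  interpret group G by fact
  interpret K: subgroup K G by fact
  interpret H: subgroup H G by fact
  have x: "x \<in> carrier G" using assms by auto
  have pw: "x [^]\<^bsub>G\<^esub> (n::nat) \<in> K" for n using assms(5) by (induction n) auto
  let ?f = "\<lambda>n::nat. H #>\<^bsub>G\<^esub> (x [^]\<^bsub>G\<^esub> n)"
  have "range ?f \<subseteq> rcosets\<^bsub>G\<lparr>carrier := K\<rparr>\<^esub> H"
    using pw by (auto simp: RCOSETS_def r_coset_def)
  then have "finite (range ?f)" using assms(4) finite_subset by (auto simp: finite_index_def)
  then have "\<not> inj ?f" using finite_imageD infinite_UNIV_nat by blast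
  then obtain i j :: nat where "i \<noteq> j" "?f i = ?f j" by (auto simp: inj_def)
  then obtain i j :: nat where ij: "i < j" "?f i = ?f j" by (metis linorder_neqE_nat)
  have "x [^]\<^bsub>G\<^esub> j \<in> ?f j" using x H.one_closed by (auto simp: r_coset_def intro!: bexI[of _ "\<one>\<^bsub>G\<^esub>"])
  then obtain h where h: "h \<in> H" "x [^]\<^bsub>G\<^esub> j = h \<otimes>\<^bsub>G\<^esub> x [^]\<^bsub>G\<^esub> i"
    using ij(2) by (auto simp: r_coset_def)
  have "x [^]\<^bsub>G\<^esub> (j - i) \<otimes>\<^bsub>G\<^esub> x [^]\<^bsub>G\<^esub> i = x [^]\<^bsub>G\<^esub> j" using x ij by (simp add: nat_pow_mult)
  then have "x [^]\<^bsub>G\<^esub> (j - i) = h" using h x H.subset by (metis nat_pow_closed right_cancel H.mem_carrier)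
  then show ?thesis using that[of "j - i"] ij h by auto
qed

lemma finite_index_transversal:
  assumes "group G" "subgroup K G" "subgroup H G" "finite_index G H K"
  obtains T where "finite T" "T \<subseteq> K" "\<And>x. x \<in> K \<Longrightarrow> \<exists>t\<in>T. \<exists>h\<in>H. x = h \<otimes>\<^bsub>G\<^esub> t"
proof -
  interpret group G by fact
  interpret K: subgroup K G by fact
  interpret H: subgroup H G by fact
  let ?R = "rcosets\<^bsub>G\<lparr>carrier := K\<rparr>\<^esub> H"
  have R: "?R = (\<lambda>a. H #>\<^bsub>G\<^esub> a) ` K" by (auto simp: RCOSETS_def r_coset_def)
  have "finite ((\<lambda>a. H #>\<^bsub>G\<^esub> a) ` K)" using assms(4) by (simp add: finite_index_def R)
  then obtain T where T: "finite T" "T \<subseteq> K" "(\<lambda>a. H #>\<^bsub>G\<^esub> a) ` K = (\<lambda>a. H #>\<^bsub>G\<^esub> a) ` T"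
    by (metis finite_subset_image order_refl)
  have "\<exists>t\<in>T. \<exists>h\<in>H. x = h \<otimes>\<^bsub>G\<^esub> t" if x: "x \<in> K" for x
  proof -
    obtain t where t: "t \<in> T" "H #>\<^bsub>G\<^esub> x = H #>\<^bsub>G\<^esub> t" using T(3) x by blast
    have "x \<in> H #>\<^bsub>G\<^esub> x" using x H.one_closed by (auto simp: r_coset_def intro!: bexI[of _ "\<one>\<^bsub>G\<^esub>"])
    then show ?thesis using t by (auto simp: r_coset_def)
  qed
  then show ?thesis using that T by blast
qed

lemma conjugate_subgroup_PSL2C:
  assumes "subgroup \<Gamma> PSL2C" "det g = 1"
  shows "subgroup (psl g <#\<^bsub>PSL2C\<^esub> \<Gamma> #>\<^bsub>PSL2C\<^esub> inv\<^bsub>PSL2C\<^esub> psl g) PSL2C"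
    "psl g <#\<^bsub>PSL2C\<^esub> \<Gamma> #>\<^bsub>PSL2C\<^esub> inv\<^bsub>PSL2C\<^esub> psl g = {psl (conjugate_by g A) | A. A \<in> lift_set \<Gamma>}"
proof -
  interpret group PSL2C by (rule group_PSL2C)
  interpret subgroup \<Gamma> PSL2C by fact
  let ?C = "psl g <#\<^bsub>PSL2C\<^esub> \<Gamma> #>\<^bsub>PSL2C\<^esub> inv\<^bsub>PSL2C\<^esub> psl g"
  show eq: "?C = {psl (conjugate_by g A) | A. A \<in> lift_set \<Gamma>}"
  proof (intro subset_antisym subsetI)
    fix x assume "x \<in> ?C"
    then obtain y where y: "y \<in> \<Gamma>" "x = psl g \<otimes>\<^bsub>PSL2C\<^esub> y \<otimes>\<^bsub>PSL2C\<^esub> inv\<^bsub>PSL2C\<^esub> psl g"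
      by (auto simp: r_coset_def l_coset_def)
    obtain A where A: "det A = 1" "y = psl A" using carrier_PSL2C_cases[OF mem_carrier[OF y(1)]] by blast
    then have "x = psl (conjugate_by g A)" "A \<in> lift_set \<Gamma>"
      using y assms(2) by (simp_all add: psl_mult psl_inv det_mul det_adj2 conjugate_by_def lift_set_def)
    then show "x \<in> {psl (conjugate_by g A) | A. A \<in> lift_set \<Gamma>}" by blast
  next
    fix x assume "x \<in> {psl (conjugate_by g A) | A. A \<in> lift_set \<Gamma>}"
    then obtain A where A: "det A = 1" "psl A \<in> \<Gamma>" "x = psl (conjugate_by g A)" by (auto simp: lift_set_def)
    then have "x = psl g \<otimes>\<^bsub>PSL2C\<^esub> psl A \<otimes>\<^bsub>PSL2C\<^esub> inv\<^bsub>PSL2C\<^esub> psl g"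
      using assms(2) by (simp add: psl_mult psl_inv det_mul det_adj2 conjugate_by_def)
    then show "x \<in> ?C" using A(2) by (auto simp: r_coset_def l_coset_def)
  qed
  note cb = conjugate_by_simps[OF assms(2)]
  show "subgroup ?C PSL2C"
    unfolding eq
  proof (rule subgroupI)
    show "{psl (conjugate_by g A) |A. A \<in> lift_set \<Gamma>} \<subseteq> carrier PSL2C"
      by (auto simp: lift_set_def cb)
    have "mat 1 \<in> lift_set \<Gamma>" using one_closed by (simp add: lift_set_def psl_one)
    then show "{psl (conjugate_by g A) |A. A \<in> lift_set \<Gamma>} \<noteq> {}" by blast
  next
    fix a assume "a \<in> {psl (conjugate_by g A) |A. A \<in> lift_set \<Gamma>}"
    then obtain A where A: "A \<in> lift_set \<Gamma>" "a = psl (conjugate_by g A)" by blast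
    have "adj2 A \<in> lift_set \<Gamma>" using A m_inv_closed[of "psl A"] by (simp add: lift_set_def det_adj2 psl_inv)
    moreover have "inv\<^bsub>PSL2C\<^esub> a = psl (conjugate_by g (adj2 A))"
    proof -
      have dA: "det A = 1" using A by (simp add: lift_set_def)
      have "conjugate_by g (adj2 A) ** conjugate_by g A = mat 1"
        using adj2_mult(2)[of A] dA by (simp add: cb(1)[symmetric] cb(5))
      then show ?thesis using dA A(2)
        by (intro inv_equality) (auto simp: psl_mult psl_one cb(4) det_adj2)
    qed
    ultimately show "inv\<^bsub>PSL2C\<^esub> a \<in> {psl (conjugate_by g A) |A. A \<in> lift_set \<Gamma>}" by blast
  next
    fix a b assume "a \<in> {psl (conjugate_by g A) |A. A \<in> lift_set \<Gamma>}" "b \<in> {psl (conjugate_by g A) |A. A \<in> lift_set \<Gamma>}"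
    then obtain A B where A: "A \<in> lift_set \<Gamma>" "a = psl (conjugate_by g A)"
      and B: "B \<in> lift_set \<Gamma>" "b = psl (conjugate_by g B)" by blast
    have "A ** B \<in> lift_set \<Gamma>" using A B m_closed[of "psl A" "psl B"] by (auto simp: lift_set_def psl_mult det_mul)
    moreover have "a \<otimes>\<^bsub>PSL2C\<^esub> b = psl (conjugate_by g (A ** B))"
      using A B by (simp add: lift_set_def psl_mult cb)
    ultimately show "a \<otimes>\<^bsub>PSL2C\<^esub> b \<in> {psl (conjugate_by g A) |A. A \<in> lift_set \<Gamma>}" by blast
  qed
qed

text \<open>
  Up to conjugation, elements of either group have a power in the
  other group, and \<open>\<Delta>\<close> is covered by finitely many translates of \<open>\<Gamma>\<close>.
\<close>

lemma commensurable_lift: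
  assumes \<Gamma>: "subgroup \<Gamma> PSL2C" and \<Delta>: "subgroup \<Delta> PSL2C" and "commensurable \<Gamma> \<Delta>"
  obtains g T where "det g = 1" "finite T"
    "\<And>A. A \<in> lift_set \<Gamma> \<Longrightarrow> \<exists>n>0. mpow (conjugate_by g A) n \<in> lift_set \<Delta>"
    "\<And>B. B \<in> lift_set \<Delta> \<Longrightarrow> \<exists>n>0. mpow (conjugate_by (adj2 g) B) n \<in> lift_set \<Gamma>"
    "\<And>B. B \<in> lift_set \<Delta> \<Longrightarrow> \<exists>A\<in>lift_set \<Gamma>. \<exists>t\<in>T. B = conjugate_by g A ** t"
proof -
  interpret group PSL2C by (rule group_PSL2C)
  from assms(3) obtain h where h: "h \<in> carrier PSL2C"
    "let \<Gamma>' = h <#\<^bsub>PSL2C\<^esub> \<Gamma> #>\<^bsub>PSL2C\<^esub> inv\<^bsub>PSL2C\<^esub> h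
        in finite_index PSL2C (\<Gamma>' \<inter> \<Delta>) \<Gamma>' \<and> finite_index PSL2C (\<Gamma>' \<inter> \<Delta>) \<Delta>"
    by (auto simp: commensurable_def)
  obtain g where g: "det g = 1" "h = psl g" using h(1) by (rule carrier_PSL2C_cases)
  define C where "C = psl g <#\<^bsub>PSL2C\<^esub> \<Gamma> #>\<^bsub>PSL2C\<^esub> inv\<^bsub>PSL2C\<^esub> psl g"
  have fi: "finite_index PSL2C (C \<inter> \<Delta>) C" "finite_index PSL2C (C \<inter> \<Delta>) \<Delta>"
    using h(2) by (auto simp: Let_def g(2) C_def)
  note Csub = conjugate_subgroup_PSL2C(1)[OF \<Gamma> g(1), folded C_def]
  note Ceq = conjugate_subgroup_PSL2C(2)[OF \<Gamma> g(1), folded C_def]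
  have Isub: "subgroup (C \<inter> \<Delta>) PSL2C" using subgroups_Inter_pair[OF Csub \<Delta>] .
  note cb = conjugate_by_simps[OF g(1)]
  have lift_C: "\<exists>A\<in>lift_set \<Gamma>. B = conjugate_by g A" if "psl B \<in> C" for B
  proof -
    obtain A where A: "A \<in> lift_set \<Gamma>" "psl B = psl (conjugate_by g A)" using \<open>psl B \<in> C\<close> by (auto simp: Ceq)
    have "- A \<in> lift_set \<Gamma>" using A(1) by (simp add: lift_set_def psl_eq insert_commute)
    moreover have "conjugate_by g (- A) = - conjugate_by g A" by (simp add: conjugate_by_def)
    ultimately show ?thesis using A by (metis psl_eq_iff)
  qed
  obtain T where T: "finite T" "T \<subseteq> \<Delta>" "\<And>x. x \<in> \<Delta> \<Longrightarrow> \<exists>t\<in>T. \<exists>h\<in>C \<inter> \<Delta>. x = h \<otimes>\<^bsub>PSL2C\<^esub> t"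
    using finite_index_transversal[OF group_PSL2C \<Delta> Isub fi(2)] by blast
  have TG: "T \<subseteq> carrier PSL2C" using T(2) subgroup.subset[OF \<Delta>] by blast
  have "finite (\<Union>T)"
  proof (rule finite_Union[OF T(1)])
    fix t assume "t \<in> T"
    then have "t \<in> carrier PSL2C" using TG by blast
    then show "finite t" by (auto elim!: carrier_PSL2C_cases simp: psl_eq)
  qed
  show ?thesis
  proof (rule that[of g "\<Union>T"])
    show "det g = 1" "finite (\<Union>T)" by fact+
    fix A assume A: "A \<in> lift_set \<Gamma>"
    then have dA: "det A = 1" by (simp add: lift_set_def)
    have "psl (conjugate_by g A) \<in> C" using A by (auto simp: Ceq)
    then obtain n :: nat where "n > 0" "psl (conjugate_by g A) [^]\<^bsub>PSL2C\<^esub> n \<in> C \<inter> \<Delta>"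
      using finite_index_power[OF group_PSL2C Csub Isub fi(1)] by blast
    then show "\<exists>n>0. mpow (conjugate_by g A) n \<in> lift_set \<Delta>"
      using dA by (auto simp: psl_mpow cb lift_set_def)
  next
    fix B assume B: "B \<in> lift_set \<Delta>"
    then have dB: "det B = 1" "psl B \<in> \<Delta>" by (auto simp: lift_set_def)
    then obtain n :: nat where n: "n > 0" "psl B [^]\<^bsub>PSL2C\<^esub> n \<in> C \<inter> \<Delta>"
      using finite_index_power[OF group_PSL2C \<Delta> Isub fi(2)] by blast
    then obtain A where A: "A \<in> lift_set \<Gamma>" "mpow B n = conjugate_by g A"
      using lift_C[of "mpow B n"] dB by (auto simp: psl_mpow)
    have "conjugate_by (adj2 g) (mpow B n) = A" using A cb by simp
    then have "mpow (conjugate_by (adj2 g) B) n = A"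
      using conjugate_by_simps(6)[of "adj2 g" B n] g(1) by (simp add: det_adj2)
    then show "\<exists>n>0. mpow (conjugate_by (adj2 g) B) n \<in> lift_set \<Gamma>" using n A by blast
    obtain t h where th: "t \<in> T" "h \<in> C" "psl B = h \<otimes>\<^bsub>PSL2C\<^esub> t" using T(3)[OF dB(2)] by blast
    obtain s where s: "det s = 1" "t = psl s" using th(1) TG by (auto elim: carrier_PSL2C_cases)
    obtain H where H: "det H = 1" "h = psl H" using th(2) subgroup.subset[OF Csub] by (auto elim: carrier_PSL2C_cases)
    have "psl B = psl (H ** s)" using th s H by (simp add: psl_mult)
    then have "B = H ** s \<or> B = H ** (- s)" by (auto simp: psl_eq_iff)
    moreover obtain A where "A \<in> lift_set \<Gamma>" "H = conjugate_by g A" using lift_C[of H] th H by auto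
    moreover have "s \<in> \<Union>T" "- s \<in> \<Union>T" using th(1) s by (auto simp: psl_eq)
    ultimately show "\<exists>A\<in>lift_set \<Gamma>. \<exists>t\<in>\<Union>T. B = conjugate_by g A ** t" by blast
  qed
qed

lemma commensurable_chain:
  assumes \<Gamma>: "subgroup \<Gamma> PSL2C" and \<Delta>: "subgroup \<Delta> PSL2C" and P: "subgroup P PSL2C"
    and comm: "commensurable \<Gamma> \<Delta>" "commensurable \<Delta> P"
  shows "\<exists>f. det f = 1 \<and> (\<forall>A\<in>lift_set \<Gamma>. \<exists>n>0. mpow (conjugate_by f A) n \<in> lift_set P) \<and>
    (\<forall>U\<in>lift_set P. \<exists>n>0. \<exists>A\<in>lift_set \<Gamma>. conjugate_by f A = mpow U n)"
proof (rule commensurable_lift[OF \<Gamma> \<Delta> comm(1)])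
  fix g
  assume g: "det g = 1"
    and g_to: "\<And>A. A \<in> lift_set \<Gamma> \<Longrightarrow> \<exists>n>0. mpow (conjugate_by g A) n \<in> lift_set \<Delta>"
    and g_from: "\<And>B. B \<in> lift_set \<Delta> \<Longrightarrow> \<exists>n>0. mpow (conjugate_by (adj2 g) B) n \<in> lift_set \<Gamma>"
  show ?thesis
  proof (rule commensurable_lift[OF \<Delta> P comm(2)])
    fix h
    assume h: "det h = 1"
      and h_to: "\<And>A. A \<in> lift_set \<Delta> \<Longrightarrow> \<exists>n>0. mpow (conjugate_by h A) n \<in> lift_set P"
      and h_from: "\<And>B. B \<in> lift_set P \<Longrightarrow> \<exists>n>0. mpow (conjugate_by (adj2 h) B) n \<in> lift_set \<Delta>"
    note cg = conjugate_by_simps[OF g] and ch = conjugate_by_simps[OF h]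
    have chg: "conjugate_by (h ** g) A = conjugate_by h (conjugate_by g A)" for A
      by (rule conjugate_by_mult(1)[OF h g])
    have to: "\<exists>n>0. mpow (conjugate_by (h ** g) A) n \<in> lift_set P" if A: "A \<in> lift_set \<Gamma>" for A
    proof -
      obtain n1 where n1: "n1 > 0" "mpow (conjugate_by g A) n1 \<in> lift_set \<Delta>" using g_to[OF A] by blast
      obtain n2 where n2: "n2 > 0" "mpow (conjugate_by h (mpow (conjugate_by g A) n1)) n2 \<in> lift_set P"
        using h_to[OF n1(2)] by blast
      then have "mpow (conjugate_by (h ** g) A) (n1 * n2) \<in> lift_set P" by (simp add: chg ch(6) mpow_mult)
      then show ?thesis using n1 n2 by (intro exI[of _ "n1 * n2"]) simp
    qed
    have from_P: "\<exists>n>0. \<exists>A\<in>lift_set \<Gamma>. conjugate_by (h ** g) A = mpow U n" if U: "U \<in> lift_set P" for U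
    proof -
      obtain n1 where n1: "n1 > 0" "mpow (conjugate_by (adj2 h) U) n1 \<in> lift_set \<Delta>" using h_from[OF U] by blast
      obtain n2 where n2: "n2 > 0" "mpow (conjugate_by (adj2 g) (mpow (conjugate_by (adj2 h) U) n1)) n2 \<in> lift_set \<Gamma>"
        using g_from[OF n1(2)] by blast
      have "conjugate_by (h ** g) (mpow (conjugate_by (adj2 g) (mpow (conjugate_by (adj2 h) U) n1)) n2) = mpow U (n1 * n2)"
        by (simp add: chg cg ch mpow_mult)
      then show ?thesis using n1 n2 by (intro exI[of _ "n1 * n2"]) auto
    qed
    have "det (h ** g) = 1" using g h by (simp add: det_mul)
    then show ?thesis using to from_P by blast
  qed
qed

section \<open>The action on hyperbolic space and a criterion for cocompactness\<close>

lemma cmod_power2_complex: "(complex_of_real (cmod z))\<^sup>2 = z * cnj z"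
  by (metis complex_norm_square of_real_power)

text \<open>
  The point \<open>(z, t)\<close> of the upper half-space as a positive Hermitian matrix of determinant \<open>1\<close>, namely
  \<open>g g\<^sup>*\<close> for any \<open>g\<close> that maps \<open>(0, 1)\<close> to \<open>(z, t)\<close>. In these terms \<open>A\<close> acts by \<open>H \<mapsto> A H A\<^sup>*\<close>, which is
  visibly a group action.
\<close>

definition herm :: "complex \<times> real \<Rightarrow> complex^2^2" where
  "herm p = mk2 (of_real (((cmod (fst p))\<^sup>2 + (snd p)\<^sup>2) / snd p)) (fst p / of_real (snd p))
     (cnj (fst p) / of_real (snd p)) (1 / of_real (snd p))"

definition ctrans :: "complex^2^2 \<Rightarrow> complex^2^2" where
  "ctrans A = mk2 (cnj (A $ 1 $ 1)) (cnj (A $ 2 $ 1)) (cnj (A $ 1 $ 2)) (cnj (A $ 2 $ 2))"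

lemma ctrans_nth [simp]:
  "ctrans A $ 1 $ 1 = cnj (A $ 1 $ 1)" "ctrans A $ 1 $ 2 = cnj (A $ 2 $ 1)"
  "ctrans A $ 2 $ 1 = cnj (A $ 1 $ 2)" "ctrans A $ 2 $ 2 = cnj (A $ 2 $ 2)"
  by (simp_all add: ctrans_def)

lemma ctrans_mult: "ctrans (A ** B) = ctrans B ** ctrans A"
  by (auto intro!: matrix_2_eqI simp: mat2_mult_nth)

lemma det_ctrans: "det (ctrans A) = cnj (det A)"
  by (simp add: det_2 algebra_simps)

lemma herm_nth:
  "herm p $ 1 $ 1 = of_real (((cmod (fst p))\<^sup>2 + (snd p)\<^sup>2) / snd p)" "herm p $ 1 $ 2 = fst p / of_real (snd p)"
  "herm p $ 2 $ 1 = cnj (fst p) / of_real (snd p)" "herm p $ 2 $ 2 = 1 / of_real (snd p)"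
  by (simp_all add: herm_def)

lemma det_herm: "snd p \<noteq> 0 \<Longrightarrow> det (herm p) = 1"
  by (simp add: det_2 herm_nth cmod_power2_complex divide_simps) (simp add: power2_eq_square)

lemma herm_inj: "herm p = herm q \<Longrightarrow> snd p \<noteq> 0 \<Longrightarrow> snd q \<noteq> 0 \<Longrightarrow> p = q"
proof -
  assume h: "herm p = herm q" and 0: "snd p \<noteq> 0" "snd q \<noteq> 0"
  have "herm p $ 2 $ 2 = herm q $ 2 $ 2" using h by simp
  then have s: "snd p = snd q" using 0 by (simp add: herm_nth)
  have "herm p $ 1 $ 2 = herm q $ 1 $ 2" using h by simp
  then have "fst p = fst q" using 0 s by (simp add: herm_nth)
  then show ?thesis using s by (simp add: prod_eq_iff)
qed

lemma hyp3_act_denominator_pos: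
  fixes A :: "complex^2^2"
  assumes "det A = 1" "t > 0"
  shows "(cmod (A $ 2 $ 1 * z + A $ 2 $ 2))\<^sup>2 + (cmod (A $ 2 $ 1))\<^sup>2 * t\<^sup>2 > 0"
proof (cases "A $ 2 $ 1 = 0")
  case True
  then have "A $ 2 $ 2 \<noteq> 0" using assms by (auto simp: det_2)
  then show ?thesis using True by simp
qed (use assms in \<open>auto intro!: add_nonneg_pos\<close>)

lemma hyp3_act_in_hyp3: "det A = 1 \<Longrightarrow> p \<in> hyp3 \<Longrightarrow> hyp3_act A p \<in> hyp3"
  using hyp3_act_denominator_pos[of A "snd p" "fst p"] by (simp add: hyp3_act_def hyp3_def Let_def)

text \<open>
  Three of the entries agree by computation; the first diagonal entry follows because both sides have
  determinant \<open>1\<close>.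
\<close>

lemma herm_hyp3_act:
  assumes A: "det A = 1" and p: "p \<in> hyp3"
  shows "herm (hyp3_act A p) = A ** herm p ** ctrans A" (is "?L = ?R")
proof -
  define a b c d where abcd: "a = A $ 1 $ 1" "b = A $ 1 $ 2" "c = A $ 2 $ 1" "d = A $ 2 $ 2"
  obtain z t where pz: "p = (z, t)" by (cases p)
  have t: "t > 0" using p by (simp add: pz hyp3_def)
  define q where "q = (cmod (c * z + d))\<^sup>2 + (cmod c)\<^sup>2 * t\<^sup>2"
  have q: "q > 0" using hyp3_act_denominator_pos[OF A t, of z] by (simp add: q_def abcd)
  have qc: "complex_of_real q = (c * z + d) * cnj (c * z + d) + c * cnj c * (of_real t)\<^sup>2"
    unfolding q_def by (simp only: of_real_add of_real_mult of_real_power cmod_power2_complex)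
  have act: "hyp3_act A (z, t) = (((a * z + b) * cnj (c * z + d) + a * cnj c * of_real (t\<^sup>2)) / of_real q, t / q)"
    by (simp add: hyp3_act_def pz Let_def abcd q_def)
  have t0: "complex_of_real t \<noteq> 0" and q0: "complex_of_real q \<noteq> 0" using t q by auto
  note s = mat2_mult_nth herm_nth pz act abcd[symmetric]
  have 22: "?L $ 2 $ 2 = ?R $ 2 $ 2"
    using t0 q0 qc by (simp add: s cmod_power2_complex) (simp add: field_simps power2_eq_square)
  have 12: "?L $ 1 $ 2 = ?R $ 1 $ 2"
    using t0 q0 by (simp add: s cmod_power2_complex) (simp add: field_simps power2_eq_square)
  have 21: "?L $ 2 $ 1 = ?R $ 2 $ 1"
    using t0 q0 by (simp add: s cmod_power2_complex) (simp add: field_simps power2_eq_square)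
  have "det ?L = 1" using t q by (intro det_herm) (simp add: pz act)
  moreover have "det ?R = 1" using A t by (simp add: det_mul det_ctrans det_herm pz)
  ultimately have "?L $ 1 $ 1 * ?L $ 2 $ 2 = ?R $ 1 $ 1 * ?R $ 2 $ 2"
    using 12 21 by (simp add: det_2 algebra_simps)
  moreover have "?L $ 2 $ 2 \<noteq> 0" using t q by (simp add: herm_nth pz act)
  ultimately have "?L $ 1 $ 1 = ?R $ 1 $ 1" using 22 by simp
  then show ?thesis using 12 21 22 by (intro matrix_2_eqI)
qed

lemma hyp3_act_mult:
  assumes "det A = 1" "det B = 1" "p \<in> hyp3"
  shows "hyp3_act (A ** B) p = hyp3_act A (hyp3_act B p)"
proof (rule herm_inj)
  have Bp: "hyp3_act B p \<in> hyp3" by (intro hyp3_act_in_hyp3 assms)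
  have AB: "det (A ** B) = 1" using assms by (simp add: det_mul)
  show "herm (hyp3_act (A ** B) p) = herm (hyp3_act A (hyp3_act B p))"
    using assms Bp AB by (simp add: herm_hyp3_act ctrans_mult matrix_mul_assoc)
  show "snd (hyp3_act (A ** B) p) \<noteq> 0" "snd (hyp3_act A (hyp3_act B p)) \<noteq> 0"
    using hyp3_act_in_hyp3[OF AB assms(3)] hyp3_act_in_hyp3[OF assms(1) Bp] by (auto simp: hyp3_def)
qed

definition upper :: "complex \<Rightarrow> real \<Rightarrow> complex^2^2" where
  "upper z t = mk2 (of_real (sqrt t)) (z / of_real (sqrt t)) 0 (1 / of_real (sqrt t))"

lemma upper_nth [simp]:
  "upper z t $ 1 $ 1 = of_real (sqrt t)" "upper z t $ 1 $ 2 = z / of_real (sqrt t)"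
  "upper z t $ 2 $ 1 = 0" "upper z t $ 2 $ 2 = 1 / of_real (sqrt t)"
  by (simp_all add: upper_def)

lemma det_upper: "t > 0 \<Longrightarrow> det (upper z t) = 1"
  by (simp add: det_2)

lemma upper_act_base:
  assumes "t > 0"
  shows "hyp3_act (upper z t) (0, 1) = (z, t)"
proof -
  have "complex_of_real (sqrt t) * complex_of_real (sqrt t) = of_real t"
    using assms by (simp flip: of_real_mult)
  then show ?thesis using assms
    by (simp add: hyp3_act_def Let_def norm_divide power_divide field_simps power2_eq_square)
qed

definition entry_norm :: "complex^2^2 \<Rightarrow> real" where
  "entry_norm A = cmod (A $ 1 $ 1) + cmod (A $ 1 $ 2) + cmod (A $ 2 $ 1) + cmod (A $ 2 $ 2)"

lemma entry_norm_nonneg: "entry_norm A \<ge> 0"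
  by (simp add: entry_norm_def)

lemma entry_norm_adj2: "entry_norm (adj2 A) = entry_norm A"
  by (simp add: entry_norm_def)

lemma entry_le_entry_norm: "cmod (A $ i $ j) \<le> entry_norm A"
  using exhaust_2[of i] exhaust_2[of j] by (auto simp: entry_norm_def)

lemma entry_norm_mult: "entry_norm (A ** B) \<le> entry_norm A * entry_norm B"
proof -
  have e: "cmod ((A ** B) $ i $ j) \<le> cmod (A $ i $ 1) * cmod (B $ 1 $ j) + cmod (A $ i $ 2) * cmod (B $ 2 $ j)" for i j
    using norm_triangle_ineq[of "A $ i $ 1 * B $ 1 $ j" "A $ i $ 2 * B $ 2 $ j"]
    by (simp add: mat2_mult_nth norm_mult)
  have "entry_norm (A ** B) \<le> (cmod (A $ 1 $ 1) + cmod (A $ 2 $ 1)) * (cmod (B $ 1 $ 1) + cmod (B $ 1 $ 2)) +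
     (cmod (A $ 1 $ 2) + cmod (A $ 2 $ 2)) * (cmod (B $ 2 $ 1) + cmod (B $ 2 $ 2))"
    using e[of 1 1] e[of 1 2] e[of 2 1] e[of 2 2] unfolding entry_norm_def by (simp add: algebra_simps)
  also have "\<dots> \<le> (cmod (A $ 1 $ 1) + cmod (A $ 2 $ 1)) * entry_norm B + (cmod (A $ 1 $ 2) + cmod (A $ 2 $ 2)) * entry_norm B"
    by (intro add_mono mult_left_mono) (auto simp: entry_norm_def)
  also have "\<dots> = entry_norm A * entry_norm B" by (simp add: entry_norm_def algebra_simps)
  finally show ?thesis .
qed

text \<open>
  The point \<open>(z, t)\<close> is the image of \<open>(0, 1)\<close> under \<open>g\<close>, and \<open>\<kappa>\<close> is unitary.
\<close>

lemma iwasawa_decomposition: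
  assumes g: "det g = 1"
  obtains z t \<kappa> where "t > 0" "g = upper z t ** \<kappa>" "det \<kappa> = 1" "entry_norm \<kappa> \<le> 4"
proof -
  define a b c d where abcd: "a = g $ 1 $ 1" "b = g $ 1 $ 2" "c = g $ 2 $ 1" "d = g $ 2 $ 2"
  have det: "a * d - b * c = 1" using g by (simp add: det_2 abcd)
  define n where "n = (cmod c)\<^sup>2 + (cmod d)\<^sup>2"
  have n: "n > 0"
  proof -
    have "c \<noteq> 0 \<or> d \<noteq> 0" using det by auto
    then show ?thesis unfolding n_def by (auto intro: add_pos_nonneg add_nonneg_pos)
  qed
  define t where "t = 1 / n"
  define z where "z = (a * cnj c + b * cnj d) * of_real t"
  define r where "r = sqrt t"
  have t: "t > 0" and r: "r > 0" using n by (simp_all add: t_def r_def)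
  have rr: "complex_of_real r * of_real r = of_real t" "r\<^sup>2 = t" using t by (simp_all add: r_def flip: of_real_mult)
  have nc: "c * cnj c + d * cnj d = of_real n" by (simp add: n_def cmod_power2_complex)
  have tn: "complex_of_real t * of_real n = 1" using n by (simp add: t_def)
  define \<kappa> where "\<kappa> = mk2 (of_real r * cnj d) (- (of_real r * cnj c)) (of_real r * c) (of_real r * d)"
  have r0: "complex_of_real r \<noteq> 0" using r by simp
  have 1: "of_real r * (of_real r * cnj d) + z * c = a"
  proof -
    have "of_real r * (of_real r * cnj d) + z * c = of_real t * (cnj d + (a * cnj c + b * cnj d) * c)"
      by (simp add: z_def rr(1)[symmetric] algebra_simps)
    also have "cnj d + (a * cnj c + b * cnj d) * c = a * (c * cnj c + d * cnj d) - cnj d * (a * d - b * c - 1)"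
      by (simp add: algebra_simps)
    finally show ?thesis using tn by (simp add: det nc mult.left_commute)
  qed
  have 2: "- (of_real r * (of_real r * cnj c)) + z * d = b"
  proof -
    have "- (of_real r * (of_real r * cnj c)) + z * d = of_real t * (- cnj c + (a * cnj c + b * cnj d) * d)"
      by (simp add: z_def rr(1)[symmetric] algebra_simps)
    also have "- cnj c + (a * cnj c + b * cnj d) * d = b * (c * cnj c + d * cnj d) + cnj c * (a * d - b * c - 1)"
      by (simp add: algebra_simps)
    finally show ?thesis using tn by (simp add: det nc mult.left_commute)
  qed
  have "g = upper z t ** \<kappa>"
    using 1 2 r0 by (intro matrix_2_eqI) (simp_all add: mat2_mult_nth \<kappa>_def abcd[symmetric] r_def[symmetric])
  moreover have "det \<kappa> = 1"
  proof -
    have "det \<kappa> = of_real r * of_real r * (c * cnj c + d * cnj d)" by (simp add: det_2 \<kappa>_def algebra_simps)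
    then show ?thesis using tn by (simp add: rr nc)
  qed
  moreover have "entry_norm \<kappa> \<le> 4"
  proof -
    have "(r * cmod c)\<^sup>2 + (r * cmod d)\<^sup>2 = r\<^sup>2 * n" by (simp add: power_mult_distrib n_def algebra_simps)
    also have "\<dots> = 1" using rr(2) n by (simp add: t_def)
    finally have "(r * cmod c)\<^sup>2 \<le> 1\<^sup>2" "(r * cmod d)\<^sup>2 \<le> 1\<^sup>2"
      using zero_le_power2[of "r * cmod c"] zero_le_power2[of "r * cmod d"] unfolding one_power2 by linarith+
    then have "r * cmod c \<le> 1" "r * cmod d \<le> 1" by (auto intro: power2_le_imp_le)
    then show ?thesis using r by (simp add: entry_norm_def \<kappa>_def norm_mult)
  qed
  ultimately show ?thesis using that t by blast
qed

text \<open>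
  Cocompactness of a set of matrices acting on \<open>SL\<^sub>2(\<complex>)\<close> from the left. This form is easy to transport
  along commensurability and avoids topology until the end.
\<close>

definition cobounded :: "(complex^2^2) set \<Rightarrow> bool" where
  "cobounded S \<longleftrightarrow>
     (\<exists>B. \<forall>g. det g = 1 \<longrightarrow> (\<exists>u\<in>S. \<exists>\<kappa>. g = u ** \<kappa> \<and> det u = 1 \<and> det \<kappa> = 1 \<and> entry_norm \<kappa> \<le> B))"

lemma topspace_quotient_topology: "topspace (quotient_topology T f) = f ` topspace T"
proof (rule subset_antisym)
  show "topspace (quotient_topology T f) \<subseteq> f ` topspace T"
    using openin_topspace[of "quotient_topology T f"] unfolding openin_quotient_topology by blast
  have "openin (quotient_topology T f) (f ` topspace T)"
  proof -
    have "{x \<in> topspace T. f x \<in> f ` topspace T} = topspace T" by blast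
    then show ?thesis by (simp add: openin_quotient_topology)
  qed
  then show "f ` topspace T \<subseteq> topspace (quotient_topology T f)" by (rule openin_subset)
qed

lemma compact_space_quotient:
  assumes "compactin T K" "f ` K = f ` topspace T"
  shows "compact_space (quotient_topology T f)"
proof -
  have "continuous_map T (quotient_topology T f) f"
    by (auto simp: continuous_map_def topspace_quotient_topology openin_quotient_topology)
  then have "compactin (quotient_topology T f) (f ` K)" using assms(1) by (rule image_compactin[rotated])
  then show ?thesis by (simp add: compact_space_def topspace_quotient_topology assms(2))
qed

text \<open>
  Every point of the half-space is \<open>g (0, 1)\<close> with \<open>g = u \<kappa>\<close>, so its orbit meets the set of points
  \<open>\<kappa> (0, 1)\<close>, which is contained in a compact set \<open>K\<close>.
\<close>

lemma cobounded_imp_cocompact: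
  assumes sub: "subgroup \<Gamma> PSL2C" and cb: "cobounded (lift_set \<Gamma>)"
  shows "cocompact \<Gamma>"
proof -
  interpret subgroup \<Gamma> PSL2C by fact
  obtain B where B: "\<And>g. det g = 1 \<Longrightarrow> \<exists>u\<in>lift_set \<Gamma>. \<exists>\<kappa>. g = u ** \<kappa> \<and> det u = 1 \<and> det \<kappa> = 1 \<and> entry_norm \<kappa> \<le> B"
    using cb unfolding cobounded_def by blast
  define C where "C = max B 1"
  have C1: "C \<ge> 1" by (simp add: C_def)
  define K where "K = cball (0::complex) (4 * C ^ 4) \<times> {1 / (2 * C\<^sup>2) .. 2 * C\<^sup>2 :: real}"
  have "compact K" unfolding K_def by (intro compact_Times) auto
  have K_sub: "K \<subseteq> hyp3"
  proof
    fix x assume "x \<in> K"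
    then have "1 / (2 * C\<^sup>2) \<le> snd x" by (auto simp: K_def)
    moreover have "1 / (2 * C\<^sup>2) > 0" using C1 by (intro divide_pos_pos mult_pos_pos) auto
    ultimately have "snd x > 0" by linarith
    then show "x \<in> hyp3" by (simp add: hyp3_def)
  qed
  have in_K: "hyp3_act \<kappa> (0, 1) \<in> K" if d: "det \<kappa> = 1" and n: "entry_norm \<kappa> \<le> B" for \<kappa>
  proof -
    define a b c d where abcd: "a = \<kappa> $ 1 $ 1" "b = \<kappa> $ 1 $ 2" "c = \<kappa> $ 2 $ 1" "d = \<kappa> $ 2 $ 2"
    define s where "s = (cmod d)\<^sup>2 + (cmod c)\<^sup>2"
    have le: "cmod a \<le> C" "cmod b \<le> C" "cmod c \<le> C" "cmod d \<le> C"
      using n norm_ge_zero[of a] norm_ge_zero[of b] norm_ge_zero[of c] norm_ge_zero[of d]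
      unfolding entry_norm_def abcd[symmetric] C_def by linarith+
    have sq: "x\<^sup>2 \<le> C\<^sup>2" if "0 \<le> x" "x \<le> C" for x using that by (simp add: power_mono)
    have s_le: "s \<le> 2 * C\<^sup>2" unfolding s_def using sq[OF _ le(3)] sq[OF _ le(4)] by simp
    have "1 = cmod (a * d - b * c)" using \<open>det \<kappa> = 1\<close> by (simp add: det_2 abcd)
    also have "\<dots> \<le> cmod a * cmod d + cmod b * cmod c" by (metis norm_mult norm_triangle_ineq4)
    also have "\<dots> \<le> C * cmod d + C * cmod c" using le by (intro add_mono mult_right_mono) auto
    finally have "1 \<le> C * (cmod d + cmod c)" by (simp add: algebra_simps)
    then have "1\<^sup>2 \<le> (C * (cmod d + cmod c))\<^sup>2" by (intro power_mono) auto
    also have "\<dots> = C\<^sup>2 * (cmod d + cmod c)\<^sup>2" by (simp add: power_mult_distrib)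
    also have "\<dots> \<le> C\<^sup>2 * (2 * s)"
    proof (intro mult_left_mono)
      show "(cmod d + cmod c)\<^sup>2 \<le> 2 * s"
        using zero_le_power2[of "cmod d - cmod c"] unfolding s_def by (simp add: power2_eq_square algebra_simps)
    qed auto
    finally have s_ge: "1 \<le> 2 * C\<^sup>2 * s" by simp
    have Cp: "C\<^sup>2 > 0" using C1 by simp
    have s0: "s > 0" using s_ge Cp by (smt (verit) mult_nonneg_nonpos zero_le_power2)
    have t_le: "1 / s \<le> 2 * C\<^sup>2" using s_ge s0 by (simp add: divide_simps mult.commute)
    have act: "hyp3_act \<kappa> (0, 1) = ((b * cnj d + a * cnj c) / of_real s, 1 / s)"
      by (simp add: hyp3_act_def Let_def abcd s_def)
    have "cmod (b * cnj d + a * cnj c) \<le> cmod b * cmod d + cmod a * cmod c"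
      by (metis norm_mult norm_triangle_ineq complex_mod_cnj)
    also have "\<dots> \<le> C * C + C * C" using le C1 by (intro add_mono mult_mono) auto
    also have "\<dots> = 2 * C\<^sup>2" by (simp add: power2_eq_square)
    finally have "cmod ((b * cnj d + a * cnj c) / of_real s) \<le> (2 * C\<^sup>2) * (1 / s)"
      using s0 by (simp add: norm_divide divide_right_mono)
    also have "\<dots> \<le> (2 * C\<^sup>2) * (2 * C\<^sup>2)" using t_le by (intro mult_left_mono) auto
    also have "\<dots> = 4 * C ^ 4" by (simp add: power2_eq_square power4_eq_xxxx)
    finally have "cmod ((b * cnj d + a * cnj c) / of_real s) \<le> 4 * C ^ 4" .
    moreover have "1 / (2 * C\<^sup>2) \<le> 1 / s" using s_le s0 Cp by (intro divide_left_mono) auto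
    ultimately show ?thesis using t_le by (simp add: act K_def)
  qed
  have L: "\<Union>\<Gamma> = lift_set \<Gamma>" by (rule Union_eq_lift_set[OF subset])
  have mult_L: "A ** u \<in> lift_set \<Gamma>" if "A \<in> lift_set \<Gamma>" "u \<in> lift_set \<Gamma>" for A u
    using that m_closed[of "psl A" "psl u"] by (auto simp: lift_set_def psl_mult det_mul)
  have inv_L: "adj2 u \<in> lift_set \<Gamma>" if "u \<in> lift_set \<Gamma>" for u
    using that m_inv_closed[OF _ , of "psl u"] subgroup.m_inv_closed[OF sub, of "psl u"]
    by (auto simp: lift_set_def psl_inv det_adj2)
  let ?f = "psl_orbit hyp3_act \<Gamma>"
  have "\<exists>q\<in>K. ?f p = ?f q" if p: "p \<in> hyp3" for p
  proof -
    obtain z t where pz: "p = (z, t)" "t > 0" using p by (cases p) (auto simp: hyp3_def)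
    obtain u \<kappa> where u: "u \<in> lift_set \<Gamma>" "upper z t = u ** \<kappa>" "det u = 1" "det \<kappa> = 1" "entry_norm \<kappa> \<le> B"
      using B[OF det_upper[OF pz(2)], of z] by blast
    define q where "q = hyp3_act \<kappa> (0, 1)"
    have base: "(0, 1) \<in> hyp3" by (simp add: hyp3_def)
    have qh: "q \<in> hyp3" unfolding q_def by (rule hyp3_act_in_hyp3[OF u(4) base])
    have pq: "p = hyp3_act u q"
      using upper_act_base[OF pz(2), of z] hyp3_act_mult[OF u(3,4) base] u(2) pz(1) by (simp add: q_def)
    have "?f p = ?f q"
      unfolding psl_orbit_def L
    proof (intro subset_antisym subsetI)
      fix x assume "x \<in> (\<lambda>A. hyp3_act A p) ` lift_set \<Gamma>"
      then obtain A where A: "A \<in> lift_set \<Gamma>" "x = hyp3_act A p" by blast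
      then have "x = hyp3_act (A ** u) q" using hyp3_act_mult[of A u q] u qh pq by (simp add: lift_set_def)
      then show "x \<in> (\<lambda>A. hyp3_act A q) ` lift_set \<Gamma>" using mult_L[OF A(1) u(1)] by blast
    next
      fix x assume "x \<in> (\<lambda>A. hyp3_act A q) ` lift_set \<Gamma>"
      then obtain A where A: "A \<in> lift_set \<Gamma>" "x = hyp3_act A q" by blast
      have "hyp3_act (A ** adj2 u) p = hyp3_act ((A ** adj2 u) ** u) q"
        using hyp3_act_mult[of "A ** adj2 u" u q] A(1) u qh pq by (simp add: lift_set_def det_mul det_adj2)
      then have "x = hyp3_act (A ** adj2 u) p" using A(2) adj2_cancel(4)[OF u(3)] by simp
      then show "x \<in> (\<lambda>A. hyp3_act A p) ` lift_set \<Gamma>" using mult_L[OF A(1) inv_L[OF u(1)]] by blast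
    qed
    moreover have "q \<in> K" unfolding q_def by (rule in_K[OF u(4,5)])
    ultimately show ?thesis by blast
  qed
  then have "?f ` hyp3 \<subseteq> ?f ` K" by (metis image_eqI image_subsetI)
  then have "?f ` K = ?f ` topspace (top_of_set hyp3)" using image_mono[OF K_sub, of ?f] by simp
  moreover have "compactin (top_of_set hyp3) K" using \<open>compact K\<close> K_sub by (simp add: compactin_subtopology)
  ultimately show ?thesis unfolding cocompact_def by (intro compact_space_quotient)
qed

lemma cobounded_commensurable:
  assumes "cobounded S" "det g = 1" "finite T"
    and cover: "\<And>B. B \<in> S \<Longrightarrow> \<exists>A\<in>S'. \<exists>t\<in>T. B = conjugate_by g A ** t" and S': "\<And>A. A \<in> S' \<Longrightarrow> det A = 1"
  shows "cobounded S'"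
proof -
  obtain B where B: "\<And>g. det g = 1 \<Longrightarrow> \<exists>u\<in>S. \<exists>\<kappa>. g = u ** \<kappa> \<and> det u = 1 \<and> det \<kappa> = 1 \<and> entry_norm \<kappa> \<le> B"
    using assms(1) unfolding cobounded_def by blast
  define M where "M = (\<Sum>t\<in>T. entry_norm t)"
  have "\<exists>u\<in>S'. \<exists>\<kappa>. x = u ** \<kappa> \<and> det u = 1 \<and> det \<kappa> = 1 \<and> entry_norm \<kappa> \<le> entry_norm (adj2 g) * M * B"
    if x: "det x = 1" for x
  proof -
    have "det (g ** x) = 1" using x assms(2) by (simp add: det_mul)
    then obtain u \<kappa> where u: "u \<in> S" "g ** x = u ** \<kappa>" "det u = 1" "det \<kappa> = 1" "entry_norm \<kappa> \<le> B" using B by blast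
    obtain A t where A: "A \<in> S'" "t \<in> T" "u = conjugate_by g A ** t" using cover[OF u(1)] by blast
    define \<kappa>' where "\<kappa>' = adj2 g ** t ** \<kappa>"
    have "x = adj2 g ** (u ** \<kappa>)" using adj2_cancel(2)[OF assms(2), of x] u(2) by simp
    also have "\<dots> = (adj2 g ** g) ** A ** \<kappa>'" by (simp add: A(3) conjugate_by_def \<kappa>'_def matrix_mul_assoc)
    finally have e: "x = A ** \<kappa>'" using adj2_mult(2)[of g] assms(2) by simp
    have "det \<kappa>' = 1" using e x S'[OF A(1)] by (simp add: det_mul)
    moreover have "entry_norm \<kappa>' \<le> entry_norm (adj2 g) * M * B"
    proof -
      have "entry_norm t \<le> M" unfolding M_def using A(2) assms(3) entry_norm_nonneg by (intro member_le_sum) auto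
      moreover have "entry_norm \<kappa>' \<le> entry_norm (adj2 g) * entry_norm t * entry_norm \<kappa>"
        unfolding \<kappa>'_def using entry_norm_nonneg entry_norm_mult
        by (meson mult_right_mono order_trans)
      ultimately show ?thesis using u(5) entry_norm_nonneg
        by (smt (verit) mult_left_mono mult_right_mono mult_nonneg_nonneg)
    qed
    ultimately show ?thesis using e A(1) S' by blast
  qed
  then show ?thesis unfolding cobounded_def by blast
qed

section \<open>Quaternion algebras and orders inside \<open>M\<^sub>2(\<complex>)\<close>\<close>

lemma vec4_eqI:
  "x $ 1 = y $ 1 \<Longrightarrow> x $ 2 = y $ 2 \<Longrightarrow> x $ 3 = y $ 3 \<Longrightarrow> x $ 4 = y $ 4 \<Longrightarrow> x = (y :: 'a^4)"
  by (simp add: vec_eq_iff forall_4)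

lemma quat_mult_nth [simp]:
  "quat_mult a b x y $ 1 = x$1 * y$1 + a * x$2 * y$2 + b * x$3 * y$3 - a * b * x$4 * y$4"
  "quat_mult a b x y $ 2 = x$1 * y$2 + x$2 * y$1 - b * x$3 * y$4 + b * x$4 * y$3"
  "quat_mult a b x y $ 3 = x$1 * y$3 + x$3 * y$1 + a * x$2 * y$4 - a * x$4 * y$2"
  "quat_mult a b x y $ 4 = x$1 * y$4 + x$4 * y$1 + x$2 * y$3 - x$3 * y$2"
  by (simp_all add: quat_mult_def)

lemma quat_conj_nth [simp]:
  "quat_conj x $ 1 = x $ 1" "quat_conj x $ 2 = - x $ 2" "quat_conj x $ 3 = - x $ 3" "quat_conj x $ 4 = - x $ 4"
  by (simp_all add: quat_conj_def)

lemma quat_norm_eq: "quat_norm a b x = (x$1)\<^sup>2 - a * (x$2)\<^sup>2 - b * (x$3)\<^sup>2 + a * b * (x$4)\<^sup>2"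
  by (simp add: quat_norm_def power2_eq_square)

lemma quat_norm_mult: "quat_norm a b (quat_mult a b x y) = quat_norm a b x * quat_norm a b y"
  unfolding quat_norm_eq by (simp add: power2_eq_square algebra_simps)

lemma quat_mult_conj: "quat_mult a b x (quat_conj x) = quat_norm a b x *s axis 1 1"
  by (rule vec4_eqI) (simp_all add: quat_norm_eq axis_def power2_eq_square algebra_simps)

lemma eigenvalue_pair_2:
  fixes M :: "complex^2^2"
  obtains l1 l2 where "l1 + l2 = trace M" "l1 * l2 = det M"
    "\<And>l. l = l1 \<or> l = l2 \<Longrightarrow> \<exists>p q. (p \<noteq> 0 \<or> q \<noteq> 0) \<and> p * M $ 1 $ 1 + q * M $ 2 $ 1 = l * p \<and> p * M $ 1 $ 2 + q * M $ 2 $ 2 = l * q"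
proof -
  define s where "s = csqrt ((trace M)\<^sup>2 - 4 * det M)"
  have s: "s\<^sup>2 = (trace M)\<^sup>2 - 4 * det M" by (simp add: s_def)
  define l1 l2 where l: "l1 = (trace M + s) / 2" "l2 = (trace M - s) / 2"
  have 1: "l1 + l2 = trace M" by (simp add: l field_simps)
  have "l1 * l2 = ((trace M)\<^sup>2 - s\<^sup>2) / 4" by (simp add: l power2_eq_square algebra_simps)
  then have 2: "l1 * l2 = det M" by (simp add: s)
  have "\<exists>p q. (p \<noteq> 0 \<or> q \<noteq> 0) \<and> p * M $ 1 $ 1 + q * M $ 2 $ 1 = x * p \<and> p * M $ 1 $ 2 + q * M $ 2 $ 2 = x * q"
    if x: "x = l1 \<or> x = l2" for x
  proof -
    have "(x - l1) * (x - l2) = 0" using x by auto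
    then have "x\<^sup>2 - (l1 + l2) * x + l1 * l2 = 0" by (simp add: power2_eq_square algebra_simps)
    then have "x\<^sup>2 - trace M * x + det M = 0" by (simp add: 1 2)
    then have e: "(M $ 1 $ 1 - x) * (M $ 2 $ 2 - x) = M $ 1 $ 2 * M $ 2 $ 1"
      by (simp add: trace2 det_2 power2_eq_square algebra_simps)
    show ?thesis
    proof (cases "M $ 2 $ 1 = 0 \<and> M $ 1 $ 1 = x")
      case False
      then show ?thesis using e
        by (intro exI[of _ "M $ 2 $ 1"] exI[of _ "x - M $ 1 $ 1"]) (auto simp: algebra_simps)
    next
      case True
      note T = this
      show ?thesis
      proof (cases "M $ 1 $ 2 = 0 \<and> M $ 2 $ 2 = x")
        case True
        then show ?thesis using T by (intro exI[of _ 1] exI[of _ 0]) auto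
      next
        case False
        then show ?thesis using T
          by (intro exI[of _ "M $ 2 $ 2 - x"] exI[of _ "- M $ 1 $ 2"]) (auto simp: algebra_simps)
      qed
    qed
  qed
  then show ?thesis using that 1 2 by blast
qed

text \<open>
  The data in the definition of an arithmetic Kleinian group, over a field with a primitive element.
\<close>

locale quaternion_order = primitive_field k \<theta> m for k \<theta> m +
  fixes a b :: complex and R :: "(complex^4) set" and \<rho> :: "complex^4 \<Rightarrow> complex^2^2"
  assumes field_k: "csubfield k" and a: "a \<in> k" "a \<noteq> 0" and b: "b \<in> k" "b \<noteq> 0"
    and order: "quat_order k a b R" and embedding: "quat_embedding k a b \<rho>"
begin

definition quats :: "(complex^4) set" where "quats = {x. \<forall>i. x $ i \<in> k}"

lemma quats_iff: "x \<in> quats \<longleftrightarrow> x $ 1 \<in> k \<and> x $ 2 \<in> k \<and> x $ 3 \<in> k \<and> x $ 4 \<in> k"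
  by (simp add: quats_def forall_4)

lemmas k_closed = csubring_closed[OF csubring_k]

lemma carrier_quat: "carrier (quat_algebra k a b) = quats"
  by (simp add: quat_algebra_def quats_def)

lemma quats_closed:
  "x \<in> quats \<Longrightarrow> y \<in> quats \<Longrightarrow> x + y \<in> quats" "x \<in> quats \<Longrightarrow> y \<in> quats \<Longrightarrow> quat_mult a b x y \<in> quats"
  "c \<in> k \<Longrightarrow> x \<in> quats \<Longrightarrow> c *s x \<in> quats" "x \<in> quats \<Longrightarrow> quat_conj x \<in> quats" "axis i 1 \<in> quats"
  "0 \<in> quats"
  using a b by (auto simp: quats_iff axis_def intro!: k_closed)

lemma rho_hom:
  "x \<in> quats \<Longrightarrow> y \<in> quats \<Longrightarrow> \<rho> (x + y) = \<rho> x + \<rho> y"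
  "x \<in> quats \<Longrightarrow> y \<in> quats \<Longrightarrow> \<rho> (quat_mult a b x y) = \<rho> x ** \<rho> y"
  "\<rho> (axis 1 1) = mat 1" "c \<in> k \<Longrightarrow> x \<in> quats \<Longrightarrow> \<rho> (c *s x) = mat c ** \<rho> x"
  using embedding
  by (auto simp: quat_embedding_def ring_hom_def quat_algebra_def M2C_def quats_def)

definition I where "I = \<rho> (axis 2 1)"
definition J where "J = \<rho> (axis 3 1)"

lemma rho_expand:
  assumes x: "x \<in> quats"
  shows "\<rho> x = mat (x $ 1) + mat (x $ 2) ** I + mat (x $ 3) ** J + mat (x $ 4) ** (I ** J)"
proof -
  have ij: "\<rho> (axis 4 1) = I ** J"
  proof -
    have "quat_mult a b (axis 2 1) (axis 3 1) = axis 4 1" by (rule vec4_eqI) (simp_all add: axis_def)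
    then show ?thesis unfolding I_def J_def using rho_hom(2)[OF quats_closed(5) quats_closed(5)] by metis
  qed
  have e: "x = x $ 1 *s axis 1 1 + x $ 2 *s axis 2 1 + x $ 3 *s axis 3 1 + x $ 4 *s axis 4 1"
    by (rule vec4_eqI) (simp_all add: axis_def)
  have xk: "x $ i \<in> k" for i using x by (simp add: quats_def)
  have "\<rho> x = \<rho> (x $ 1 *s axis 1 1) + \<rho> (x $ 2 *s axis 2 1) + \<rho> (x $ 3 *s axis 3 1) + \<rho> (x $ 4 *s axis 4 1)"
    by (subst e, simp only: rho_hom(1) quats_closed(1,3,5) xk)
  also have "\<dots> = mat (x $ 1) ** \<rho> (axis 1 1) + mat (x $ 2) ** \<rho> (axis 2 1) + mat (x $ 3) ** \<rho> (axis 3 1) + mat (x $ 4) ** \<rho> (axis 4 1)"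
    by (simp only: rho_hom(4) quats_closed(5) xk)
  finally show ?thesis by (simp add: rho_hom(3) ij flip: I_def J_def)
qed

lemma IJ_relations: "I ** I = mat a" "J ** J = mat b" "J ** I = - (I ** J)"
proof -
  have q: "axis i 1 \<in> quats" for i by (rule quats_closed(5))
  have "quat_mult a b (axis 2 1) (axis 2 1) = a *s axis 1 1" "quat_mult a b (axis 3 1) (axis 3 1) = b *s axis 1 1"
    "quat_mult a b (axis 3 1) (axis 2 1) = (-1) *s quat_mult a b (axis 2 1) (axis 3 1)"
    by (auto intro!: vec4_eqI simp: axis_def)
  moreover have "-1 \<in> k" using k_closed(2,3) by blast
  ultimately
  have "I ** I = mat a ** mat 1" "J ** J = mat b ** mat 1" "J ** I = mat (-1) ** (I ** J)"
    unfolding I_def J_def using a b q quats_closed(2) by (metis rho_hom(2,3,4))+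
  moreover have "mat (-1) ** M = - M" for M :: "complex^2^2" by (rule matrix_2_eqI) (simp_all add: mat2_mult_nth)
  ultimately show "I ** I = mat a" "J ** J = mat b" "J ** I = - (I ** J)" by auto
qed

text \<open>
  Each of these matrices anticommutes with an invertible one.
\<close>

lemma trace_IJ: "trace I = 0" "trace J = 0" "trace (I ** J) = 0"
proof -
  have tm: "trace (mat c ** M) = c * trace M" for c and M :: "complex^2^2"
    by (simp add: trace2 mat2_mult_nth algebra_simps)
  have cm: "M ** mat c = mat c ** M" for c and M :: "complex^2^2"
    by (rule matrix_2_eqI) (simp_all add: mat2_mult_nth)
  have "trace (J ** (I ** J)) = trace ((I ** J) ** J)" by (rule trace_mul_sym)
  moreover have "J ** (I ** J) = - (I ** J ** J)" by (simp add: matrix_mul_assoc IJ_relations)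
  moreover have "I ** J ** J = mat b ** I" by (simp add: IJ_relations cm flip: matrix_mul_assoc)
  ultimately have "- (b * trace I) = b * trace I" by (simp add: tm)
  then show "trace I = 0" using b by (simp add: neg_equal_iff_equal eq_neg_iff_add_eq_0 neg_eq_iff_add_eq_0 flip: mult_2)
  have "trace (I ** (J ** I)) = trace ((J ** I) ** I)" by (rule trace_mul_sym)
  moreover have "I ** (J ** I) = - (mat a ** J)" by (simp add: matrix_mul_assoc IJ_relations)
  moreover have "(J ** I) ** I = mat a ** J"
  proof -
    have "(J ** I) ** I = - ((I ** J) ** I)" by (simp only: IJ_relations(3) mult_minus2)
    also have "\<dots> = - (I ** (J ** I))" by (simp only: matrix_mul_assoc)
    finally show ?thesis using \<open>I ** (J ** I) = - (mat a ** J)\<close> by simp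
  qed
  ultimately have "- (a * trace J) = a * trace J" by (simp add: tm)
  then show "trace J = 0" using a by (simp add: neg_equal_iff_equal eq_neg_iff_add_eq_0 neg_eq_iff_add_eq_0 flip: mult_2)
  have "trace (J ** I) = trace (I ** J)" by (rule trace_mul_sym)
  then have "- trace (I ** J) = trace (I ** J)" by (simp add: IJ_relations)
  then show "trace (I ** J) = 0" by (simp add: neg_eq_iff_add_eq_0 flip: mult_2)
qed

lemma rho_nth:
  assumes "x \<in> quats"
  shows "\<rho> x $ i $ j = x $ 1 * (mat 1 :: complex^2^2) $ i $ j + x $ 2 * I $ i $ j + x $ 3 * J $ i $ j + x $ 4 * (I ** J) $ i $ j"
proof -
  have "(mat c ** M) $ i $ j = c * M $ i $ j" for c and M :: "complex^2^2"
    using exhaust_2[of i] exhaust_2[of j] by (auto simp: mat2_mult_nth)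
  moreover have "(mat c :: complex^2^2) $ i $ j = c * (mat 1 :: complex^2^2) $ i $ j" for c
    by (simp add: mat_def)
  ultimately show ?thesis unfolding rho_expand[OF assms] by (metis vector_add_component)
qed

lemma trace_rho: "x \<in> quats \<Longrightarrow> trace (\<rho> x) = 2 * x $ 1"
proof -
  assume x: "x \<in> quats"
  have "trace (\<rho> x) = 2 * x $ 1 + x $ 2 * trace I + x $ 3 * trace J + x $ 4 * trace (I ** J)"
    unfolding trace2 rho_nth[OF x] by (simp add: algebra_simps)
  then show ?thesis by (simp add: trace_IJ)
qed

text \<open>
  Both sides are \<open>tr (\<rho> x) - \<rho> x\<close>. So the reduced norm is the determinant.
\<close>

lemma rho_conj: "x \<in> quats \<Longrightarrow> \<rho> (quat_conj x) = adj2 (\<rho> x)"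
proof -
  assume x: "x \<in> quats"
  have "\<rho> (quat_conj x) $ i $ j = (if i = j then trace (\<rho> x) else 0) - \<rho> x $ i $ j" for i j
    unfolding rho_nth[OF x] rho_nth[OF quats_closed(4)[OF x]] trace_rho[OF x] by (simp add: mat_def)
  then show ?thesis by (intro matrix_2_eqI) (simp_all add: trace2)
qed

lemma det_rho: "x \<in> quats \<Longrightarrow> det (\<rho> x) = quat_norm a b x"
proof -
  assume x: "x \<in> quats"
  have "quat_norm a b x \<in> k" using x a b unfolding quat_norm_eq
    by (auto simp: quats_iff intro!: k_closed csubring_power csubring_k)
  then have "\<rho> x ** adj2 (\<rho> x) = mat (quat_norm a b x) ** mat 1"
    using arg_cong[OF quat_mult_conj[of a b x], of \<rho>] x
    by (simp add: rho_hom quats_closed rho_conj)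
  then have "mat (det (\<rho> x)) = (mat (quat_norm a b x) :: complex^2^2)" by (simp add: adj2_mult)
  then have "(mat (det (\<rho> x)) :: complex^2^2) $ 1 $ 1 = (mat (quat_norm a b x) :: complex^2^2) $ 1 $ 1" by simp
  then show ?thesis by simp
qed

subsection \<open>The order\<close>

lemma csubring_integers: "csubring (ring_of_integers k)"
proof -
  have "ring_of_integers k = k \<inter> {x. algebraic_int x}" by (auto simp: ring_of_integers_def)
  then show ?thesis using csubring_k csubring_algebraic_int by (auto simp: csubring_def)
qed

lemma order_subset: "R \<subseteq> quats"
proof -
  have "subring R (quat_algebra k a b)" using order by (simp add: quat_order_def)
  then have "submonoid R (quat_algebra k a b)" by (simp add: subring_def)
  then show ?thesis using carrier_quat by (auto dest: submonoid.subset)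
qed

lemma order_closed:
  "x \<in> R \<Longrightarrow> y \<in> R \<Longrightarrow> x + y \<in> R" "x \<in> R \<Longrightarrow> y \<in> R \<Longrightarrow> quat_mult a b x y \<in> R"
  "axis 1 1 \<in> R" "0 \<in> R"
proof -
  have s: "subring R (quat_algebra k a b)" using order by (simp add: quat_order_def)
  then have 1: "submonoid R (quat_algebra k a b)" and 2: "subgroup R (add_monoid (quat_algebra k a b))"
    by (simp_all add: subring_def)
  show "x \<in> R \<Longrightarrow> y \<in> R \<Longrightarrow> x + y \<in> R" using subgroup.m_closed[OF 2, of x y] by (simp add: quat_algebra_def)
  show "x \<in> R \<Longrightarrow> y \<in> R \<Longrightarrow> quat_mult a b x y \<in> R"
    using submonoid.m_closed[OF 1, of x y] by (simp add: quat_algebra_def)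
  show "axis 1 1 \<in> R" using submonoid.one_closed[OF 1] by (simp add: quat_algebra_def)
  show "0 \<in> R" using subgroup.one_closed[OF 2] by (simp add: quat_algebra_def)
qed

lemma order_sum: "(\<And>i. i \<in> A \<Longrightarrow> f i \<in> R) \<Longrightarrow> sum f A \<in> R"
  by (induction A rule: infinite_finite_induct) (auto intro: order_closed)

lemma order_scale:
  assumes c: "c \<in> ring_of_integers k" and x: "x \<in> R"
  shows "c *s x \<in> R"
proof -
  obtain B where B: "R = lin_span (ring_of_integers k) B" using order by (auto simp: quat_order_def)
  obtain F d where F: "finite F" "F \<subseteq> B" "d ` F \<subseteq> ring_of_integers k" "x = (\<Sum>v\<in>F. d v *s v)"
    using x unfolding B lin_span_def by blast
  have "c *s x = (\<Sum>v\<in>F. (c * d v) *s v)"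
    unfolding F(4) by (simp add: vec_eq_iff sum_distrib_left mult.assoc)
  moreover have "(\<lambda>v. c * d v) ` F \<subseteq> ring_of_integers k"
    using F(3) c csubring_closed(6)[OF csubring_integers] by auto
  ultimately show ?thesis unfolding B lin_span_def using F(1,2)
    by (intro CollectI exI[of _ F] exI[of _ "\<lambda>v. c * d v"] conjI)
qed

lemma of_int_integers: "of_int n \<in> ring_of_integers k"
  by (rule csubring_of_int[OF csubring_integers])

lemma order_minus: "x \<in> R \<Longrightarrow> y \<in> R \<Longrightarrow> x - y \<in> R"
proof -
  assume "x \<in> R" "y \<in> R"
  then have "x + of_int (- 1) *s y \<in> R" using order_closed(1) order_scale of_int_integers by blast
  moreover have "x + of_int (- 1) *s y = x - y" by (simp add: vec_eq_iff)
  ultimately show ?thesis by simp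
qed

text \<open>
  Products of generators of \<open>R\<close> over the ring of integers with generators of that ring over \<open>\<int>\<close>.
\<close>

lemma order_finitely_generated:
  obtains A :: "((complex^4) \<times> complex) set" and w where "finite A" "\<And>i. i \<in> A \<Longrightarrow> w i \<in> R"
    "\<And>x. x \<in> R \<Longrightarrow> \<exists>c :: (complex^4) \<times> complex \<Rightarrow> int. x = (\<Sum>i\<in>A. of_int (c i) *s w i)"
proof -
  obtain B where B: "finite B" "R = lin_span (ring_of_integers k) B" using order by (auto simp: quat_order_def)
  obtain G where G: "finite G" "G \<subseteq> ring_of_integers k"
    "\<And>x. x \<in> ring_of_integers k \<Longrightarrow> \<exists>c :: complex \<Rightarrow> int. x = (\<Sum>g\<in>G. of_int (c g) * g)"
    using ring_of_integers_finitely_generated by blast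
  have BR: "v \<in> R" if "v \<in> B" for v
    unfolding B(2) lin_span_def using that csubring_closed(2)[OF csubring_integers]
    by (auto intro!: exI[of _ "{v}"] exI[of _ "\<lambda>_. 1"])
  show ?thesis
  proof (rule that[of "B \<times> G" "\<lambda>(v, g). g *s v"])
    show "finite (B \<times> G)" using B G by simp
    show "(case i of (v, g) \<Rightarrow> g *s v) \<in> R" if "i \<in> B \<times> G" for i
      using that BR G(2) order_scale by auto
    fix x assume "x \<in> R"
    then obtain F d where F: "finite F" "F \<subseteq> B" "d ` F \<subseteq> ring_of_integers k" "x = (\<Sum>v\<in>F. d v *s v)"
      unfolding B(2) lin_span_def by blast
    define d' where "d' v = (if v \<in> F then d v else 0)" for v
    have x: "x = (\<Sum>v\<in>B. d' v *s v)"
      unfolding F(4) d'_def by (rule sum.mono_neutral_cong_left[OF B(1) F(2)]) auto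
    have "d' v \<in> ring_of_integers k" for v
      using F(3) csubring_closed(1)[OF csubring_integers] by (auto simp: d'_def)
    then have "\<forall>v. \<exists>c :: complex \<Rightarrow> int. d' v = (\<Sum>g\<in>G. of_int (c g) * g)" using G(3) by blast
    then obtain c :: "complex^4 \<Rightarrow> complex \<Rightarrow> int" where c: "\<And>v. d' v = (\<Sum>g\<in>G. of_int (c v g) * g)" by metis
    have "x = (\<Sum>v\<in>B. \<Sum>g\<in>G. of_int (c v g) *s (g *s v))"
      unfolding x c by (simp add: vec_eq_iff sum_distrib_right mult.assoc)
    also have "\<dots> = (\<Sum>i\<in>B \<times> G. of_int (case i of (v, g) \<Rightarrow> c v g) *s (case i of (v, g) \<Rightarrow> g *s v))"
      by (simp add: sum.cartesian_product case_prod_unfold)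
    finally show "\<exists>c :: (complex^4) \<times> complex \<Rightarrow> int. x = (\<Sum>i\<in>B \<times> G. of_int (c i) *s (case i of (v, g) \<Rightarrow> g *s v))" by blast
  qed
qed

lemma rho_sum:
  assumes "\<And>i. i \<in> A \<Longrightarrow> f i \<in> quats"
  shows "\<rho> (sum f A) = (\<Sum>i\<in>A. \<rho> (f i))"
  using assms
proof (induction A rule: infinite_finite_induct)
  case (insert i A)
  have "sum f A \<in> quats" using insert by (auto simp: quats_def intro!: csubring_sum[OF csubring_k])
  then show ?case using insert by (simp add: rho_hom)
next
  case empty
  have "\<rho> 0 = \<rho> (0 + 0)" by simp
  also have "\<dots> = \<rho> 0 + \<rho> 0" by (rule rho_hom(1)[OF quats_closed(6) quats_closed(6)])
  finally show ?case by simp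
next
  case (infinite A)
  have "\<rho> 0 = \<rho> (0 + 0)" by simp
  also have "\<dots> = \<rho> 0 + \<rho> 0" by (rule rho_hom(1)[OF quats_closed(6) quats_closed(6)])
  finally show ?case using infinite by simp
qed

text \<open>
  For a left eigenvector \<open>(p, q)\<close> of \<open>\<rho> r\<close>, the maps \<open>\<phi> j\<close> that send \<open>x\<close> to the entries of \<open>(p, q) \<rho> x\<close> turn the
  left multiplication by \<open>r\<close> on the finitely generated group \<open>R\<close> into the multiplication by \<open>l\<close>.
\<close>

lemma eigenvalue_integral:
  assumes r: "r \<in> R" and pq: "p \<noteq> 0 \<or> q \<noteq> 0"
    and e: "p * \<rho> r $ 1 $ 1 + q * \<rho> r $ 2 $ 1 = l * p" "p * \<rho> r $ 1 $ 2 + q * \<rho> r $ 2 $ 2 = l * q"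
  shows "algebraic_int l"
proof -
  obtain A and w :: "(complex^4) \<times> complex \<Rightarrow> complex^4" where A: "finite A" "\<And>i. i \<in> A \<Longrightarrow> w i \<in> R"
    "\<And>x. x \<in> R \<Longrightarrow> \<exists>c :: (complex^4) \<times> complex \<Rightarrow> int. x = (\<Sum>i\<in>A. of_int (c i) *s w i)"
    using order_finitely_generated by metis
  define \<phi> where "\<phi> j x = p * \<rho> x $ 1 $ j + q * \<rho> x $ 2 $ j" for j x
  have lin: "\<phi> j (\<Sum>i\<in>A. of_int (c i) *s w i) = (\<Sum>i\<in>A. of_int (c i) * \<phi> j (w i))" for j and c :: "_ \<Rightarrow> int"
  proof -
    have wq: "w i \<in> quats" if "i \<in> A" for i using A(2)[OF that] order_subset by blast
    have ck: "of_int n \<in> k" for n by (rule csubring_of_int[OF csubring_k])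
    have "\<rho> (\<Sum>i\<in>A. of_int (c i) *s w i) = (\<Sum>i\<in>A. mat (of_int (c i)) ** \<rho> (w i))"
      using wq ck by (subst rho_sum) (auto intro!: quats_closed sum.cong simp: rho_hom)
    moreover have "(mat x ** M) $ i $ j = x * M $ i $ j" for x and M :: "complex^2^2" and i
      using exhaust_2[of i] by (auto simp: mat2_mult_nth)
    ultimately show ?thesis by (simp add: \<phi>_def sum_distrib_left sum.distrib algebra_simps)
  qed
  have mult: "\<phi> j (quat_mult a b r x) = l * \<phi> j x" if "x \<in> R" for j x
  proof -
    have "\<rho> (quat_mult a b r x) = \<rho> r ** \<rho> x" using that r order_subset by (intro rho_hom) auto
    then have "\<phi> j (quat_mult a b r x) = (p * \<rho> r $ 1 $ 1 + q * \<rho> r $ 2 $ 1) * \<rho> x $ 1 $ j +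
        (p * \<rho> r $ 1 $ 2 + q * \<rho> r $ 2 $ 2) * \<rho> x $ 2 $ j"
      by (simp add: \<phi>_def mat2_mult_nth algebra_simps)
    then show ?thesis by (simp add: e \<phi>_def algebra_simps)
  qed
  have "\<phi> 1 (axis 1 1) = p" "\<phi> 2 (axis 1 1) = q" by (simp_all add: \<phi>_def rho_hom)
  then obtain j where j: "\<phi> j (axis 1 1) \<noteq> 0" using pq by metis
  obtain c0 :: "(complex^4) \<times> complex \<Rightarrow> int" where c0: "axis 1 1 = (\<Sum>i\<in>A. of_int (c0 i) *s w i)"
    using A(3)[OF order_closed(3)] by blast
  have "\<phi> j (axis 1 1) = (\<Sum>i\<in>A. of_int (c0 i) * \<phi> j (w i))" by (subst c0) (rule lin)
  then have "\<exists>i\<in>A. \<phi> j (w i) \<noteq> 0" using j by (auto intro: ccontr)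
  then obtain i0 where i0: "i0 \<in> A" "\<phi> j (w i0) \<noteq> 0" by blast
  show ?thesis
  proof (rule algebraic_int_if_eigenvalue[where I = A and v = "\<lambda>i. \<phi> j (w i)", OF A(1) i0])
    fix i assume i: "i \<in> A"
    obtain c :: "(complex^4) \<times> complex \<Rightarrow> int" where c: "quat_mult a b r (w i) = (\<Sum>i\<in>A. of_int (c i) *s w i)"
      using A(3)[OF order_closed(2)[OF r A(2)[OF i]]] by blast
    have "l * \<phi> j (w i) = \<phi> j (quat_mult a b r (w i))" using mult[OF A(2)[OF i]] by simp
    also have "\<dots> = (\<Sum>i\<in>A. of_int (c i) * \<phi> j (w i))" by (subst c) (rule lin)
    finally show "\<exists>c. (\<forall>j\<in>A. c j \<in> \<int>) \<and> l * \<phi> j (w i) = (\<Sum>i\<in>A. c i * \<phi> j (w i))"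
      by (intro exI[of _ "\<lambda>i. of_int (c i)"]) auto
  qed
qed

lemma norm_trace_integral:
  assumes "r \<in> R"
  shows "quat_norm a b r \<in> ring_of_integers k" "2 * r $ 1 \<in> ring_of_integers k"
proof -
  have rq: "r \<in> quats" using assms order_subset by blast
  obtain l1 l2 where l: "l1 + l2 = trace (\<rho> r)" "l1 * l2 = det (\<rho> r)"
    "\<And>l. l = l1 \<or> l = l2 \<Longrightarrow> \<exists>p q. (p \<noteq> 0 \<or> q \<noteq> 0) \<and> p * \<rho> r $ 1 $ 1 + q * \<rho> r $ 2 $ 1 = l * p \<and> p * \<rho> r $ 1 $ 2 + q * \<rho> r $ 2 $ 2 = l * q"
    using eigenvalue_pair_2[of "\<rho> r"] by metis
  have "algebraic_int l1" "algebraic_int l2"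
    using l(3)[of l1] l(3)[of l2] eigenvalue_integral[OF assms] by blast+
  then have "algebraic_int (trace (\<rho> r))" "algebraic_int (det (\<rho> r))"
    using algebraic_int_add_mult l(1,2) by metis+
  moreover have "quat_norm a b r \<in> k" "2 * r $ 1 \<in> k" using rq a b csubring_of_nat[OF csubring_k, of 2]
    by (auto simp: quat_norm_eq quats_iff intro!: k_closed csubring_power csubring_k)
  ultimately show "quat_norm a b r \<in> ring_of_integers k" "2 * r $ 1 \<in> ring_of_integers k"
    using rq by (auto simp: ring_of_integers_def det_rho trace_rho)
qed

text \<open>
  The conjugate of \<open>r\<close> is \<open>tr r - r\<close>.
\<close>

lemma order_conj: "r \<in> R \<Longrightarrow> quat_conj r \<in> R"
proof -
  assume r: "r \<in> R"
  have "quat_conj r = (2 * r $ 1) *s axis 1 1 - r" by (rule vec4_eqI) (simp_all add: axis_def)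
  then show ?thesis using order_minus[OF order_scale[OF norm_trace_integral(2)[OF r] order_closed(3)] r] by simp
qed

definition units1 :: "(complex^2^2) set" where
  "units1 = \<rho> ` {x \<in> R. quat_norm a b x = 1}"

lemma units1_det: "A \<in> units1 \<Longrightarrow> det A = 1"
  using order_subset by (auto simp: units1_def det_rho)

lemma units1_closed:
  "A \<in> units1 \<Longrightarrow> B \<in> units1 \<Longrightarrow> A ** B \<in> units1" "A \<in> units1 \<Longrightarrow> adj2 A \<in> units1"
  "A \<in> units1 \<Longrightarrow> - A \<in> units1" "mat 1 \<in> units1"
proof -
  show "A ** B \<in> units1" if AB: "A \<in> units1" "B \<in> units1" for A B
  proof -
    obtain x y where xy: "x \<in> R" "y \<in> R" "quat_norm a b x = 1" "quat_norm a b y = 1" "A = \<rho> x" "B = \<rho> y"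
      using AB by (auto simp: units1_def)
    then have "A ** B = \<rho> (quat_mult a b x y)" using order_subset by (simp add: rho_hom subset_iff)
    then show ?thesis using xy order_closed(2)[of x y] by (auto simp: units1_def quat_norm_mult)
  qed
  show "adj2 A \<in> units1" if A: "A \<in> units1"
  proof -
    obtain x where x: "x \<in> R" "quat_norm a b x = 1" "A = \<rho> x" using A by (auto simp: units1_def)
    then have "adj2 A = \<rho> (quat_conj x)" using order_subset by (simp add: rho_conj subset_iff)
    moreover have "quat_norm a b (quat_conj x) = 1" using x(2) by (simp add: quat_norm_eq)
    ultimately show ?thesis using order_conj[OF x(1)] by (auto simp: units1_def)
  qed
  show "- A \<in> units1" if A: "A \<in> units1" for A
  proof -
    obtain x where x: "x \<in> R" "quat_norm a b x = 1" "A = \<rho> x" using A by (auto simp: units1_def)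
    have 1: "of_int (- 1) *s x \<in> R" using order_scale[OF of_int_integers x(1)] .
    have "\<rho> (of_int (- 1) *s x) = mat (of_int (- 1)) ** A"
      using x order_subset csubring_of_int[OF csubring_k] by (simp only: rho_hom(4) subset_iff)
    also have "\<dots> = - A" by (rule matrix_2_eqI) (simp_all add: mat2_mult_nth)
    finally have "- A = \<rho> (of_int (- 1) *s x)" by simp
    moreover have "quat_norm a b (of_int (- 1) *s x) = 1" using x(2) by (simp add: quat_norm_eq)
    ultimately show ?thesis using 1 unfolding units1_def by blast
  qed
  have "quat_norm a b (axis 1 1) = 1" by (simp add: quat_norm_eq axis_def)
  then show "mat 1 \<in> units1" unfolding units1_def using rho_hom(3) order_closed(3) by (metis (mono_tags, lifting) image_eqI mem_Collect_eq)
qed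

abbreviation "unit_group \<equiv> psl ` units1"

lemma unit_group_subgroup: "subgroup unit_group PSL2C"
proof -
  interpret group PSL2C by (rule group_PSL2C)
  show ?thesis
  proof (rule subgroupI)
    show "unit_group \<subseteq> carrier PSL2C" using units1_det by auto
    show "unit_group \<noteq> {}" using units1_closed(4) by blast
    show "inv\<^bsub>PSL2C\<^esub> x \<in> unit_group" if "x \<in> unit_group" for x
      using that units1_det units1_closed(2) by (auto simp: psl_inv)
    show "x \<otimes>\<^bsub>PSL2C\<^esub> y \<in> unit_group" if "x \<in> unit_group" "y \<in> unit_group" for x y
      using that units1_det units1_closed(1) by (auto simp: psl_mult)
  qed
qed

lemma lift_unit_group: "lift_set unit_group = units1"
proof (intro subset_antisym subsetI)
  fix A assume "A \<in> lift_set unit_group"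
  then obtain B where "B \<in> units1" "psl A = psl B" by (auto simp: lift_set_def)
  then show "A \<in> units1" using units1_closed(3) by (auto simp: psl_eq_iff)
qed (auto simp: lift_set_def units1_det)

end

section \<open>Unit groups of orders in division algebras are cocompact\<close>

lemma norm_four_terms: "cmod (p - q - r + s) \<le> cmod p + cmod q + cmod r + cmod s"
  using norm_triangle_ineq[of "p - q - r" s] norm_triangle_ineq4[of "p - q" r] norm_triangle_ineq4[of p q] by linarith

lemma prod_box_sides:
  fixes M d1 d2 :: real
  assumes "finite Y"
  shows "(\<Prod>j\<in>(UNIV :: (bool \<times> 2 \<times> bool) set) <+> (Y \<times> (UNIV :: 4 set)).
      case j of Inl (r, c, e) \<Rightarrow> if r then d1 else d2 | Inr _ \<Rightarrow> M) = (d1 * d2) ^ 4 * M ^ (4 * card Y)"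
proof -
  let ?g = "\<lambda>j. case j of Inl (r, c, e) \<Rightarrow> if r then d1 else d2 | Inr _ \<Rightarrow> M"
  have "(\<Prod>x\<in>(UNIV :: (bool \<times> 2 \<times> bool) set). ?g (Inl x)) =
      (\<Prod>(r, x)\<in>(UNIV :: bool set) \<times> (UNIV :: (2 \<times> bool) set). if r then d1 else d2)"
    by (rule prod.cong) auto
  also have "\<dots> = (\<Prod>r\<in>UNIV. \<Prod>x\<in>(UNIV :: (2 \<times> bool) set). if r then d1 else d2)"
    by (rule prod.cartesian_product[symmetric])
  also have "\<dots> = (d1 * d2) ^ 4"
    by (simp add: UNIV_bool prod_constant power_mult_distrib del: UNIV_Times_UNIV)
  finally have 1: "(\<Prod>x\<in>(UNIV :: (bool \<times> 2 \<times> bool) set). ?g (Inl x)) = (d1 * d2) ^ 4" .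
  have 2: "(\<Prod>x\<in>Y \<times> (UNIV :: 4 set). ?g (Inr x)) = M ^ (4 * card Y)"
    by (simp add: card_cartesian_product mult.commute)
  have "finite (UNIV :: (bool \<times> 2 \<times> bool) set)" "finite (Y \<times> (UNIV :: 4 set))"
    using assms by simp_all
  from prod.Plus[OF this, of ?g] show ?thesis unfolding comp_def 1 2 .
qed
context quaternion_order
begin

lemma integer_multiple:
  assumes "x \<in> k"
  obtains N :: nat where "N > 0" "of_nat N * x \<in> ring_of_integers k"
proof -
  note r = rep[OF assms]
  obtain N :: nat where N: "N > 0" "poly_over \<int> (smult (of_nat N) (rep x))" using clear_denominators[OF r(1)] by blast
  have "\<int> \<subseteq> {x::complex. algebraic_int x}" by (auto intro: int_imp_algebraic_int)
  then have "poly (smult (of_nat N) (rep x)) \<theta> \<in> {x. algebraic_int x}"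
    using N(2) int_theta by (intro poly_in_csubring[OF csubring_algebraic_int]) (auto intro: poly_over_mono)
  then have "algebraic_int (of_nat N * x)" using r by simp
  moreover have "of_nat N * x \<in> k" using assms csubring_of_nat[OF csubring_k] k_closed(6) by blast
  ultimately show ?thesis using that N by (auto simp: ring_of_integers_def)
qed

lemma of_nat_integers: "of_nat n \<in> ring_of_integers k"
  by (rule csubring_of_nat[OF csubring_integers])

lemma order_multiple:
  assumes "x \<in> quats"
  shows "\<exists>N::nat. N > 0 \<and> of_nat N *s x \<in> R"
proof -
  have "x \<in> lin_span k R" using order assms by (simp add: quat_order_def carrier_quat)
  then obtain F c where F: "finite F" "F \<subseteq> R" "c ` F \<subseteq> k" "x = (\<Sum>v\<in>F. c v *s v)"
    unfolding lin_span_def by blast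
  from F(1-3) have "\<exists>N::nat. N > 0 \<and> of_nat N *s (\<Sum>v\<in>F. c v *s v) \<in> R"
  proof (induction F rule: finite_induct)
    case empty
    then show ?case by (intro exI[of _ 1]) (simp add: order_closed)
  next
    case (insert v F)
    then obtain N :: nat where N: "N > 0" "of_nat N *s (\<Sum>v\<in>F. c v *s v) \<in> R" by auto
    obtain N' :: nat where N': "N' > 0" "of_nat N' * c v \<in> ring_of_integers k"
      using integer_multiple[of "c v"] insert.prems by auto
    have "of_nat N *s ((of_nat N' * c v) *s v) + of_nat N' *s (of_nat N *s (\<Sum>v\<in>F. c v *s v)) \<in> R"
    proof (rule order_closed(1))
      show "of_nat N *s ((of_nat N' * c v) *s v) \<in> R"
        using N'(2) insert.prems by (intro order_scale of_nat_integers) auto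
      show "of_nat N' *s (of_nat N *s (\<Sum>v\<in>F. c v *s v)) \<in> R"
        by (rule order_scale[OF of_nat_integers N(2)])
    qed
    moreover have "of_nat N *s ((of_nat N' * c v) *s v) + of_nat N' *s (of_nat N *s (\<Sum>v\<in>F. c v *s v)) =
        of_nat (N * N') *s (\<Sum>v\<in>Set.insert v F. c v *s v)"
      using insert.hyps by (simp add: vec_eq_iff algebra_simps)
    ultimately have "of_nat (N * N') *s (\<Sum>v\<in>Set.insert v F. c v *s v) \<in> R" by simp
    then show ?case using N(1) N'(1) by (intro exI[of _ "N * N'"]) simp
  qed
  then show ?thesis using F(4) by simp
qed

lemma order_common_multiple:
  assumes "finite X" "X \<subseteq> quats"
  shows "\<exists>N::nat. N > 0 \<and> (\<forall>x\<in>X. of_nat N *s x \<in> R)"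
  using assms
proof (induction X rule: finite_induct)
  case empty
  then show ?case by (intro exI[of _ 1]) simp
next
  case (insert y X)
  then obtain N :: nat where N: "N > 0" "\<forall>x\<in>X. of_nat N *s x \<in> R" by auto
  obtain N' :: nat where N': "N' > 0" "of_nat N' *s y \<in> R" using order_multiple[of y] insert.prems by auto
  have "of_nat (N * N') *s x \<in> R" if "x \<in> Set.insert y X" for x
  proof -
    have "of_nat (N * N') *s x = of_nat N' *s (of_nat N *s x)" "of_nat (N * N') *s x = of_nat N *s (of_nat N' *s x)"
      by (simp_all add: vec_eq_iff mult_ac)
    then show ?thesis using that N N' order_scale[OF of_nat_integers] by (metis insert_iff)
  qed
  then show ?case using N(1) N'(1) by (intro exI[of _ "N * N'"]) simp
qed

lemma rho_order_diff:
  assumes "x \<in> R" "y \<in> R"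
  shows "\<rho> (x - y) = \<rho> x - \<rho> y"
proof -
  have "\<rho> (x - y + y) = \<rho> (x - y) + \<rho> y"
    using assms order_minus[OF assms] order_subset by (intro rho_hom(1)) auto
  then show ?thesis by simp
qed

definition real_conjugates :: "complex set" where
  "real_conjugates = {z \<in> conjugates. z \<in> \<real>}"

lemma cnj_conjugate: "z \<in> conjugates \<Longrightarrow> cnj z \<in> conjugates"
proof -
  assume z: "z \<in> conjugates"
  have "cnj (coeff m i) = coeff m i" for i
    using mD(1) by (intro cnj_Rats) (simp add: poly_over_def)
  then have "poly m (cnj z) = cnj (poly m z)" by (simp add: poly_altdef)
  then show ?thesis using z by (simp add: conjugates_def)
qed

lemma emb_cnj:
  assumes "x \<in> k"
  shows "emb (cnj z) x = cnj (emb z x)"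
proof -
  have "cnj (coeff (rep x) i) = coeff (rep x) i" for i
    using rep(1)[OF assms] by (intro cnj_Rats) (simp add: poly_over_def)
  then show ?thesis by (simp add: emb_def poly_altdef)
qed

lemma emb_real: "z \<in> real_conjugates \<Longrightarrow> x \<in> k \<Longrightarrow> emb z x \<in> \<real>"
  using emb_cnj[of x z] by (simp add: real_conjugates_def Reals_cnj_iff)

lemma integer_combinations:
  fixes \<epsilon> :: "nat \<times> 4 \<Rightarrow> complex^4" and A :: "(nat \<times> 4) set"
  assumes "\<And>i. i \<in> A \<Longrightarrow> \<epsilon> i \<in> R"
  shows "(\<Sum>i\<in>A. of_nat (s i) *s \<epsilon> i) \<in> R"
    "\<rho> (\<Sum>i\<in>A. of_nat (s i) *s \<epsilon> i) $ p $ q = (\<Sum>i\<in>A. of_nat (s i) * \<rho> (\<epsilon> i) $ p $ q)"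
    "z \<in> conjugates \<Longrightarrow> emb z ((\<Sum>i\<in>A. of_nat (s i) *s \<epsilon> i) $ l) = (\<Sum>i\<in>A. of_nat (s i) * emb z (\<epsilon> i $ l))"
proof -
  have q: "\<epsilon> i \<in> quats" if "i \<in> A" for i using assms[OF that] order_subset by blast
  have nk: "of_nat n \<in> k" for n by (rule csubring_of_nat[OF csubring_k])
  show "(\<Sum>i\<in>A. of_nat (s i) *s \<epsilon> i) \<in> R" using assms by (intro order_sum order_scale of_nat_integers)
  have "\<rho> (\<Sum>i\<in>A. of_nat (s i) *s \<epsilon> i) = (\<Sum>i\<in>A. mat (of_nat (s i)) ** \<rho> (\<epsilon> i))"
    using q nk by (subst rho_sum) (auto intro!: quats_closed sum.cong simp: rho_hom)
  moreover have "(mat x ** M) $ i $ j = x * M $ i $ j" for x and M :: "complex^2^2" and i j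
    using exhaust_2[of i] by (auto simp: mat2_mult_nth)
  ultimately show "\<rho> (\<Sum>i\<in>A. of_nat (s i) *s \<epsilon> i) $ p $ q = (\<Sum>i\<in>A. of_nat (s i) * \<rho> (\<epsilon> i) $ p $ q)" by simp
  assume z: "z \<in> conjugates"
  have ek: "\<epsilon> i $ l \<in> k" if "i \<in> A" for i using q[OF that] by (simp add: quats_def)
  have "emb z ((\<Sum>i\<in>A. of_nat (s i) *s \<epsilon> i) $ l) = emb z (\<Sum>i\<in>A. of_nat (s i) * \<epsilon> i $ l)" by simp
  also have "\<dots> = (\<Sum>i\<in>A. emb z (of_nat (s i) * \<epsilon> i $ l))"
    using ek nk k_closed(6) by (intro emb_sum[OF z]) auto
  also have "\<dots> = (\<Sum>i\<in>A. of_nat (s i) * emb z (\<epsilon> i $ l))"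
    using ek nk by (intro sum.cong refl) (simp add: emb_hom(3)[OF z] emb_rat[OF z])
  finally show "emb z ((\<Sum>i\<in>A. of_nat (s i) *s \<epsilon> i) $ l) = (\<Sum>i\<in>A. of_nat (s i) * emb z (\<epsilon> i $ l))" .
qed

text \<open>
  The pigeonhole principle for the \<open>4 n\<close> elements \<open>D \<theta>\<^sup>i e\<^sub>l\<close> of \<open>R\<close>, where \<open>n\<close> is the degree of \<open>k\<close>. As \<open>k\<close> has one
  complex place, there are \<open>n - 2\<close> real ones, and an element of \<open>R\<close> has
  \<open>8 + 4 (n - 2) = 4 n\<close> real coordinates: the entries of its image in \<open>M\<^sub>2(\<complex>)\<close> and its components at the real places.
  Boundedness of \<open>c = g\<^sup>-\<^sup>1 \<rho> r\<close>, where \<open>g = upper z t\<close>, means that the second row of \<open>\<rho> r\<close> is of size \<open>t\<^bsup>-1/2\<^esup>\<close> and the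
  first row minus \<open>z\<close> times the second row is of size \<open>t\<^bsup>1/2\<^esup>\<close>. These sizes cancel in the product
  of the sides, so the bound does not depend on \<open>z\<close> and \<open>t\<close>.
\<close>

lemma short_order_element:
  assumes nonreal: "\<theta> \<notin> \<real>" and one_place: "\<And>z. z \<in> conjugates \<Longrightarrow> z \<notin> \<real> \<Longrightarrow> z = \<theta> \<or> z = cnj \<theta>"
  obtains M where "\<And>z t. t > 0 \<Longrightarrow> \<exists>r\<in>R. r \<noteq> 0 \<and> (\<exists>c. \<rho> r = upper z t ** c \<and> entry_norm c \<le> M) \<and>
    (\<forall>y\<in>real_conjugates. \<forall>l. cmod (emb y (r $ l)) \<le> M)"
proof -
  define n where "n = degree m"
  define A :: "(nat \<times> 4) set" where "A = {..<n} \<times> UNIV"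
  have finA: "finite A" by (simp add: A_def)
  have cardA: "card A = 4 * n" by (simp add: A_def)
  have finRC: "finite real_conjugates" using finite_conjugates by (simp add: real_conjugates_def)
  have n: "n = card real_conjugates + 2"
  proof -
    have "conjugates = real_conjugates \<union> {\<theta>, cnj \<theta>}"
      using one_place theta_conjugate cnj_conjugate by (auto simp: real_conjugates_def)
    moreover have "real_conjugates \<inter> {\<theta>, cnj \<theta>} = {}"
      using nonreal by (auto simp: real_conjugates_def complex_is_Real_iff)
    moreover have "card {\<theta>, cnj \<theta>} = 2" using nonreal by (simp add: Reals_cnj_iff)
    ultimately have "card conjugates = card real_conjugates + 2" using finRC by (metis card_Un_disjoint finite.emptyI finite.insertI)
    then show ?thesis by (simp add: n_def card_conjugates)
  qed
  define \<epsilon>0 where "\<epsilon>0 = (\<lambda>(i, l). \<theta> ^ i *s axis l 1 :: complex^4)"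
  have "\<epsilon>0 ` A \<subseteq> quats"
    using csubring_power[OF csubring_k theta_in_k] by (auto simp: \<epsilon>0_def intro!: quats_closed(3,5))
  then obtain D :: nat where D: "D > 0" "\<forall>x\<in>\<epsilon>0 ` A. of_nat D *s x \<in> R"
    using order_common_multiple[of "\<epsilon>0 ` A"] finA by blast
  define \<epsilon> where "\<epsilon> i = of_nat D *s \<epsilon>0 i" for i
  have \<epsilon>R: "\<epsilon> i \<in> R" if "i \<in> A" for i using D(2) that by (simp add: \<epsilon>_def)
  define X where "X s = (\<Sum>i\<in>A. of_nat (s i) *s \<epsilon> i)" for s :: "nat \<times> 4 \<Rightarrow> nat"
  note X = integer_combinations[of A \<epsilon>, OF \<epsilon>R, folded X_def]
  have X_inj: "s = s'" if "s \<in> PiE A (\<lambda>_. S)" "s' \<in> PiE A (\<lambda>_. S)" "X s = X s'" for s s' S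
  proof (rule PiE_ext[OF that(1,2)])
    fix i assume "i \<in> A"
    then obtain i0 l where il: "i = (i0, l)" "i0 < n" by (auto simp: A_def)
    \<comment> \<open>two points with the same image give a relation of degree less than \<open>n\<close> between powers of \<open>\<theta>\<close>\<close>
    define p :: "complex poly" where "p = (\<Sum>j<n. monom (of_nat (s (j, l)) - of_nat (s' (j, l))) j)"
    have comp: "X s $ l = of_nat D * (\<Sum>j<n. of_nat (s (j, l)) * \<theta> ^ j)" for s
    proof -
      have "X s $ l = (\<Sum>j<n. \<Sum>l'\<in>UNIV. of_nat (s (j, l')) * (of_nat D * (\<theta> ^ j * axis l' 1 $ l)))"
        by (simp add: X_def A_def sum.cartesian_product \<epsilon>_def \<epsilon>0_def case_prod_unfold mult.assoc)
      also have "\<dots> = (\<Sum>j<n. of_nat (s (j, l)) * (of_nat D * \<theta> ^ j))"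
        by (simp add: axis_def if_distrib sum.delta cong: if_cong)
      finally show ?thesis by (simp add: sum_distrib_left mult_ac)
    qed
    have "poly p \<theta> = (\<Sum>j<n. of_nat (s (j, l)) * \<theta> ^ j) - (\<Sum>j<n. of_nat (s' (j, l)) * \<theta> ^ j)"
      by (simp add: p_def poly_sum poly_monom sum_subtractf algebra_simps)
    then have "of_nat D * poly p \<theta> = X s $ l - X s' $ l" by (simp add: comp right_diff_distrib)
    then have "poly p \<theta> = 0" using that(3) D(1) by simp
    moreover have "poly_over \<rat> p"
      unfolding p_def by (intro poly_over_sum poly_over_closed csubfield_csubring csubfield_Rats) auto
    moreover have "degree p < degree m"
      unfolding p_def n_def using mD(5) by (intro degree_sum_less) (auto intro: le_less_trans[OF degree_monom_le])
    ultimately have "p = 0" using mD(6) by blast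
    then have "coeff p i0 = 0" by simp
    then show "s i = s' i" using il by (simp add: p_def coeff_sum if_distrib cong: if_cong)
  qed
  define C where "C = 1 + (\<Sum>p\<in>UNIV. \<Sum>q\<in>UNIV. \<Sum>i\<in>A. cmod (\<rho> (\<epsilon> i) $ p $ q)) +
    (\<Sum>y\<in>real_conjugates. \<Sum>l\<in>UNIV. \<Sum>i\<in>A. cmod (emb y (\<epsilon> i $ l)))"
  have sums_nonneg: "(\<Sum>p\<in>UNIV. \<Sum>q\<in>UNIV. \<Sum>i\<in>A. cmod (\<rho> (\<epsilon> i) $ p $ q)) \<ge> 0"
    "(\<Sum>y\<in>real_conjugates. \<Sum>l\<in>UNIV. \<Sum>i\<in>A. cmod (emb y (\<epsilon> i $ l))) \<ge> 0"
    by (intro sum_nonneg norm_ge_zero)+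
  then have C0: "C \<ge> 1" unfolding C_def by linarith
  have lin_bound: "cmod (\<Sum>i\<in>A. of_nat (s i) * f i) \<le> (\<Sum>i\<in>A. cmod (f i)) * real N"
    if "s \<in> PiE A (\<lambda>_. {..<N})" for s N and f :: "nat \<times> 4 \<Rightarrow> complex"
  proof -
    have "cmod (\<Sum>i\<in>A. of_nat (s i) * f i) \<le> (\<Sum>i\<in>A. cmod (f i) * real N)"
    proof (rule sum_norm_le)
      fix i assume "i \<in> A"
      then have "s i < N" using that by auto
      then have "real (s i) \<le> real N" by simp
      then show "cmod (of_nat (s i) * f i) \<le> cmod (f i) * real N"
        by (simp add: norm_mult mult.commute[of _ "real N"] mult_right_mono)
    qed
    then show ?thesis by (simp add: sum_distrib_right)
  qed
  have rho_bound: "cmod (\<rho> (X s) $ p $ q) \<le> C * real N" if "s \<in> PiE A (\<lambda>_. {..<N})" for s N p q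
  proof -
    have "(\<Sum>i\<in>A. cmod (\<rho> (\<epsilon> i) $ p $ q)) \<le> (\<Sum>q\<in>UNIV. \<Sum>i\<in>A. cmod (\<rho> (\<epsilon> i) $ p $ q))"
      by (rule member_le_sum[of q UNIV "\<lambda>q. \<Sum>i\<in>A. cmod (\<rho> (\<epsilon> i) $ p $ q)"]) (auto intro!: sum_nonneg)
    also have "\<dots> \<le> (\<Sum>p\<in>UNIV. \<Sum>q\<in>UNIV. \<Sum>i\<in>A. cmod (\<rho> (\<epsilon> i) $ p $ q))"
      by (rule member_le_sum[of p UNIV "\<lambda>p. \<Sum>q\<in>UNIV. \<Sum>i\<in>A. cmod (\<rho> (\<epsilon> i) $ p $ q)"]) (auto intro!: sum_nonneg)
    also have "\<dots> \<le> C" unfolding C_def using sums_nonneg by linarith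
    finally have "(\<Sum>i\<in>A. cmod (\<rho> (\<epsilon> i) $ p $ q)) * real N \<le> C * real N" by (rule mult_right_mono) simp
    then show ?thesis using lin_bound[OF that, of "\<lambda>i. \<rho> (\<epsilon> i) $ p $ q"] X(2)[of s p q] by simp
  qed
  have emb_bound: "cmod (emb y (X s $ l)) \<le> C * real N" if "s \<in> PiE A (\<lambda>_. {..<N})" "y \<in> real_conjugates" for s N y l
  proof -
    have "(\<Sum>i\<in>A. cmod (emb y (\<epsilon> i $ l))) \<le> (\<Sum>l\<in>UNIV. \<Sum>i\<in>A. cmod (emb y (\<epsilon> i $ l)))"
      by (rule member_le_sum[of l UNIV "\<lambda>l. \<Sum>i\<in>A. cmod (emb y (\<epsilon> i $ l))"]) (auto intro!: sum_nonneg)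
    also have "\<dots> \<le> (\<Sum>y\<in>real_conjugates. \<Sum>l\<in>UNIV. \<Sum>i\<in>A. cmod (emb y (\<epsilon> i $ l)))"
      by (rule member_le_sum[of y real_conjugates "\<lambda>y. \<Sum>l\<in>UNIV. \<Sum>i\<in>A. cmod (emb y (\<epsilon> i $ l))"])
        (use that(2) finRC in \<open>auto intro!: sum_nonneg\<close>)
    also have "\<dots> \<le> C" unfolding C_def using sums_nonneg by linarith
    finally have "(\<Sum>i\<in>A. cmod (emb y (\<epsilon> i $ l))) * real N \<le> C * real N" by (rule mult_right_mono) simp
    moreover have "y \<in> conjugates" using that(2) by (simp add: real_conjugates_def)
    ultimately show ?thesis using lin_bound[OF that(1), of "\<lambda>i. emb y (\<epsilon> i $ l)"] X(3)[of y s l] by simp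
  qed
  \<comment> \<open>with the factor \<open>4\<close> the sides multiply to \<open>(4 C)\<^bsup>4 n\<^esup>\<close>\<close>
  define M where "M = 4 * C"
  have M0: "M > 0" using C0 by (simp add: M_def)
  define part where "part e w = (if e then Re w else Im w)" for e and w :: complex
  have part_le: "\<bar>part e w\<bar> \<le> cmod w" for e w by (simp add: part_def abs_Re_le_cmod abs_Im_le_cmod)
  have part_diff: "part e (v - w) = part e v - part e w" for e v w by (simp add: part_def)
  define J :: "(bool \<times> 2 \<times> bool + complex \<times> 4) set" where "J = UNIV <+> (real_conjugates \<times> UNIV)"
  have finJ: "finite J" using finRC by (simp add: J_def)
  have cardJ: "card J = card A" using finRC n by (simp add: J_def card_Plus cardA)
  have "\<exists>r\<in>R. r \<noteq> 0 \<and> (\<exists>c. \<rho> r = upper z t ** c \<and> entry_norm c \<le> 8 * M) \<and>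
    (\<forall>y\<in>real_conjugates. \<forall>l. cmod (emb y (r $ l)) \<le> 8 * M)" if t: "t > 0" for z t
  proof -
    define \<tau> where "\<tau> = sqrt t"
    have \<tau>: "\<tau> > 0" using t by (simp add: \<tau>_def)
    define d1 d2 where d: "d1 = M * \<tau>" "d2 = M / \<tau>"
    have d0: "d1 > 0" "d2 > 0" using M0 \<tau> by (simp_all add: d)
    \<comment> \<open>the corner of the cell that contains the second row, in units of \<open>d2\<close>; inside a cell the second row varies by at
      most \<open>2 d2\<close>, which bounds the skew term of the first row independently of \<open>N\<close>\<close>
    define w where "w c s = Complex (of_int \<lfloor>Re (\<rho> (X s) $ 2 $ c) / d2\<rfloor>) (of_int \<lfloor>Im (\<rho> (X s) $ 2 $ c) / d2\<rfloor>)" for c s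
    define G where "G j s = (case j of
        Inl (r, c, e) \<Rightarrow> if r then part e (\<rho> (X s) $ 1 $ c - z * (\<rho> (X s) $ 2 $ c - of_real d2 * w c s)) else part e (\<rho> (X s) $ 2 $ c)
      | Inr (y, l) \<Rightarrow> Re (emb y (X s $ l)))" for j s
    define \<delta> where "\<delta> j = (case j of Inl (r, c, e) \<Rightarrow> if r then d1 else d2 | Inr _ \<Rightarrow> M)" for j :: "bool \<times> 2 \<times> bool + complex \<times> 4"
    define E where "E j = (case j of Inl (r, c, e) \<Rightarrow> if r then cmod z * (2 * d2) else 0 | Inr _ \<Rightarrow> 0)" for j :: "bool \<times> 2 \<times> bool + complex \<times> 4"
    obtain N s s' where s: "s \<in> PiE A (\<lambda>_. {..<N})" "s' \<in> PiE A (\<lambda>_. {..<N})" "s \<noteq> s'"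
      "\<And>j. j \<in> J \<Longrightarrow> \<lfloor>G j s / \<delta> j\<rfloor> = \<lfloor>G j s' / \<delta> j\<rfloor>"
    proof (rule pigeonhole_boxes[of A J C \<delta> E G])
      show "finite A" "finite J" "card J = card A" "card A > 0" "C > 0"
        using finA finJ cardJ cardA n C0 by auto
      show "\<delta> j > 0" "E j \<ge> 0" for j using d0 M0 by (auto simp: \<delta>_def E_def split: sum.splits)
      have "(\<Prod>j\<in>J. \<delta> j) = (d1 * d2) ^ 4 * M ^ (4 * card real_conjugates)"
        unfolding J_def \<delta>_def by (rule prod_box_sides[OF finRC])
      also have "d1 * d2 = M ^ 2" using \<tau> by (simp add: d power2_eq_square)
      finally have "(\<Prod>j\<in>J. \<delta> j) = M ^ (8 + 4 * card real_conjugates)" by (simp add: power_add flip: power_mult)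
      then show "(\<Prod>j\<in>J. \<delta> j) \<ge> (4 * C) ^ card J" using n by (simp add: cardJ cardA M_def)
      show "\<bar>G j s\<bar> \<le> C * real N + E j" if s: "s \<in> PiE A (\<lambda>_. {..<N})" and j: "j \<in> J" for N s j
      proof (cases j)
        case (Inl x)
        obtain r c e where x: "x = (r, c, e)" by (cases x)
        show ?thesis
        proof (cases r)
          case True
          have "cmod (\<rho> (X s) $ 2 $ c - of_real d2 * w c s) \<le> 2 * d2"
          proof (rule complex_close)
            have fl: "\<bar>y - d2 * of_int \<lfloor>y / d2\<rfloor>\<bar> < d2" for y
            proof -
              have "y - d2 * of_int \<lfloor>y / d2\<rfloor> = d2 * (y / d2 - of_int \<lfloor>y / d2\<rfloor>)" using d0 by (simp add: right_diff_distrib)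
              moreover have "\<bar>y / d2 - of_int \<lfloor>y / d2\<rfloor>\<bar> < 1" by linarith
              ultimately show ?thesis using d0 by (simp add: abs_mult)
            qed
            show "\<bar>Re (\<rho> (X s) $ 2 $ c - of_real d2 * w c s)\<bar> < d2" "\<bar>Im (\<rho> (X s) $ 2 $ c - of_real d2 * w c s)\<bar> < d2"
              using fl by (simp_all add: w_def)
          qed
          then have "cmod (z * (\<rho> (X s) $ 2 $ c - of_real d2 * w c s)) \<le> cmod z * (2 * d2)"
            by (simp add: norm_mult mult_left_mono)
          moreover have "cmod (\<rho> (X s) $ 1 $ c) \<le> C * real N" by (rule rho_bound[OF s])
          ultimately have "cmod (\<rho> (X s) $ 1 $ c - z * (\<rho> (X s) $ 2 $ c - of_real d2 * w c s)) \<le> C * real N + cmod z * (2 * d2)"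
            by (meson add_mono norm_triangle_ineq4 order_trans)
          then show ?thesis using True part_le[of e "\<rho> (X s) $ 1 $ c - z * (\<rho> (X s) $ 2 $ c - of_real d2 * w c s)"]
            by (simp add: Inl x G_def E_def)
        next
          case False
          then show ?thesis using part_le[of e "\<rho> (X s) $ 2 $ c"] rho_bound[OF s, of 2 c] by (simp add: Inl x G_def E_def)
        qed
      next
        case (Inr x)
        obtain y l where x: "x = (y, l)" by (cases x)
        have "y \<in> real_conjugates" using j by (auto simp: J_def Inr x)
        then show ?thesis using emb_bound[OF s, of y l] abs_Re_le_cmod[of "emb y (X s $ l)"] by (simp add: Inr x G_def E_def)
      qed
    qed blast
    have close: "\<bar>G j s - G j s'\<bar> < \<delta> j" if "j \<in> J" for j
      using same_floor_imp_close[OF s(4)[OF that]] d0 M0 by (auto simp: \<delta>_def split: sum.splits)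
    define r where "r = X s - X s'"
    have rR: "r \<in> R" unfolding r_def by (intro order_minus X(1))
    have "r \<noteq> 0" using X_inj[OF s(1,2)] s(3) by (auto simp: r_def)
    have \<rho>r: "\<rho> r $ p $ q = \<rho> (X s) $ p $ q - \<rho> (X s') $ p $ q" for p q
      using rho_order_diff[OF X(1)[of s] X(1)[of s']] by (simp add: r_def)
    have Jl: "Inl x \<in> J" for x unfolding J_def by (rule InlI) simp
    have ww: "w c s = w c s'" for c
      using s(4)[OF Jl, of "(False, c, True)"] s(4)[OF Jl, of "(False, c, False)"]
      by (simp add: G_def \<delta>_def part_def w_def)
    have row2: "cmod (\<rho> r $ 2 $ c) \<le> 2 * d2" for c
    proof (rule complex_close)
      show "\<bar>Re (\<rho> r $ 2 $ c)\<bar> < d2" "\<bar>Im (\<rho> r $ 2 $ c)\<bar> < d2"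
        using close[OF Jl, of "(False, c, True)"] close[OF Jl, of "(False, c, False)"]
        by (simp_all add: G_def \<delta>_def part_def \<rho>r)
    qed
    have row1: "cmod (\<rho> r $ 1 $ c - z * \<rho> r $ 2 $ c) \<le> 2 * d1" for c
    proof (rule complex_close)
      have "G (Inl (True, c, e)) s - G (Inl (True, c, e)) s' = part e (\<rho> r $ 1 $ c - z * \<rho> r $ 2 $ c)" for e
        by (simp only: G_def sum.case prod.case if_True ww \<rho>r part_diff[symmetric]) (simp add: algebra_simps)
      then show "\<bar>Re (\<rho> r $ 1 $ c - z * \<rho> r $ 2 $ c)\<bar> < d1" "\<bar>Im (\<rho> r $ 1 $ c - z * \<rho> r $ 2 $ c)\<bar> < d1"
        using close[OF Jl, of "(True, c, True)"] close[OF Jl, of "(True, c, False)"]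
        by (simp_all add: \<delta>_def part_def)
    qed
    define c where "c = adj2 (upper z t) ** \<rho> r"
    have "\<rho> r = upper z t ** c" unfolding c_def by (rule adj2_cancel(1)[OF det_upper[OF t], symmetric])
    moreover have "entry_norm c \<le> 8 * M"
    proof -
      have 1: "cmod (c $ 1 $ j) \<le> 2 * M" for j
      proof -
        have "c $ 1 $ j = (\<rho> r $ 1 $ j - z * \<rho> r $ 2 $ j) / of_real \<tau>"
          by (simp add: c_def mat2_mult_nth \<tau>_def diff_divide_distrib)
        then have "cmod (c $ 1 $ j) \<le> 2 * d1 / \<tau>" using row1[of j] \<tau> by (simp add: norm_divide divide_right_mono)
        then show ?thesis using \<tau> by (simp add: d)
      qed
      have 2: "cmod (c $ 2 $ j) \<le> 2 * M" for j
      proof -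
        have "c $ 2 $ j = of_real \<tau> * \<rho> r $ 2 $ j" by (simp add: c_def mat2_mult_nth \<tau>_def)
        then have "cmod (c $ 2 $ j) \<le> \<tau> * (2 * d2)" using row2[of j] \<tau> by (simp add: norm_mult)
        then show ?thesis using \<tau> by (simp add: d)
      qed
      show ?thesis using 1[of 1] 1[of 2] 2[of 1] 2[of 2] by (simp add: entry_norm_def)
    qed
    moreover have "cmod (emb y (r $ l)) \<le> 8 * M" if y: "y \<in> real_conjugates" for y l
    proof -
      have yc: "y \<in> conjugates" using y by (simp add: real_conjugates_def)
      have xk: "x \<in> R \<Longrightarrow> x $ l \<in> k" for x using order_subset by (auto simp: quats_def)
      have "emb y (r $ l) = emb y (X s $ l) - emb y (X s' $ l)"
        using emb_hom(2)[OF yc xk[OF X(1)] xk[OF X(1)]] by (simp add: r_def)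
      moreover have "Inr (y, l) \<in> J" unfolding J_def using y by (intro InrI) simp
      ultimately have "\<bar>Re (emb y (r $ l))\<bar> < M" using close[of "Inr (y, l)"] by (simp add: G_def \<delta>_def)
      moreover have "emb y (r $ l) \<in> \<real>" by (rule emb_real[OF y xk[OF rR]])
      ultimately have "cmod (emb y (r $ l)) < M" by (metis complex_is_Real_iff cmod_eq_Re)
      then show ?thesis using M0 by simp
    qed
    ultimately show ?thesis using rR \<open>r \<noteq> 0\<close> by blast
  qed
  then show ?thesis using that by blast
qed

text \<open>
  Let \<open>n\<close> be a nonzero rational integer divisible by \<open>\<nu>\<close>, say \<open>\<nu> w = n\<close>. If \<open>r\<close> and \<open>s\<close> have norm \<open>\<nu>\<close> and
  \<open>r = s + n t\<close> with \<open>t \<in> R\<close>, then \<open>r s\<^sup>-\<^sup>1 = 1 + w t s\<^sup>*\<close> lies in \<open>R\<close>, where \<open>s\<^sup>*\<close> is the conjugate of \<open>s\<close>.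
  There are only finitely many residue classes modulo \<open>n R\<close>. Fixing the norm itself, and not only the ideal it
  generates, makes the quotient \<open>u\<close> a unit of norm \<open>1\<close>.
\<close>

lemma finite_norm_classes:
  assumes \<nu>: "\<nu> \<in> ring_of_integers k" "\<nu> \<noteq> 0"
  obtains T where "finite T" "T \<subseteq> R"
    "\<And>r. r \<in> R \<Longrightarrow> quat_norm a b r = \<nu> \<Longrightarrow> \<exists>s\<in>T. \<exists>u\<in>R. quat_norm a b u = 1 \<and> r = quat_mult a b u s"
proof -
  obtain w and n :: int where w: "w \<in> ring_of_integers k" "n \<noteq> 0" "\<nu> * w = of_int n"
    using algebraic_int_cofactor[OF csubring_integers \<nu>(1)] \<nu> by (auto simp: ring_of_integers_def)
  obtain A and g :: "(complex^4) \<times> complex \<Rightarrow> complex^4" where A: "finite A" "\<And>i. i \<in> A \<Longrightarrow> g i \<in> R"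
    "\<And>x. x \<in> R \<Longrightarrow> \<exists>c :: (complex^4) \<times> complex \<Rightarrow> int. x = (\<Sum>i\<in>A. of_int (c i) *s g i)"
    using order_finitely_generated by metis
  obtain cf :: "complex^4 \<Rightarrow> (complex^4) \<times> complex \<Rightarrow> int" where cf: "\<And>x. x \<in> R \<Longrightarrow> x = (\<Sum>i\<in>A. of_int (cf x i) *s g i)"
    using A(3) by metis
  define D where "D = {r \<in> R. quat_norm a b r = \<nu>}"
  define cl where "cl r = restrict (\<lambda>i. cf r i mod \<bar>n\<bar>) A" for r
  have "cl ` D \<subseteq> PiE A (\<lambda>_. {0..<\<bar>n\<bar>})" using w(2) by (auto simp: cl_def)
  moreover have "finite (PiE A (\<lambda>_. {0..<\<bar>n\<bar>}))" using A(1) by (intro finite_PiE) auto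
  ultimately have fin: "finite (cl ` D)" by (rule finite_subset)
  define T where "T = inv_into D cl ` (cl ` D)"
  show ?thesis
  proof (rule that[of T])
    show "finite T" using fin by (simp add: T_def)
    have "T \<subseteq> D" unfolding T_def by (auto intro: inv_into_into)
    then show "T \<subseteq> R" by (auto simp: D_def)
    fix r assume r: "r \<in> R" "quat_norm a b r = \<nu>"
    then have rD: "r \<in> D" by (simp add: D_def)
    define s where "s = inv_into D cl (cl r)"
    have sD: "s \<in> D" unfolding s_def using rD by (intro inv_into_into) auto
    have scl: "cl s = cl r" unfolding s_def using rD by (intro f_inv_into_f) auto
    have s: "s \<in> R" "quat_norm a b s = \<nu>" using sD by (auto simp: D_def)
    define t where "t = (\<Sum>i\<in>A. of_int ((cf r i - cf s i) div n) *s g i)"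
    have tR: "t \<in> R" unfolding t_def using A(2) by (intro order_sum order_scale of_int_integers) auto
    have diff: "r - s = of_int n *s t"
    proof -
      have "of_int (cf r i) - of_int (cf s i) = of_int n * (of_int ((cf r i - cf s i) div n) :: complex)" if "i \<in> A" for i
      proof -
        have "cf s i mod \<bar>n\<bar> = cf r i mod \<bar>n\<bar>" using scl that by (auto simp: cl_def dest: fun_cong[of _ _ i])
        then have "n dvd cf r i - cf s i" by (metis abs_dvd_iff mod_eq_dvd_iff)
        then have "cf r i - cf s i = n * ((cf r i - cf s i) div n)" by simp
        then show ?thesis by (metis of_int_diff of_int_mult)
      qed
      then have "(\<Sum>i\<in>A. of_int (cf r i) *s g i) - (\<Sum>i\<in>A. of_int (cf s i) *s g i) = of_int n *s t"
        by (simp add: t_def vec_eq_iff sum_distrib_left flip: sum_subtractf left_diff_distrib mult.assoc)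
      then show ?thesis using cf[OF r(1)] cf[OF s(1)] by simp
    qed
    \<comment> \<open>\<open>u = r s\<^sup>-\<^sup>1\<close>\<close>
    define u where "u = axis 1 1 + w *s quat_mult a b t (quat_conj s)"
    have uR: "u \<in> R" unfolding u_def
      using tR s(1) w(1) by (intro order_closed order_scale order_conj)
    have "quat_mult a b u s = s + (w * quat_norm a b s) *s t"
      by (rule vec4_eqI) (simp_all add: u_def axis_def quat_norm_eq power2_eq_square algebra_simps)
    also have "\<dots> = s + of_int n *s t" using s(2) w(3) by (simp add: mult.commute)
    also have "\<dots> = r" using diff by (simp add: algebra_simps)
    finally have rus: "r = quat_mult a b u s" by simp
    then have "\<nu> = quat_norm a b u * \<nu>" using r(2) s(2) quat_norm_mult by metis
    then have "quat_norm a b u = 1" using \<nu>(2) by simp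
    then show "\<exists>s\<in>T. \<exists>u\<in>R. quat_norm a b u = 1 \<and> r = quat_mult a b u s"
      using uR rus rD by (auto simp: T_def s_def)
  qed
qed

theorem division_imp_cobounded:
  assumes nonreal: "\<theta> \<notin> \<real>" and one_place: "\<And>z. z \<in> conjugates \<Longrightarrow> z \<notin> \<real> \<Longrightarrow> z = \<theta> \<or> z = cnj \<theta>"
    and division: "\<And>x. x \<in> quats \<Longrightarrow> x \<noteq> 0 \<Longrightarrow> quat_norm a b x \<noteq> 0"
  shows "cobounded units1"
proof -
  obtain M where M: "\<And>z t. t > 0 \<Longrightarrow> \<exists>r\<in>R. r \<noteq> 0 \<and> (\<exists>c. \<rho> r = upper z t ** c \<and> entry_norm c \<le> M) \<and>
    (\<forall>y\<in>real_conjugates. \<forall>l. cmod (emb y (r $ l)) \<le> M)"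
    using short_order_element[OF nonreal one_place] by metis
  define f where "f y = 1 + cmod (emb y a) + cmod (emb y b) + cmod (emb y a * emb y b)" for y
  have finRC: "finite real_conjugates" using finite_conjugates by (simp add: real_conjugates_def)
  have f0: "f y \<ge> 0" for y by (simp add: f_def)
  \<comment> \<open>a bound for the norm of a short element at all places\<close>
  define B where "B = M\<^sup>2 * (2 + (\<Sum>y\<in>real_conjugates. f y))"
  define NS where "NS = {x \<in> k. algebraic_int x \<and> (\<forall>z\<in>conjugates. cmod (emb z x) \<le> B)} - {0}"
  have finNS: "finite NS" unfolding NS_def using finite_integers_bounded by simp
  have "\<forall>\<nu>\<in>NS. \<exists>T. finite T \<and> T \<subseteq> R \<and>
    (\<forall>r\<in>R. quat_norm a b r = \<nu> \<longrightarrow> (\<exists>s\<in>T. \<exists>u\<in>R. quat_norm a b u = 1 \<and> r = quat_mult a b u s))"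
  proof
    fix \<nu> assume "\<nu> \<in> NS"
    then have "\<nu> \<in> ring_of_integers k" "\<nu> \<noteq> 0" by (auto simp: NS_def ring_of_integers_def)
    then show "\<exists>T. finite T \<and> T \<subseteq> R \<and>
      (\<forall>r\<in>R. quat_norm a b r = \<nu> \<longrightarrow> (\<exists>s\<in>T. \<exists>u\<in>R. quat_norm a b u = 1 \<and> r = quat_mult a b u s))"
      using finite_norm_classes[of \<nu>] by metis
  qed
  then obtain T where T: "\<And>\<nu>. \<nu> \<in> NS \<Longrightarrow> finite (T \<nu>)" "\<And>\<nu>. \<nu> \<in> NS \<Longrightarrow> T \<nu> \<subseteq> R"
    "\<And>\<nu> r. \<nu> \<in> NS \<Longrightarrow> r \<in> R \<Longrightarrow> quat_norm a b r = \<nu> \<Longrightarrow> \<exists>s\<in>T \<nu>. \<exists>u\<in>R. quat_norm a b u = 1 \<and> r = quat_mult a b u s"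
    by metis
  define TT where "TT = (\<Union>\<nu>\<in>NS. T \<nu>)"
  have finTT: "finite TT" using finNS T(1) by (simp add: TT_def)
  define S1 where "S1 = (\<Sum>s\<in>TT. entry_norm (\<rho> s))"
  define S2 where "S2 = (\<Sum>\<nu>\<in>NS. entry_norm (mat (1 / \<nu>)))"
  have "\<exists>u\<in>units1. \<exists>\<kappa>. g = u ** \<kappa> \<and> det u = 1 \<and> det \<kappa> = 1 \<and> entry_norm \<kappa> \<le> S1 * M * S2 * 4" if g: "det g = 1" for g
  proof -
    obtain z t \<kappa>0 where iw: "t > 0" "g = upper z t ** \<kappa>0" "det \<kappa>0 = 1" "entry_norm \<kappa>0 \<le> 4"
      using iwasawa_decomposition[OF g] by metis
    obtain r c where r: "r \<in> R" "r \<noteq> 0" "\<rho> r = upper z t ** c" "entry_norm c \<le> M"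
      "\<And>y l. y \<in> real_conjugates \<Longrightarrow> cmod (emb y (r $ l)) \<le> M"
      using M[OF iw(1), of z] by blast
    have rq: "r \<in> quats" using r(1) order_subset by blast
    have rk: "r $ i \<in> k" for i using rq by (simp add: quats_def)
    define \<nu> where "\<nu> = quat_norm a b r"
    have \<nu>k: "\<nu> \<in> k" "algebraic_int \<nu>" "\<nu> \<noteq> 0"
      using norm_trace_integral(1)[OF r(1)] division[OF rq r(2)] by (auto simp: \<nu>_def ring_of_integers_def)
    have det_c: "det c = \<nu>" using det_rho[OF rq] det_upper[OF iw(1), of z] by (simp add: \<nu>_def r(3) det_mul)
    have M0: "M \<ge> 0" using r(4) entry_norm_nonneg[of c] by linarith
    have \<nu>_le: "cmod \<nu> \<le> B"
    proof -
      have cM: "cmod (c $ i $ j) \<le> M" for i j using entry_le_entry_norm[of c i j] r(4) by linarith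
      have "cmod \<nu> \<le> cmod (c $ 1 $ 1) * cmod (c $ 2 $ 2) + cmod (c $ 1 $ 2) * cmod (c $ 2 $ 1)"
        using norm_triangle_ineq4[of "c $ 1 $ 1 * c $ 2 $ 2" "c $ 1 $ 2 * c $ 2 $ 1"] det_c
        by (simp add: det_2 norm_mult)
      also have "\<dots> \<le> M * M + M * M" using cM M0 by (intro add_mono mult_mono) auto
      also have "\<dots> = M\<^sup>2 * 2" by (simp add: power2_eq_square)
      also have "\<dots> \<le> B" unfolding B_def using f0 by (intro mult_left_mono) (auto intro: sum_nonneg)
      finally show ?thesis .
    qed
    have real_le: "cmod (emb y \<nu>) \<le> B" if y: "y \<in> real_conjugates" for y
    proof -
      have yc: "y \<in> conjugates" using y by (simp add: real_conjugates_def)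
      note h = emb_hom[OF yc]
      have "emb y \<nu> = (emb y (r $ 1))\<^sup>2 - emb y a * (emb y (r $ 2))\<^sup>2 - emb y b * (emb y (r $ 3))\<^sup>2 + (emb y a * emb y b) * (emb y (r $ 4))\<^sup>2"
        unfolding \<nu>_def quat_norm_eq power2_eq_square using rk a(1) b(1) by (simp add: h k_closed)
      then have "cmod (emb y \<nu>) \<le> cmod ((emb y (r $ 1))\<^sup>2) + cmod (emb y a * (emb y (r $ 2))\<^sup>2) +
          cmod (emb y b * (emb y (r $ 3))\<^sup>2) + cmod ((emb y a * emb y b) * (emb y (r $ 4))\<^sup>2)"
        by (simp only: norm_four_terms)
      also have "\<dots> \<le> M\<^sup>2 + cmod (emb y a) * M\<^sup>2 + cmod (emb y b) * M\<^sup>2 + cmod (emb y a * emb y b) * M\<^sup>2"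
        unfolding norm_mult norm_power using r(5)[OF y] by (intro add_mono mult_left_mono power_mono) auto
      also have "\<dots> = M\<^sup>2 * f y" by (simp add: f_def algebra_simps)
      also have "\<dots> \<le> B"
      proof -
        have "f y \<le> (\<Sum>y\<in>real_conjugates. f y)" using y f0 finRC by (intro member_le_sum) auto
        then show ?thesis unfolding B_def by (intro mult_left_mono) auto
      qed
      finally show ?thesis .
    qed
    have "cmod (emb x \<nu>) \<le> B" if x: "x \<in> conjugates" for x
    proof (cases "x \<in> \<real>")
      case True
      then show ?thesis using real_le x by (simp add: real_conjugates_def)
    next
      case False
      then have "x = \<theta> \<or> x = cnj \<theta>" by (rule one_place[OF x])
      then show ?thesis using \<nu>_le \<nu>k by (auto simp: emb_theta_id emb_cnj)
    qed
    then have \<nu>NS: "\<nu> \<in> NS" using \<nu>k by (simp add: NS_def)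
    obtain s u where su: "s \<in> T \<nu>" "u \<in> R" "quat_norm a b u = 1" "r = quat_mult a b u s"
      using T(3)[OF \<nu>NS r(1)] \<nu>_def by blast
    have sR: "s \<in> R" using T(2)[OF \<nu>NS] su(1) by blast
    define \<kappa> where "\<kappa> = \<rho> s ** adj2 c ** mat (1 / \<nu>) ** \<kappa>0"
    have U: "\<rho> u \<in> units1" using su by (auto simp: units1_def)
    have "g = \<rho> u ** \<kappa>"
    proof -
      have "mat x ** mat y = (mat (x * y) :: complex^2^2)" for x y
        by (rule matrix_2_eqI) (simp_all add: mat2_mult_nth)
      then have one: "c ** adj2 c ** mat (1 / \<nu>) = mat 1" using \<nu>k(3) by (simp add: adj2_mult det_c)
      have "\<rho> u ** \<rho> s = upper z t ** c"
        using su sR order_subset r(3) rho_hom(2)[of u s] by (simp add: subset_iff)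
      then have "\<rho> u ** \<kappa> = upper z t ** (c ** adj2 c ** mat (1 / \<nu>)) ** \<kappa>0"
        by (simp add: \<kappa>_def matrix_mul_assoc)
      then show ?thesis by (simp add: one iw(2))
    qed
    moreover from this have "det \<kappa> = 1" using g units1_det[OF U] by (simp add: det_mul)
    moreover have "entry_norm \<kappa> \<le> S1 * M * S2 * 4"
    proof -
      have S: "entry_norm (\<rho> s) \<le> S1" "entry_norm (mat (1 / \<nu>)) \<le> S2"
        unfolding S1_def S2_def using su(1) \<nu>NS finTT finNS entry_norm_nonneg
        by (auto intro!: member_le_sum simp: TT_def)
      have "entry_norm \<kappa> \<le> entry_norm (\<rho> s) * entry_norm (adj2 c) * entry_norm (mat (1 / \<nu>)) * entry_norm \<kappa>0"
        unfolding \<kappa>_def using entry_norm_nonneg entry_norm_mult by (meson mult_right_mono order_trans)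
      also have "\<dots> \<le> S1 * M * S2 * 4"
        using S r(4) iw(4) entry_norm_nonneg M0 order_trans[OF entry_norm_nonneg S(1)] order_trans[OF entry_norm_nonneg S(2)]
        by (intro mult_mono) (auto simp: entry_norm_adj2)
      finally show ?thesis .
    qed
    ultimately show ?thesis using U units1_det by blast
  qed
  then show ?thesis unfolding cobounded_def by blast
qed

end

section \<open>Split quaternion algebras and commensurators\<close>

text \<open>
  The Cayley-Hamilton theorem.
\<close>

lemma nilpotent_trace_zero:
  assumes "trace E = 0" "det E = 0"
  shows "E ** E = (0 :: complex^2^2)"
proof (rule matrix_2_eqI)
  have t: "E $ 2 $ 2 = - E $ 1 $ 1" using assms(1) by (simp add: trace2 eq_neg_iff_add_eq_0 add.commute)
  have d: "E $ 1 $ 1 * E $ 1 $ 1 + E $ 1 $ 2 * E $ 2 $ 1 = 0"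
    using assms(2) by (simp add: det_2 t neg_eq_iff_add_eq_0)
  show "(E ** E) $ 1 $ 1 = 0 $ 1 $ 1" "(E ** E) $ 1 $ 2 = 0 $ 1 $ 2"
    "(E ** E) $ 2 $ 1 = 0 $ 2 $ 1" "(E ** E) $ 2 $ 2 = 0 $ 2 $ 2"
    using d by (simp_all add: mat2_mult_nth t algebra_simps)
qed

lemma matrix_add_rdistrib2: "(A + B) ** M = A ** M + B ** M" for M A B :: "complex^2^2"
  by (rule matrix_2_eqI) (simp_all add: mat2_mult_nth algebra_simps)

text \<open>
  The matrices \<open>E, F, EF, FE\<close> are matrix units; their dual basis for the trace form is \<open>F, E, EF, FE\<close>.
  So the left-hand side is the Casimir operator of \<open>M\<^sub>2(\<complex>)\<close>.
\<close>

lemma matrix_unit_casimir: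
  fixes E F Y :: "complex^2^2"
  assumes "trace E = 0" "trace F = 0" "det E = 0" "det F = 0" "trace (E ** F) = 1"
  shows "E ** Y ** F + F ** Y ** E + E ** F ** Y ** (E ** F) + F ** E ** Y ** (F ** E) = mat (trace Y)"
proof -
  define p q r u v w where pq: "p = E $ 1 $ 1" "q = E $ 1 $ 2" "r = E $ 2 $ 1" "u = F $ 1 $ 1" "v = F $ 1 $ 2" "w = F $ 2 $ 1"
  have E22: "E $ 2 $ 2 = - p" using assms(1) by (simp add: pq trace2 eq_neg_iff_add_eq_0 add.commute)
  have F22: "F $ 2 $ 2 = - u" using assms(2) by (simp add: pq trace2 eq_neg_iff_add_eq_0 add.commute)
  have e: "p * p + q * r = 0" using assms(3) by (simp add: det_2 E22 pq[symmetric] neg_eq_iff_add_eq_0)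
  have f: "u * u + v * w = 0" using assms(4) by (simp add: det_2 F22 pq[symmetric] neg_eq_iff_add_eq_0)
  have t: "2 * p * u + q * w + r * v = 1"
    using assms(5) by (simp add: trace2 mat2_mult_nth E22 F22 pq[symmetric] algebra_simps)
  define a b c d where abcd: "a = Y $ 1 $ 1" "b = Y $ 1 $ 2" "c = Y $ 2 $ 1" "d = Y $ 2 $ 2"
  note s = mat2_mult_nth E22 F22 pq[symmetric] abcd[symmetric] trace2
  show ?thesis
  proof (rule matrix_2_eqI)
    show "(E ** Y ** F + F ** Y ** E + E ** F ** Y ** (E ** F) + F ** E ** Y ** (F ** E)) $ 1 $ 1 = (mat (trace Y) :: complex^2^2) $ 1 $ 1"
      by (simp add: s) (use e f t in Groebner_Basis.algebra)
    show "(E ** Y ** F + F ** Y ** E + E ** F ** Y ** (E ** F) + F ** E ** Y ** (F ** E)) $ 1 $ 2 = (mat (trace Y) :: complex^2^2) $ 1 $ 2"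
      by (simp add: s) (use e f t in Groebner_Basis.algebra)
    show "(E ** Y ** F + F ** Y ** E + E ** F ** Y ** (E ** F) + F ** E ** Y ** (F ** E)) $ 2 $ 1 = (mat (trace Y) :: complex^2^2) $ 2 $ 1"
      by (simp add: s) (use e f t in Groebner_Basis.algebra)
    show "(E ** Y ** F + F ** Y ** E + E ** F ** Y ** (E ** F) + F ** E ** Y ** (F ** E)) $ 2 $ 2 = (mat (trace Y) :: complex^2^2) $ 2 $ 2"
      by (simp add: s) (use e f t in Groebner_Basis.algebra)
  qed
qed

text \<open>
  The trace of the conjugation by \<open>Z\<close> on \<open>M\<^sub>2(\<complex>)\<close> is \<open>tr Z tr Z\<^sup>-\<^sup>1 = tr\<^sup>2 Z\<close>; here it is computed with dual bases.
\<close>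

lemma trace_sq_by_casimir:
  assumes EF: "trace E = 0" "trace F = 0" "det E = 0" "det F = 0" "trace (E ** F) = 1" and Z: "det Z = 1"
  shows "(trace Z)\<^sup>2 = trace (conjugate_by Z E ** F) + trace (conjugate_by Z F ** E) +
    trace (conjugate_by Z E ** conjugate_by Z F ** (E ** F)) + trace (conjugate_by Z F ** conjugate_by Z E ** (F ** E))"
proof -
  have add: "M ** (A + B) = M ** A + M ** B" for M A B :: "complex^2^2" by (rule matrix_add_ldistrib)
  have "Z ** mat (trace (adj2 Z)) = Z ** (E ** adj2 Z ** F + F ** adj2 Z ** E + E ** F ** adj2 Z ** (E ** F) + F ** E ** adj2 Z ** (F ** E))"
    by (simp only: matrix_unit_casimir[OF EF, of "adj2 Z"])
  also have "\<dots> = conjugate_by Z E ** F + conjugate_by Z F ** E + conjugate_by Z (E ** F) ** (E ** F) + conjugate_by Z (F ** E) ** (F ** E)"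
    by (simp only: add conjugate_by_def matrix_mul_assoc)
  also have "\<dots> = conjugate_by Z E ** F + conjugate_by Z F ** E + conjugate_by Z E ** conjugate_by Z F ** (E ** F) +
      conjugate_by Z F ** conjugate_by Z E ** (F ** E)"
    by (simp only: conjugate_by_simps(1)[OF Z])
  finally have "trace (Z ** mat (trace (adj2 Z))) = trace (conjugate_by Z E ** F) + trace (conjugate_by Z F ** E) +
    trace (conjugate_by Z E ** conjugate_by Z F ** (E ** F)) + trace (conjugate_by Z F ** conjugate_by Z E ** (F ** E))"
    by (simp only: trace_add)
  moreover have "trace (Z ** mat (trace (adj2 Z))) = (trace Z)\<^sup>2"
    by (simp add: trace2 mat2_mult_nth power2_eq_square algebra_simps)
  ultimately show ?thesis by simp
qed

lemma mpow_unipotent: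
  assumes "E ** E = (0 :: complex^2^2)"
  shows "mpow (mat 1 + mat c ** E) n = mat 1 + mat (of_nat n * c) ** E"
proof (induction n)
  case 0
  show ?case by (rule matrix_2_eqI) (simp_all add: mat2_mult_nth)
next
  case (Suc n)
  have e: "E $ i $ 1 * E $ 1 $ j + E $ i $ 2 * E $ 2 $ j = 0" for i j
    using arg_cong[OF assms, of "\<lambda>M. M $ i $ j"] by (simp add: mat2_mult_nth)
  have "mpow (mat 1 + mat c ** E) (Suc n) = (mat 1 + mat (of_nat n * c) ** E) ** (mat 1 + mat c ** E)"
    by (simp add: Suc)
  also have "\<dots> = mat 1 + mat (of_nat n * c) ** E + mat c ** E + (mat (of_nat n * c) ** E) ** (mat c ** E)"
    by (simp add: matrix_add_ldistrib matrix_add_rdistrib2 algebra_simps)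
  also have "(mat (of_nat n * c) ** E) ** (mat c ** E) = mat (of_nat n * c * c) ** (E ** E)"
    by (rule matrix_2_eqI) (simp_all add: mat2_mult_nth algebra_simps)
  also have "mat (of_nat n * c * c) ** (E ** E) = (0 :: complex^2^2)"
    unfolding assms by (rule matrix_2_eqI) (simp_all add: mat2_mult_nth)
  also have "mat 1 + mat (of_nat n * c) ** E + mat c ** E + 0 = mat 1 + mat (of_nat (Suc n) * c) ** E"
    by (rule matrix_2_eqI) (simp_all add: mat2_mult_nth algebra_simps)
  finally show ?case .
qed

lemma mpow_row_eigenvector:
  assumes "p * Z $ 1 $ 1 + q * Z $ 2 $ 1 = l * p" "p * Z $ 1 $ 2 + q * Z $ 2 $ 2 = l * q"
  shows "p * mpow Z n $ 1 $ 1 + q * mpow Z n $ 2 $ 1 = l ^ n * p" "p * mpow Z n $ 1 $ 2 + q * mpow Z n $ 2 $ 2 = l ^ n * q"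
proof (induction n)
  case (Suc n)
  {
    case 1
    have "p * mpow Z (Suc n) $ 1 $ 1 + q * mpow Z (Suc n) $ 2 $ 1 =
        (p * mpow Z n $ 1 $ 1 + q * mpow Z n $ 2 $ 1) * Z $ 1 $ 1 + (p * mpow Z n $ 1 $ 2 + q * mpow Z n $ 2 $ 2) * Z $ 2 $ 1"
      by (simp add: mat2_mult_nth algebra_simps)
    also have "\<dots> = l ^ n * (p * Z $ 1 $ 1 + q * Z $ 2 $ 1)" by (simp only: Suc) (simp add: algebra_simps)
    finally show ?case by (simp add: assms)
  next
    case 2
    have "p * mpow Z (Suc n) $ 1 $ 2 + q * mpow Z (Suc n) $ 2 $ 2 =
        (p * mpow Z n $ 1 $ 1 + q * mpow Z n $ 2 $ 1) * Z $ 1 $ 2 + (p * mpow Z n $ 1 $ 2 + q * mpow Z n $ 2 $ 2) * Z $ 2 $ 2"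
      by (simp add: mat2_mult_nth algebra_simps)
    also have "\<dots> = l ^ n * (p * Z $ 1 $ 2 + q * Z $ 2 $ 2)" by (simp only: Suc) (simp add: algebra_simps)
    finally show ?case by (simp add: assms)
  }
qed simp_all

context quaternion_order
begin

lemma field_divide: "x \<in> k \<Longrightarrow> y \<in> k \<Longrightarrow> x / y \<in> k"
  using csubfield_divide[OF field_k] .

text \<open>
  A zero divisor makes the norm form isotropic; the lemma finds an isotropic vector among the pure
  quaternions, that is, a nonzero nilpotent. The last condition guarantees that its product with \<open>i\<close> or
  with \<open>ij\<close> has nonzero trace.
\<close>

lemma isotropic_pure_quaternion:
  assumes x: "x \<in> quats" "x \<noteq> 0" "quat_norm a b x = 0"
  obtains e where "e \<in> quats" "e $ 1 = 0" "quat_norm a b e = 0" "e $ 2 \<noteq> 0 \<or> e $ 4 \<noteq> 0"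
proof -
  have xk: "x $ i \<in> k" for i using x by (simp add: quats_def)
  have n: "(x$1)\<^sup>2 - a * (x$2)\<^sup>2 = b * ((x$3)\<^sup>2 - a * (x$4)\<^sup>2)" using x(3) by (simp add: quat_norm_eq algebra_simps)
  define e :: "complex \<Rightarrow> complex \<Rightarrow> complex \<Rightarrow> complex^4" where "e p q r = vector [0, p, q, r]" for p q r
  have e: "e p q r $ 1 = 0" "e p q r $ 2 = p" "e p q r $ 3 = q" "e p q r $ 4 = r" for p q r
    by (simp_all add: e_def)
  have eq: "p \<in> k \<Longrightarrow> q \<in> k \<Longrightarrow> r \<in> k \<Longrightarrow> e p q r \<in> quats" for p q r
    using k_closed(1) by (simp add: quats_iff e)
  define D where "D = (x$3)\<^sup>2 - a * (x$4)\<^sup>2"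
  show ?thesis
  proof (cases "D = 0")
    case False
    \<comment> \<open>here \<open>b = u\<^sup>2 - a v\<^sup>2\<close> is a norm from \<open>k(\<surd>a)\<close>\<close>
    define u where "u = (x$1 * x$3 - a * x$2 * x$4) / D"
    define v where "v = (x$2 * x$3 - x$1 * x$4) / D"
    have "D * D * b = (x$1 * x$3 - a * x$2 * x$4)\<^sup>2 - a * (x$2 * x$3 - x$1 * x$4)\<^sup>2"
      using n unfolding D_def by Groebner_Basis.algebra
    also have "\<dots> = D * D * (u\<^sup>2 - a * v\<^sup>2)" using False by (simp add: u_def v_def power_divide field_simps power2_eq_square)
    finally have bn: "b = u\<^sup>2 - a * v\<^sup>2" using False by simp
    have Dk: "D \<in> k" unfolding D_def using xk a by (intro k_closed csubring_power csubring_k) auto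
    have uv: "u \<in> k" "v \<in> k" unfolding u_def v_def using xk a Dk by (auto intro!: field_divide k_closed)
    have "quat_norm a b (e b (a * v) u) = 0"
    proof -
      have "quat_norm a b (e b (a * v) u) = a * b * (u\<^sup>2 - a * v\<^sup>2 - b)"
        by (simp add: quat_norm_eq e power2_eq_square algebra_simps)
      then show ?thesis using bn by simp
    qed
    then show ?thesis using that[of "e b (a * v) u"] eq[of b "a * v" u] b uv a k_closed(6) by (simp add: e)
  next
    case True
    then have 1: "(x$1)\<^sup>2 = a * (x$2)\<^sup>2" "(x$3)\<^sup>2 = a * (x$4)\<^sup>2" using n by (auto simp: D_def)
    obtain s where s: "s \<in> k" "s\<^sup>2 = a"
    proof (cases "x$4 = 0")
      case False
      then show ?thesis using that[of "x$3 / x$4"] 1 xk field_divide by (simp add: power_divide)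
    next
      case True
      then have "x$3 = 0" using 1 by simp
      have "x$2 \<noteq> 0"
      proof
        assume "x$2 = 0"
        then have "x = 0" using 1 True \<open>x$3 = 0\<close> by (intro vec4_eqI) auto
        then show False using x(2) by simp
      qed
      then show ?thesis using that[of "x$1 / x$2"] 1 xk field_divide by (simp add: power_divide)
    qed
    have "quat_norm a b (e 0 s 1) = 0" by (simp add: quat_norm_eq e s)
    then show ?thesis using that[of "e 0 s 1"] eq[of 0 s 1] s k_closed by (simp add: e)
  qed
qed

text \<open>
  Choose a pure \<open>y\<close> with \<open>t = tr (e y) \<noteq> 0\<close>. As \<open>e\<close> is isotropic, adding a multiple of \<open>e\<close> to \<open>y\<close> changes the
  norm of \<open>y\<close> linearly, so the norm can be made zero; then rescale.
\<close>

lemma nilpotent_pair: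
  assumes x: "x \<in> quats" "x \<noteq> 0" "quat_norm a b x = 0"
  obtains e f where "e \<in> quats" "f \<in> quats" "e $ 1 = 0" "f $ 1 = 0" "quat_norm a b e = 0" "quat_norm a b f = 0"
    "trace (\<rho> e ** \<rho> f) = 1"
proof -
  obtain e where e: "e \<in> quats" "e $ 1 = 0" "quat_norm a b e = 0" "e $ 2 \<noteq> 0 \<or> e $ 4 \<noteq> 0"
    using isotropic_pure_quaternion[OF x] by blast
  define l :: 4 where "l = (if e $ 2 \<noteq> 0 then 2 else 4)"
  define y :: "complex^4" where "y = axis l 1"
  have y: "y \<in> quats" "y $ 1 = 0" unfolding y_def l_def by (rule quats_closed) (simp add: axis_def)
  define t where "t = 2 * quat_mult a b e y $ 1"
  define q where "q = quat_norm a b y"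
  have tk: "t \<in> k" using quats_closed(2)[OF e(1) y(1)] csubring_of_nat[OF csubring_k, of 2]
    by (auto simp: t_def quats_def simp del: quat_mult_nth intro!: k_closed)
  have qk: "q \<in> k" using y a b by (auto simp: q_def quat_norm_eq quats_def intro!: k_closed csubring_power csubring_k)
  have "t \<noteq> 0" using e(4) a b by (auto simp: t_def y_def l_def axis_def e(2))
  define f where "f = (1 / t) *s (y + (q / t) *s e)"
  have ey: "y + (q / t) *s e \<in> quats" using y e qk tk by (intro quats_closed field_divide)
  then have f: "f \<in> quats" "f $ 1 = 0"
    unfolding f_def using y(2) e(2) quats_closed(3)[OF field_divide[OF k_closed(2) tk] ey] by simp_all
  have "quat_norm a b (i *s (y + c *s e)) =
      i\<^sup>2 * (quat_norm a b y - c * (2 * quat_mult a b e y $ 1) + c\<^sup>2 * quat_norm a b e)" for i c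
    by (simp add: quat_norm_eq y(2) e(2) power2_eq_square algebra_simps)
  then have "quat_norm a b f = (1 / t)\<^sup>2 * (q - (q / t) * t + (q / t)\<^sup>2 * quat_norm a b e)"
    by (simp only: f_def q_def t_def)
  then have "quat_norm a b f = 0" using e(3) \<open>t \<noteq> 0\<close> by simp
  moreover have "trace (\<rho> e ** \<rho> f) = 1"
  proof -
    have "trace (\<rho> e ** \<rho> f) = 2 * quat_mult a b e f $ 1"
      using e(1) f(1) by (simp add: trace_rho quats_closed flip: rho_hom(2))
    also have "\<dots> = (1 / t) * (t - 2 * (q / t) * quat_norm a b e)"
    proof -
      have "2 * quat_mult a b e (i *s (y + c *s e)) $ 1 = i * (2 * quat_mult a b e y $ 1 - 2 * c * quat_norm a b e)" for i c
        by (simp add: quat_norm_eq y(2) e(2) power2_eq_square algebra_simps)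
      then show ?thesis by (simp only: f_def t_def)
    qed
    finally show ?thesis using e(3) \<open>t \<noteq> 0\<close> by simp
  qed
  ultimately show ?thesis using that e f by blast
qed

text \<open>
  If \<open>N e\<close> lies in the order, then \<open>1 + N e\<close> is a unit of norm \<open>1\<close>, and its powers are the \<open>1 + n N e\<close>. If the conjugate of one of them
  lies in the algebra, so does the conjugate of \<open>e\<close>.
\<close>

lemma conjugate_nilpotent_in_algebra:
  assumes Z: "det Z = 1" and H: "\<And>U. U \<in> units1 \<Longrightarrow> \<exists>n>0. conjugate_by Z (mpow U n) \<in> units1"
    and e: "e \<in> quats" "e $ 1 = 0" "quat_norm a b e = 0"
  shows "conjugate_by Z (\<rho> e) \<in> \<rho> ` quats"
proof -
  obtain N :: nat where N: "N > 0" "of_nat N *s e \<in> R" using order_multiple[OF e(1)] by blast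
  have EE: "\<rho> e ** \<rho> e = 0"
    using e by (intro nilpotent_trace_zero) (simp_all add: trace_rho det_rho)
  define x where "x = axis 1 1 + of_nat N *s e"
  have xR: "x \<in> R" unfolding x_def using order_closed N by blast
  have "quat_norm a b x = 1 + (of_nat N)\<^sup>2 * quat_norm a b e"
    by (simp add: x_def quat_norm_eq axis_def e(2) power2_eq_square algebra_simps)
  then have xU: "\<rho> x \<in> units1" using xR e(3) by (auto simp: units1_def)
  have \<rho>x: "\<rho> x = mat 1 + mat (of_nat N) ** \<rho> e"
    using e(1) csubring_of_nat[OF csubring_k] by (simp add: x_def rho_hom quats_closed)
  obtain n where n: "n > 0" "conjugate_by Z (mpow (\<rho> x) n) \<in> units1" using H[OF xU] by blast
  define c where "c = (of_nat n * of_nat N :: complex)"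
  have c0: "c \<noteq> 0" and ck: "1 / c \<in> k"
    using n N csubring_of_nat[OF csubring_k, of "n * N"] k_closed(2) field_divide[of 1 c] by (auto simp: c_def)
  obtain y where y: "y \<in> R" "conjugate_by Z (mpow (\<rho> x) n) = \<rho> y" using n(2) by (auto simp: units1_def)
  have "mpow (\<rho> x) n = mat 1 + mat c ** \<rho> e" unfolding \<rho>x c_def by (rule mpow_unipotent[OF EE])
  then have "\<rho> y = conjugate_by Z (mat 1 + mat c ** \<rho> e)" using y(2) by simp
  also have "\<dots> = mat 1 + mat c ** conjugate_by Z (\<rho> e)"
  proof -
    have cm: "Z ** (mat c ** M) = mat c ** (Z ** M)" for M :: "complex^2^2"
      by (rule matrix_2_eqI) (simp_all add: mat2_mult_nth algebra_simps)
    have "conjugate_by Z (mat 1 + mat c ** \<rho> e) = conjugate_by Z (mat 1) + Z ** (mat c ** \<rho> e) ** adj2 Z"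
      by (simp add: conjugate_by_def matrix_add_ldistrib matrix_add_rdistrib2)
    also have "\<dots> = mat 1 + mat c ** conjugate_by Z (\<rho> e)"
      by (simp only: conjugate_by_simps(5)[OF Z] cm) (simp add: conjugate_by_def matrix_mul_assoc)
    finally show ?thesis .
  qed
  finally have \<rho>y: "\<rho> y = mat 1 + mat c ** conjugate_by Z (\<rho> e)" .
  have "conjugate_by Z (\<rho> e) = mat (1 / c) ** (\<rho> y - mat 1)"
    unfolding \<rho>y using c0 by (intro matrix_2_eqI) (simp_all add: mat2_mult_nth)
  also have "\<rho> y - mat 1 = \<rho> (y - axis 1 1)"
    using rho_order_diff[OF y(1) order_closed(3)] rho_hom(3) by simp
  also have "mat (1 / c) ** \<rho> (y - axis 1 1) = \<rho> ((1 / c) *s (y - axis 1 1))"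
    using order_minus[OF y(1) order_closed(3)] order_subset by (intro rho_hom(4)[OF ck, symmetric]) auto
  finally have "conjugate_by Z (\<rho> e) = \<rho> ((1 / c) *s (y - axis 1 1))" .
  moreover have "(1 / c) *s (y - axis 1 1) \<in> quats"
    using order_minus[OF y(1) order_closed(3)] order_subset by (intro quats_closed(3)[OF ck]) auto
  ultimately show ?thesis by blast
qed

lemma commensurator_trace_sq:
  assumes Z: "det Z = 1" and H: "\<And>U. U \<in> units1 \<Longrightarrow> \<exists>n>0. conjugate_by Z (mpow U n) \<in> units1"
    and n: "n > 0" "mpow Z n \<in> units1"
    and x: "x \<in> quats" "x \<noteq> 0" "quat_norm a b x = 0"
  shows "(trace Z)\<^sup>2 \<in> ring_of_integers k"
proof -
  obtain e f where ef: "e \<in> quats" "f \<in> quats" "e $ 1 = 0" "f $ 1 = 0" "quat_norm a b e = 0" "quat_norm a b f = 0"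
    "trace (\<rho> e ** \<rho> f) = 1" using nilpotent_pair[OF x] by metis
  obtain e' f' where ef': "e' \<in> quats" "f' \<in> quats" "conjugate_by Z (\<rho> e) = \<rho> e'" "conjugate_by Z (\<rho> f) = \<rho> f'"
    using conjugate_nilpotent_in_algebra[OF Z H ef(1,3,5)] conjugate_nilpotent_in_algebra[OF Z H ef(2,4,6)] by auto
  have tr: "trace (\<rho> u) \<in> k" if "u \<in> quats" for u
    using that csubring_of_nat[OF csubring_k, of 2] by (auto simp: trace_rho quats_def intro!: k_closed)
  have "(trace Z)\<^sup>2 = trace (\<rho> e' ** \<rho> f) + trace (\<rho> f' ** \<rho> e) + trace (\<rho> e' ** \<rho> f' ** (\<rho> e ** \<rho> f)) +
      trace (\<rho> f' ** \<rho> e' ** (\<rho> f ** \<rho> e))"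
    using ef unfolding ef'(3,4)[symmetric] by (intro trace_sq_by_casimir Z) (simp_all add: trace_rho det_rho)
  also have "\<dots> \<in> k"
    using ef(1,2) ef'(1,2) by (auto simp flip: rho_hom(2) intro!: k_closed tr quats_closed simp: quats_closed)
  finally have "(trace Z)\<^sup>2 \<in> k" .
  moreover have "algebraic_int ((trace Z)\<^sup>2)"
  proof -
    obtain l1 l2 where l: "l1 + l2 = trace Z" "l1 * l2 = det Z"
      "\<And>l. l = l1 \<or> l = l2 \<Longrightarrow> \<exists>p q. (p \<noteq> 0 \<or> q \<noteq> 0) \<and> p * Z $ 1 $ 1 + q * Z $ 2 $ 1 = l * p \<and> p * Z $ 1 $ 2 + q * Z $ 2 $ 2 = l * q"
      using eigenvalue_pair_2[of Z] by metis
    obtain r where r: "r \<in> R" "mpow Z n = \<rho> r" using n(2) by (auto simp: units1_def)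
    have "algebraic_int l" if l': "l = l1 \<or> l = l2" for l
    proof -
      obtain p q where pq: "p \<noteq> 0 \<or> q \<noteq> 0" "p * Z $ 1 $ 1 + q * Z $ 2 $ 1 = l * p" "p * Z $ 1 $ 2 + q * Z $ 2 $ 2 = l * q"
        using l(3)[OF l'] by blast
      have "algebraic_int (l ^ n)"
        using eigenvalue_integral[OF r(1) pq(1)] mpow_row_eigenvector[OF pq(2,3), of n] unfolding r(2) by blast
      then show ?thesis using algebraic_int_power_imp n(1) by blast
    qed
    then have "algebraic_int (trace Z)" using algebraic_int_add_mult(1) l(1) by metis
    then show ?thesis using algebraic_int_add_mult(2) by (simp add: power2_eq_square)
  qed
  ultimately show ?thesis by (simp add: ring_of_integers_def)
qed

text \<open>
  With only two conjugates, \<open>x = p + q \<theta>\<close> for rational \<open>p, q\<close>, and \<open>q = 0\<close> as \<open>x\<close> is real.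
\<close>

lemma real_integers_imaginary_quadratic:
  assumes nonreal: "\<theta> \<notin> \<real>" and conj: "conjugates \<subseteq> {\<theta>, cnj \<theta>}"
    and x: "x \<in> ring_of_integers k" "x \<in> \<real>"
  shows "x \<in> \<int>"
proof -
  have xk: "x \<in> k" and xi: "algebraic_int x" using x(1) by (auto simp: ring_of_integers_def)
  have "card conjugates \<le> card {\<theta>, cnj \<theta>}" using conj by (intro card_mono) auto
  also have "\<dots> \<le> 2" by (simp add: card_insert_if)
  finally have "degree (rep x) \<le> 1" using rep(2)[OF xk] by (simp add: card_conjugates)
  then have "rep x = [:coeff (rep x) 0, coeff (rep x) 1:]"
    by (intro poly_eqI) (auto simp: coeff_pCons coeff_eq_0 split: nat.splits)
  then have "poly (rep x) \<theta> = coeff (rep x) 0 + \<theta> * coeff (rep x) 1" by (metis poly_pCons poly_0 mult_zero_right add.right_neutral)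
  then have e: "x = coeff (rep x) 0 + \<theta> * coeff (rep x) 1" using rep(3)[OF xk] by simp
  have q: "coeff (rep x) i \<in> \<rat>" for i using rep(1)[OF xk] by (simp add: poly_over_def)
  have "coeff (rep x) 1 = 0"
  proof (rule ccontr)
    assume "coeff (rep x) 1 \<noteq> 0"
    then have "\<theta> = (x - coeff (rep x) 0) / coeff (rep x) 1" using e by (simp add: field_simps)
    also have "\<dots> \<in> \<real>" using x(2) q cnj_Rats by (intro Reals_divide Reals_diff) (auto simp: Reals_cnj_iff)
    finally show False using nonreal by simp
  qed
  then have "x \<in> \<rat>" using e q[of 0] by simp
  then show ?thesis using xi by (intro rational_algebraic_int_is_int)
qed

end

section \<open>Number fields, places and ramification\<close>

lemma field_ring_simps [simp]:
  "carrier field_ring = UNIV" "x \<otimes>\<^bsub>field_ring\<^esub> y = x * y" "\<one>\<^bsub>field_ring\<^esub> = 1"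
  "\<zero>\<^bsub>field_ring\<^esub> = 0" "x \<oplus>\<^bsub>field_ring\<^esub> y = x + y"
  by (simp_all add: field_ring_def)

lemma ring_field_ring: "ring (field_ring :: complex ring)"
proof (rule ringI)
  show "abelian_group (field_ring :: complex ring)"
  proof (rule abelian_groupI)
    show "\<exists>y\<in>carrier field_ring. y \<oplus>\<^bsub>field_ring\<^esub> x = \<zero>\<^bsub>field_ring\<^esub>" for x :: complex
      by (intro bexI[of _ "- x"]) auto
  qed (auto simp: algebra_simps)
  show "Group.monoid (field_ring :: complex ring)"
    by (rule monoidI) (auto simp: algebra_simps)
qed (auto simp: algebra_simps)

lemma subfield_imp_csubfield:
  assumes "subfield k field_ring"
  shows "csubfield k"
proof -
  have M: "submonoid k field_ring" and G: "subgroup k (add_monoid field_ring)"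
    using assms unfolding subfield_def subdomain_def subcring_def subring_def by blast+
  have add: "x + y \<in> k" if "x \<in> k" "y \<in> k" for x y
    using subgroup.m_closed[OF G that] by simp
  have mult: "x * y \<in> k" if "x \<in> k" "y \<in> k" for x y
    using submonoid.m_closed[OF M that] by simp
  have one: "1 \<in> k" using submonoid.one_closed[OF M] by simp
  have neg: "- x \<in> k" if "x \<in> k" for x
  proof -
    have "inv\<^bsub>add_monoid field_ring\<^esub> x = - x"
      unfolding m_inv_def by (rule the_equality) (auto simp: eq_neg_iff_add_eq_0 add.commute)
    then show ?thesis using subgroup.m_inv_closed[OF G that] by simp
  qed
  have inv: "inverse x \<in> k" if x: "x \<in> k" for x
  proof (cases "x = 0")
    case False
    then have "x \<in> Units (field_ring\<lparr>carrier := k\<rparr>)" using x subfield.subfield_Units[OF assms] by simp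
    then obtain y where "y \<in> k" "y * x = 1" by (auto simp: Units_def)
    then have "inverse x = y" by (metis inverse_unique mult.commute)
    then show ?thesis using \<open>y \<in> k\<close> by simp
  qed (use x in simp)
  show ?thesis unfolding csubfield_def csubring_def
    using one mult inv add[OF _ neg] by (auto simp: diff_conv_add_uminus simp del: add_uminus_conv_diff)
qed

text \<open>
  The spanning set is read off the chain of line extensions that defines the dimension.
\<close>

lemma finite_dimension_spanning_set:
  assumes "ring.dimension field_ring n \<rat> E"
  shows "\<exists>B. finite B \<and> B \<subseteq> E \<and> (\<forall>x\<in>E. \<exists>q :: complex \<Rightarrow> complex. (\<forall>b. q b \<in> \<rat>) \<and> x = (\<Sum>b\<in>B. q b * b)) \<and> (0::complex) \<in> E"
  using assms
proof (induction n "\<rat> :: complex set" E rule: ring.dimension.induct[OF ring_field_ring, consumes 1])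
  case 1
  show ?case by (intro exI[of _ "{}"]) (auto intro!: exI[of _ "\<lambda>_. 0"])
next
  case (2 v E n)
  then obtain B where B: "finite B" "B \<subseteq> E" "(0::complex) \<in> E"
    "\<And>x. x \<in> E \<Longrightarrow> \<exists>q :: complex \<Rightarrow> complex. (\<forall>b. q b \<in> \<rat>) \<and> x = (\<Sum>b\<in>B. q b * b)" by blast
  have mem: "x \<in> ring.line_extension field_ring \<rat> v E \<longleftrightarrow> (\<exists>c\<in>\<rat>. \<exists>u\<in>E. x = c * v + u)" for x
    using ring.line_extension_mem_iff[OF ring_field_ring, of x \<rat> v E] by simp
  have vB: "v \<notin> B" using 2 B by blast
  show ?case
  proof (intro exI[of _ "insert v B"] conjI ballI)
    show "finite (insert v B)" using B by simp
    show "insert v B \<subseteq> ring.line_extension field_ring \<rat> v E"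
    proof
      fix x assume "x \<in> insert v B"
      then have "x = 1 * v + 0 \<or> x \<in> E \<and> x = 0 * v + x" using B(2) by auto
      then show "x \<in> ring.line_extension field_ring \<rat> v E"
        unfolding mem using B(3) Rats_0 Rats_1 by blast
    qed
    show "0 \<in> ring.line_extension field_ring \<rat> v E" unfolding mem using B(3) by (intro bexI[of _ 0]) auto
    fix x assume "x \<in> ring.line_extension field_ring \<rat> v E"
    then obtain c u where cu: "c \<in> \<rat>" "u \<in> E" "x = c * v + u" unfolding mem by blast
    obtain q :: "complex \<Rightarrow> complex" where q: "\<forall>b. q b \<in> \<rat>" "u = (\<Sum>b\<in>B. q b * b)" using B(4)[OF cu(2)] by blast
    have "(\<Sum>b\<in>B. (q(v := c)) b * b) = (\<Sum>b\<in>B. q b * b)" using vB by (intro sum.cong) auto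
    then have "x = (\<Sum>b\<in>insert v B. (q(v := c)) b * b)" using vB B(1) by (simp add: cu(3) q(2))
    then show "\<exists>q :: complex \<Rightarrow> complex. (\<forall>b. q b \<in> \<rat>) \<and> x = (\<Sum>b\<in>insert v B. q b * b)"
      using q(1) cu(1) by (intro exI[of _ "q(v := c)"]) auto
  qed
qed

text \<open>
  A finite spanning set generates \<open>k\<close>, and multiplication by \<open>x \<in> k\<close> on it shows that \<open>x\<close> is algebraic.
  A multiple of a primitive element is integral.
\<close>

lemma number_field_primitive:
  assumes "number_field k"
  obtains \<theta> m where "primitive_field k \<theta> m" "csubfield k"
proof -
  have k: "csubfield k" using assms subfield_imp_csubfield by (simp add: number_field_def)
  note kr = csubfield_csubring[OF k]
  obtain n where dim: "ring.dimension field_ring n \<rat> k"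
    using assms by (auto simp: number_field_def ring.finite_dimension_def[OF ring_field_ring])
  obtain B where B0: "finite B \<and> B \<subseteq> k \<and>
      (\<forall>x\<in>k. \<exists>q :: complex \<Rightarrow> complex. (\<forall>b. q b \<in> \<rat>) \<and> x = (\<Sum>b\<in>B. q b * b)) \<and> 0 \<in> k"
    using finite_dimension_spanning_set[OF dim] by (rule exE)
  have B: "finite B" "B \<subseteq> k" using B0 by simp_all
  have span: "\<exists>q :: complex \<Rightarrow> complex. (\<forall>b. q b \<in> \<rat>) \<and> x = (\<Sum>b\<in>B. q b * b)" if "x \<in> k" for x
    using conjunct1[OF conjunct2[OF conjunct2[OF B0]]] that by (rule bspec)
  have alg: "\<exists>p. poly_over \<rat> p \<and> p \<noteq> 0 \<and> poly p x = 0" if x: "x \<in> k" for x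
  proof -
    obtain q1 :: "complex \<Rightarrow> complex" where q1: "1 = (\<Sum>b\<in>B. q1 b * b)" using span[OF csubring_closed(2)[OF kr]] by blast
    have "\<exists>b\<in>B. b \<noteq> 0"
    proof (rule ccontr)
      assume "\<not> ?thesis"
      then have "(\<Sum>b\<in>B. q1 b * b) = 0" by (intro sum.neutral) auto
      then show False using q1 by simp
    qed
    then obtain b0 where b0: "b0 \<in> B" "b0 \<noteq> 0" by blast
    have "\<exists>q. poly_over \<rat> q \<and> lead_coeff q = 1 \<and> poly q x = 0"
    proof (rule monic_root_if_eigenvalue[where I = B and v = "\<lambda>b. b", OF csubfield_csubring[OF csubfield_Rats] B(1) b0])
      fix b assume "b \<in> B"
      then have "x * b \<in> k" using x B(2) csubring_closed(6)[OF kr] by blast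
      then show "\<exists>c. (\<forall>j\<in>B. c j \<in> \<rat>) \<and> x * b = (\<Sum>j\<in>B. c j * j)" using span by blast
    qed
    then show ?thesis by (metis leading_coeff_0_iff zero_neq_one)
  qed
  have gen: "k \<subseteq> L" if "csubfield L" "B \<subseteq> L" for L
  proof
    fix x assume "x \<in> k"
    then obtain q :: "complex \<Rightarrow> complex" where "\<forall>b. q b \<in> \<rat>" "x = (\<Sum>b\<in>B. q b * b)" using span by blast
    then show "x \<in> L" using that Rats_subset_csubfield[OF that(1)] csubfield_csubring[OF that(1)]
      by (auto intro!: csubring_sum csubring_closed(6))
  qed
  obtain t where t: "t \<in> k" "k = adjoin t" using primitive_element[OF k alg B(1,2) gen] by blast
  obtain p where p: "poly_over \<rat> p" "p \<noteq> 0" "poly p t = 0" using alg[OF t(1)] by blast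
  obtain N :: nat where N: "N > 0" "algebraic_int (of_nat N * t)" using algebraic_integer_multiple[OF p] by blast
  define \<theta> where "\<theta> = of_nat N * t"
  have \<theta>k: "\<theta> \<in> k" unfolding \<theta>_def using t(1) csubring_of_nat[OF kr] csubring_closed(6)[OF kr] by blast
  have "adjoin t \<subseteq> adjoin \<theta>"
  proof -
    have "(1 / of_nat N :: complex) \<in> \<rat>" by simp
    then have "(1 / of_nat N) \<in> adjoin \<theta>" using Rats_subset_adjoin[of \<theta>] by blast
    then have "(1 / of_nat N) * \<theta> \<in> adjoin \<theta>" using adjoin_self csubring_closed(6)[OF csubring_adjoin] by blast
    then have "t \<in> adjoin \<theta>" using N(1) by (simp add: \<theta>_def)
    then show ?thesis
      using poly_in_csubring[OF csubring_adjoin] poly_over_mono[OF _ Rats_subset_adjoin] by (auto simp: adjoin_def[of t])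
  qed
  then have "k = adjoin \<theta>" using adjoin_least[OF k \<theta>k] t(2) by blast
  moreover obtain m where "is_minpoly \<rat> m \<theta>"
    using alg[OF \<theta>k] is_minpoly_exists[OF csubfield_Rats] by metis
  ultimately have "primitive_field k \<theta> m" using N(2) by unfold_locales (simp_all add: \<theta>_def)
  then show ?thesis using that k by blast
qed

context primitive_field
begin

lemma emb_real_embedding:
  assumes y: "y \<in> conjugates" "y \<in> \<real>"
  shows "restrict (\<lambda>x. Re (emb y x)) k \<in> field_embeddings k"
proof -
  have real: "emb y x \<in> \<real>" if "x \<in> k" for x
  proof -
    have "coeff (rep x) i \<in> \<real>" for i
      using rep(1)[OF that] by (auto simp: poly_over_def complex_is_Real_iff elim!: Rats_cases' dest!: spec[of _ i])
    then show ?thesis unfolding emb_def poly_altdef using y by (intro sum_in_Reals Reals_mult Reals_power)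
  qed
  have im: "Im (emb y x) = 0" if "x \<in> k" for x using real[OF that] by (simp add: complex_is_Real_iff)
  show ?thesis
    unfolding field_embeddings_def ring_hom_def
    by (auto simp: field_ring_def emb_hom[OF y(1)] emb_rat[OF y(1) Rats_1] im csubring_closed[OF csubring_k])
qed

lemma emb_complex_embedding:
  assumes y: "y \<in> conjugates"
  shows "restrict (emb y) k \<in> field_embeddings k"
  unfolding field_embeddings_def ring_hom_def
  by (auto simp: field_ring_def emb_hom[OF y] emb_rat[OF y Rats_1] csubring_closed[OF csubring_k])

lemma theta_not_real: "\<not> k \<subseteq> \<real> \<Longrightarrow> \<theta> \<notin> \<real>"
proof
  assume "\<not> k \<subseteq> \<real>" "\<theta> \<in> \<real>"
  then obtain x where x: "x \<in> k" "x \<notin> \<real>" by blast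
  have q: "coeff (rep x) i \<in> \<rat>" for i using rep(1)[OF x(1)] by (simp add: poly_over_def)
  have "\<rat> \<subseteq> (\<real> :: complex set)" by (auto elim!: Rats_cases')
  then have "coeff (rep x) i \<in> \<real>" for i using q by blast
  then have "poly (rep x) \<theta> \<in> \<real>" unfolding poly_altdef using \<open>\<theta> \<in> \<real>\<close> by (intro sum_in_Reals Reals_mult Reals_power)
  then show False using x rep(3)[OF x(1)] by simp
qed

text \<open>
  Embeddings are distinguished by the image of \<open>\<theta>\<close>.
\<close>

lemma one_complex_place:
  assumes card: "card (complex_places k) = 1" and k: "\<not> k \<subseteq> \<real>" and y: "y \<in> conjugates" "y \<notin> \<real>"
  shows "y = \<theta> \<or> y = cnj \<theta>"
proof -
  define P where "P y = {restrict (emb y) k, restrict (cnj \<circ> restrict (emb y) k) k}" for y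
  have "P z \<in> complex_places k" if z: "z \<in> conjugates" "z \<notin> \<real>" for z
  proof -
    have "\<not> restrict (emb z) k ` k \<subseteq> \<real>" using emb_theta[OF z(1)] theta_in_k z(2) by auto
    then show ?thesis unfolding complex_places_def P_def using emb_complex_embedding[OF z(1)] by blast
  qed
  then have "P y \<in> complex_places k" "P \<theta> \<in> complex_places k" using y theta_conjugate theta_not_real[OF k] by blast+
  then have "P y = P \<theta>" using card by (metis card_1_singletonE singletonD)
  then have "restrict (emb y) k \<in> P \<theta>" by (auto simp: P_def)
  then have "restrict (emb y) k \<theta> \<in> {restrict (emb \<theta>) k \<theta>, restrict (cnj \<circ> restrict (emb \<theta>) k) k \<theta>}"
    unfolding P_def by (metis insert_iff singleton_iff)
  then show ?thesis using theta_in_k emb_theta[OF y(1)] emb_theta[OF theta_conjugate] by auto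
qed

end

lemma ramified_imp_anisotropic:
  assumes "ramified_at_real_place a b \<sigma>" "x \<noteq> 0"
  shows "quat_norm (\<sigma> a) (\<sigma> b) x \<noteq> 0"
proof
  assume 0: "quat_norm (\<sigma> a) (\<sigma> b) x = 0"
  let ?A = "quat_algebra UNIV (\<sigma> a) (\<sigma> b)"
  have "x \<in> Units ?A" using assms by (simp add: ramified_at_real_place_def Let_def quat_algebra_def)
  then obtain y where "quat_mult (\<sigma> a) (\<sigma> b) y x = axis 1 1" by (auto simp: Units_def quat_algebra_def)
  then have "quat_norm (\<sigma> a) (\<sigma> b) (quat_mult (\<sigma> a) (\<sigma> b) y x) = 1" by (simp add: quat_norm_eq axis_def)
  then show False using 0 by (simp add: quat_norm_mult)
qed

context quaternion_order
begin

text \<open>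
  A real embedding would map the isotropic vector of the norm form to one over \<open>\<real>\<close>.
\<close>

lemma zero_divisor_imp_no_real_conjugates:
  assumes x: "x \<in> quats" "x \<noteq> 0" "quat_norm a b x = 0"
    and ram: "\<And>\<sigma>. \<sigma> \<in> field_embeddings k \<Longrightarrow> ramified_at_real_place a b \<sigma>" and y: "y \<in> conjugates"
  shows "y \<notin> \<real>"
proof
  assume yr: "y \<in> \<real>"
  then have yR: "y \<in> real_conjugates" using y by (simp add: real_conjugates_def)
  define \<sigma> where "\<sigma> = restrict (\<lambda>x. Re (emb y x)) k"
  have s: "complex_of_real (\<sigma> u) = emb y u" if "u \<in> k" for u
    using emb_real[OF yR that] that by (simp add: \<sigma>_def of_real_Re)
  have xk: "x $ i \<in> k" for i using x(1) by (simp add: quats_def)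
  define x' :: "real^4" where "x' = (\<chi> i. \<sigma> (x $ i))"
  obtain i where i: "x $ i \<noteq> 0" using x(2) by (auto simp: vec_eq_iff)
  have "emb y (x $ i) * emb y (inverse (x $ i)) = emb y 1"
    using emb_hom(3)[OF y xk[of i], of "inverse (x $ i)"] i field_k xk by (auto simp: csubfield_def)
  then have "emb y (x $ i) \<noteq> 0" using emb_rat[OF y, of 1] by auto
  then have "\<sigma> (x $ i) \<noteq> 0" using s[OF xk[of i]] by auto
  then have "x' \<noteq> 0" by (metis vec_lambda_beta x'_def zero_index)
  moreover have "ramified_at_real_place a b \<sigma>"
    using ram[OF emb_real_embedding[OF y yr]] unfolding \<sigma>_def .
  ultimately have "quat_norm (\<sigma> a) (\<sigma> b) x' \<noteq> 0" by (intro ramified_imp_anisotropic)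
  moreover have "complex_of_real (quat_norm (\<sigma> a) (\<sigma> b) x') = emb y (quat_norm a b x)"
    unfolding quat_norm_eq power2_eq_square using xk a(1) b(1)
    by (simp add: x'_def s emb_hom[OF y] k_closed)
  ultimately show False using x(3) emb_rat[OF y, of 0] by simp
qed

end

lemma arithmetic_kleinian_groupE:
  assumes "arithmetic_kleinian_group \<Delta>"
  obtains k \<theta> m a b R \<rho> where "quaternion_order k \<theta> m a b R \<rho>"
    "card (complex_places k) = 1" "\<not> k \<subseteq> \<real>" "\<And>\<sigma>. \<sigma> \<in> field_embeddings k \<Longrightarrow> ramified_at_real_place a b \<sigma>"
    "commensurable \<Delta> (psl ` quaternion_order.units1 a b R \<rho>)"
proof -
  obtain k a b R \<rho> where ar: "number_field k" "card (complex_places k) = 1" "\<not> k \<subseteq> \<real>"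
    "a \<in> k - {0}" "b \<in> k - {0}" "\<forall>\<sigma>\<in>field_embeddings k. ramified_at_real_place a b \<sigma>"
    "quat_order k a b R" "quat_embedding k a b \<rho>"
    "commensurable \<Delta> (psl ` \<rho> ` {x \<in> R. quat_norm a b x = 1})"
    using assms unfolding arithmetic_kleinian_group_def by blast
  obtain \<theta> m where "primitive_field k \<theta> m" "csubfield k" using number_field_primitive[OF ar(1)] by blast
  then have q: "quaternion_order k \<theta> m a b R \<rho>"
    using ar by (auto simp: quaternion_order_def quaternion_order_axioms_def)
  show ?thesis
    by (rule that[OF q ar(2,3)]) (use ar q in \<open>auto simp: quaternion_order.units1_def\<close>)
qed

theorem noncocompact_imp_zero_divisor:
  assumes "quaternion_order k \<theta> m a b R \<rho>" "card (complex_places k) = 1" "\<not> k \<subseteq> \<real>"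
    and comm: "commensurable \<Delta> (psl ` quaternion_order.units1 a b R \<rho>)"
    and \<Delta>: "kleinian_group \<Delta>" "\<not> cocompact \<Delta>"
  shows "\<exists>x\<in>quaternion_order.quats k. x \<noteq> 0 \<and> quat_norm a b x = 0"
proof (rule ccontr)
  interpret quaternion_order k \<theta> m a b R \<rho> by fact
  assume "\<not> ?thesis"
  then have division: "quat_norm a b x \<noteq> 0" if "x \<in> quats" "x \<noteq> 0" for x using that by blast
  have cb: "cobounded units1"
    using theta_not_real[OF assms(3)] one_complex_place[OF assms(2,3)] division by (rule division_imp_cobounded)
  have sub: "subgroup \<Delta> PSL2C" using \<Delta>(1) by (simp add: kleinian_group_def)
  show False
  proof (rule commensurable_lift[OF sub unit_group_subgroup comm])
    fix g T
    assume gT: "det g = 1" "finite T"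
      and cover: "\<And>B. B \<in> lift_set unit_group \<Longrightarrow> \<exists>A\<in>lift_set \<Delta>. \<exists>t\<in>T. B = conjugate_by g A ** t"
    have "cobounded (lift_set \<Delta>)"
      by (rule cobounded_commensurable[OF cb gT cover[unfolded lift_unit_group]]) (simp_all add: lift_set_def)
    then show False using cobounded_imp_cocompact[OF sub] \<Delta>(2) by blast
  qed
qed

section \<open>Two-generator groups with a common fixed point\<close>

text \<open>
  In a basis of eigenvectors of \<open>X\<close>, with \<open>Y\<close> having off-diagonal entries \<open>\<beta>, \<gamma>\<close>, the trace of the commutator is
  \<open>2 + \<beta> \<gamma> (4 - tr\<^sup>2 X)\<close>. So \<open>Y\<close> is triangular in this basis. The matrix \<open>S\<close> conjugates both to upper
  triangular ones.
\<close>

lemma common_fixed_point: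
  assumes X: "det X = 1" and Y: "det Y = 1" and tX: "(trace X)\<^sup>2 = 3"
    and comm: "trace (X ** Y ** adj2 X ** adj2 Y) = 2"
  obtains S where "det S = 1" "conjugate_by (adj2 S) X $ 2 $ 1 = 0" "conjugate_by (adj2 S) Y $ 2 $ 1 = 0"
proof -
  obtain l1 l2 where l: "l1 + l2 = trace X" "l1 * l2 = det X"
    "\<And>l. l = l1 \<or> l = l2 \<Longrightarrow> \<exists>p q. (p \<noteq> 0 \<or> q \<noteq> 0) \<and> p * transpose X $ 1 $ 1 + q * transpose X $ 2 $ 1 = l * p \<and> p * transpose X $ 1 $ 2 + q * transpose X $ 2 $ 2 = l * q"
    using eigenvalue_pair_2[of "transpose X"] by (simp add: trace2 transpose_def flip: det_transpose[of X]) blast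
  have l3: "l1 * l2 = 1" "(l1 + l2)\<^sup>2 = 3" using l X tX by auto
  have sq: "l1\<^sup>2 + l2\<^sup>2 = 1" using l3 by (simp add: power2_sum mult.assoc)
  have ne: "l1 \<noteq> l2"
  proof
    assume "l1 = l2"
    then have "(l1 + l2)\<^sup>2 = 4 * (l1 * l2)" by (simp add: power2_eq_square algebra_simps)
    then show False using l3 by simp
  qed
  obtain p1 q1 where e1: "p1 \<noteq> 0 \<or> q1 \<noteq> 0" "p1 * X $ 1 $ 1 + q1 * X $ 1 $ 2 = l1 * p1" "p1 * X $ 2 $ 1 + q1 * X $ 2 $ 2 = l1 * q1"
    using l(3)[of l1] by (auto simp: transpose_def)
  obtain p2 q2 where e2: "p2 \<noteq> 0 \<or> q2 \<noteq> 0" "p2 * X $ 1 $ 1 + q2 * X $ 1 $ 2 = l2 * p2" "p2 * X $ 2 $ 1 + q2 * X $ 2 $ 2 = l2 * q2"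
    using l(3)[of l2] by (auto simp: transpose_def)
  define D where "D = p1 * q2 - p2 * q1"
  have D: "D \<noteq> 0"
  proof
    assume "D = 0"
    then have d: "p1 * q2 = p2 * q1" by (simp add: D_def)
    have "(l1 - l2) * (p1 * p2) = 0" "(l1 - l2) * (q1 * q2) = 0" "(l1 - l2) * (p1 * q2) = 0"
      using e1 e2 d by Groebner_Basis.algebra+
    then have "p1 * p2 = 0" "q1 * q2 = 0" "p1 * q2 = 0" "p2 * q1 = 0" using ne d by auto
    then show False using e1(1) e2(1) by auto
  qed
  \<comment> \<open>columns are eigenvectors of \<open>X\<close>, scaled to determinant \<open>1\<close>\<close>
  define S where "S = mk2 p1 (p2 / D) q1 (q2 / D)"
  have S: "det S = 1"
  proof -
    have "det S = (p1 * q2 - p2 * q1) / D" by (simp add: det_2 S_def diff_divide_distrib)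
    then have "det S = D / D" by (simp only: D_def)
    then show ?thesis using D by simp
  qed
  define X' Y' where XY: "X' = conjugate_by (adj2 S) X" "Y' = conjugate_by (adj2 S) Y"
  have dS: "det (adj2 S) = 1" using S by (simp add: det_adj2)
  have "X ** S = S ** mk2 l1 0 0 l2"
    using e1(2,3) e2(2,3) D by (intro matrix_2_eqI) (simp_all add: mat2_mult_nth S_def field_simps)
  moreover have "adj2 (adj2 S) = S" by (rule matrix_2_eqI) simp_all
  ultimately have X': "X' = mk2 l1 0 0 l2"
    using adj2_cancel(2)[OF S] by (simp add: XY conjugate_by_def flip: matrix_mul_assoc)
  have adjc: "conjugate_by (adj2 S) (adj2 M) = adj2 (conjugate_by (adj2 S) M)" for M
    by (rule matrix_2_eqI) (simp_all add: conjugate_by_def mat2_mult_nth algebra_simps)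
  have "trace (X' ** Y' ** adj2 X' ** adj2 Y') = trace (conjugate_by (adj2 S) (X ** Y ** adj2 X ** adj2 Y))"
    by (simp add: XY conjugate_by_simps(1)[OF dS] adjc)
  then have tc: "trace (X' ** Y' ** adj2 X' ** adj2 Y') = 2" using comm conjugate_by_simps(7)[OF dS] by simp
  have dY': "Y' $ 1 $ 1 * Y' $ 2 $ 2 - Y' $ 1 $ 2 * Y' $ 2 $ 1 = 1"
    using conjugate_by_simps(4)[OF dS, of Y] Y by (simp add: XY det_2)
  have "trace (X' ** Y' ** adj2 X' ** adj2 Y') =
      2 * (l1 * l2) * (Y' $ 1 $ 1 * Y' $ 2 $ 2) - (l1\<^sup>2 + l2\<^sup>2) * (Y' $ 1 $ 2 * Y' $ 2 $ 1)"
    by (simp add: trace2 mat2_mult_nth X' power2_eq_square algebra_simps)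
  also have "\<dots> = 2 + Y' $ 1 $ 2 * Y' $ 2 $ 1" using dY' l3(1) sq by (simp add: algebra_simps)
  finally have "Y' $ 1 $ 2 * Y' $ 2 $ 1 = 0" using tc by simp
  then show ?thesis
  proof (cases "Y' $ 2 $ 1 = 0")
    case True
    then show ?thesis using that[OF S] X' by (simp add: XY)
  next
    case False
    then have 0: "Y' $ 1 $ 2 = 0" using \<open>Y' $ 1 $ 2 * Y' $ 2 $ 1 = 0\<close> by simp
    \<comment> \<open>exchange the two eigenvectors\<close>
    define W where "W = mk2 0 (- 1) 1 0"
    have W: "det W = 1" by (simp add: det_2 W_def)
    have "conjugate_by (adj2 (S ** W)) M = conjugate_by (adj2 W) (conjugate_by (adj2 S) M)" for M
    proof -
      have "adj2 (S ** W) = adj2 W ** adj2 S" by (rule matrix_2_eqI) (simp_all add: mat2_mult_nth algebra_simps)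
      then show ?thesis using conjugate_by_mult(1)[of "adj2 W" "adj2 S"] W S by (simp add: det_adj2)
    qed
    moreover have "conjugate_by (adj2 W) M $ 2 $ 1 = - M $ 1 $ 2" for M
      by (simp add: conjugate_by_def mat2_mult_nth W_def)
    moreover have "det (S ** W) = 1" using S W by (simp add: det_mul)
    ultimately show ?thesis using that[of "S ** W"] X' 0 by (simp flip: XY)
  qed
qed

text \<open>
  The first column of \<open>S\<close> is an eigenvector of \<open>A\<close>.
\<close>

lemma moebius_fixed:
  assumes S: "det S = 1" and A: "det A = 1" and c: "conjugate_by (adj2 S) A $ 2 $ 1 = 0"
  shows "moebius A (moebius S None) = moebius S None"
proof -
  define l where "l = conjugate_by (adj2 S) A $ 1 $ 1"
  define p q where pq: "p = S $ 1 $ 1" "q = S $ 2 $ 1"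
  have dS: "det (adj2 S) = 1" using S by (simp add: det_adj2)
  have "adj2 (adj2 S) = S" by (rule matrix_2_eqI) simp_all
  then have "A ** S = S ** conjugate_by (adj2 S) A"
    using adj2_cancel(1)[OF S] by (simp add: conjugate_by_def flip: matrix_mul_assoc)
  then have "(A ** S) $ 1 $ 1 = (S ** conjugate_by (adj2 S) A) $ 1 $ 1" "(A ** S) $ 2 $ 1 = (S ** conjugate_by (adj2 S) A) $ 2 $ 1"
    by simp_all
  then have e: "A $ 1 $ 1 * p + A $ 1 $ 2 * q = l * p" "A $ 2 $ 1 * p + A $ 2 $ 2 * q = l * q"
    by (simp_all add: mat2_mult_nth c l_def pq mult.commute)
  have "l \<noteq> 0"
  proof
    assume "l = 0"
    then have "det (conjugate_by (adj2 S) A) = 0" by (simp add: det_2 c l_def)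
    then show False using conjugate_by_simps(4)[OF dS, of A] A by simp
  qed
  show ?thesis
  proof (cases "q = 0")
    case True
    then have "p \<noteq> 0" using S by (auto simp: det_2 pq)
    then have "A $ 2 $ 1 = 0" using e(2) True by simp
    then show ?thesis using True by (simp add: moebius_def Let_def pq)
  next
    case False
    have "A $ 2 $ 1 * (p / q) + A $ 2 $ 2 = l" using e(2) False by (simp add: field_simps)
    moreover have "A $ 1 $ 1 * (p / q) + A $ 1 $ 2 = l * (p / q)" using e(1) False by (simp add: field_simps)
    ultimately show ?thesis using False \<open>l \<noteq> 0\<close> by (simp add: moebius_def Let_def flip: pq)
  qed
qed

lemma reducible_pair_imp_elementary:
  assumes X: "det X = 1" and Y: "det Y = 1" and S: "det S = 1"
    and XS: "conjugate_by (adj2 S) X $ 2 $ 1 = 0" and YS: "conjugate_by (adj2 S) Y $ 2 $ 1 = 0"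
  shows "elementary (generate PSL2C {psl X, psl Y})"
proof -
  interpret group PSL2C by (rule group_PSL2C)
  have dS: "det (adj2 S) = 1" using S by (simp add: det_adj2)
  define T where "T = {psl A | A. det A = 1 \<and> conjugate_by (adj2 S) A $ 2 $ 1 = 0}"
  have "subgroup T PSL2C"
  proof (rule subgroupI)
    show "T \<subseteq> carrier PSL2C" by (auto simp: T_def)
    show "T \<noteq> {}" using X XS by (auto simp: T_def)
  next
    fix x assume "x \<in> T"
    then obtain A where A: "det A = 1" "conjugate_by (adj2 S) A $ 2 $ 1 = 0" "x = psl A" by (auto simp: T_def)
    have "conjugate_by (adj2 S) (adj2 A) = adj2 (conjugate_by (adj2 S) A)"
      by (rule matrix_2_eqI) (simp_all add: conjugate_by_def mat2_mult_nth algebra_simps)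
    then have "conjugate_by (adj2 S) (adj2 A) $ 2 $ 1 = 0" using A(2) by simp
    then show "inv\<^bsub>PSL2C\<^esub> x \<in> T" using A unfolding T_def by (auto simp: psl_inv det_adj2)
  next
    fix x y assume "x \<in> T" "y \<in> T"
    then obtain A B where A: "det A = 1" "conjugate_by (adj2 S) A $ 2 $ 1 = 0" "x = psl A"
      and B: "det B = 1" "conjugate_by (adj2 S) B $ 2 $ 1 = 0" "y = psl B" by (auto simp: T_def)
    have "conjugate_by (adj2 S) (A ** B) $ 2 $ 1 = 0"
      by (simp add: conjugate_by_simps(1)[OF dS] mat2_mult_nth A B)
    then show "x \<otimes>\<^bsub>PSL2C\<^esub> y \<in> T" using A B unfolding T_def by (auto simp: psl_mult det_mul)
  qed
  moreover have "{psl X, psl Y} \<subseteq> T" using X Y XS YS by (auto simp: T_def)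
  ultimately have gT: "generate PSL2C {psl X, psl Y} \<subseteq> T" by (intro generate_subgroup_incl)
  have gC: "generate PSL2C {psl X, psl Y} \<subseteq> carrier PSL2C" using X Y by (intro generate_incl) auto
  have "moebius A (moebius S None) = moebius S None" if A: "A \<in> \<Union>(generate PSL2C {psl X, psl Y})" for A
  proof -
    obtain B where B: "det B = 1" "conjugate_by (adj2 S) B $ 2 $ 1 = 0" "A \<in> psl B" using A gT by (auto simp: T_def)
    have "conjugate_by (adj2 S) (- B) = - conjugate_by (adj2 S) B" by (simp add: conjugate_by_def)
    then have "det A = 1" "conjugate_by (adj2 S) A $ 2 $ 1 = 0" using B by (auto simp: psl_eq)
    then show ?thesis by (rule moebius_fixed[OF S])
  qed
  then have "psl_orbit moebius (generate PSL2C {psl X, psl Y}) (moebius S None) \<subseteq> {moebius S None}"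
    by (auto simp: psl_orbit_def)
  then have "finite (psl_orbit moebius (generate PSL2C {psl X, psl Y}) (moebius S None))"
    using finite_subset by blast
  then show ?thesis unfolding elementary_def by blast
qed

section \<open>Elliptic Joergensen groups and non-cocompact groups\<close>

text \<open>
  An integral \<open>tr\<^sup>2 X\<close> would have to be \<open>3\<close>, as explained at the beginning.
\<close>

lemma elliptic_generator_trace_sq_nonintegral:
  assumes "jorgensen_group_elliptic_type \<Gamma>"
  obtains X where "det X = 1" "psl X \<in> \<Gamma>" "(trace X)\<^sup>2 \<in> \<real>" "(trace X)\<^sup>2 \<notin> \<int>"
proof -
  obtain g h where gh: "(g, h) \<in> generating_pairs \<Gamma>" "jorgensen_number g h = 1" "psl_elliptic g"
    and J: "jorgensen_group \<Gamma>" using assms unfolding jorgensen_group_elliptic_type_def by blast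
  have gen: "generate PSL2C {g, h} = \<Gamma>" and gC: "g \<in> carrier PSL2C" and hC: "h \<in> carrier PSL2C"
    using gh(1) by (auto simp: generating_pairs_def)
  obtain X where X: "det X = 1" "g = psl X" using gC by (rule carrier_PSL2C_cases)
  obtain Y where Y: "det Y = 1" "h = psl Y" using hC by (rule carrier_PSL2C_cases)
  have el: "(trace X)\<^sup>2 \<in> \<real>" "0 \<le> Re ((trace X)\<^sup>2)" "Re ((trace X)\<^sup>2) < 4"
    using gh(3) by (auto simp: psl_elliptic_def X(2) psl_tr2_psl)
  have jn: "cmod ((trace X)\<^sup>2 - 4) + cmod (trace (X ** Y ** adj2 X ** adj2 Y) - 2) = 1"
    using gh(2) X Y by (simp add: jorgensen_number_def psl_tr2_psl psl_tr_comm_psl matrix_inv_adj2)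
  have "(trace X)\<^sup>2 \<notin> \<int>"
  proof
    assume "(trace X)\<^sup>2 \<in> \<int>"
    then obtain n where n: "(trace X)\<^sup>2 = of_int n" by (auto elim: Ints_cases)
    then have n4: "0 \<le> n" "n < 4" using el by auto
    have "(trace X)\<^sup>2 - 4 = of_int (n - 4)" using n by simp
    then have "cmod ((trace X)\<^sup>2 - 4) = \<bar>of_int (n - 4)\<bar>" by (simp only: norm_of_int)
    then have c: "cmod ((trace X)\<^sup>2 - 4) = 4 - real_of_int n" using n4 by simp
    have "real_of_int n \<ge> 3" using jn c norm_ge_zero[of "trace (X ** Y ** adj2 X ** adj2 Y) - 2"] by linarith
    then have "n = 3" using n4 by linarith
    then have "(trace X)\<^sup>2 = 3" "trace (X ** Y ** adj2 X ** adj2 Y) = 2" using n jn c by auto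
    then obtain S where S: "det S = 1" "conjugate_by (adj2 S) X $ 2 $ 1 = 0" "conjugate_by (adj2 S) Y $ 2 $ 1 = 0"
      using common_fixed_point[OF X(1) Y(1)] by blast
    have "elementary \<Gamma>" using reducible_pair_imp_elementary[OF X(1) Y(1) S] gen X(2) Y(2) by simp
    then show False using J by (simp add: jorgensen_group_def)
  qed
  moreover have "psl X \<in> \<Gamma>" unfolding gen[symmetric] X(2)[symmetric] by (rule generate.incl) simp
  ultimately show ?thesis using that X(1) el(1) by blast
qed

theorem corollary5p5:
  fixes \<Gamma> \<Delta> :: "(complex^2^2) set set"
  assumes "arithmetic_kleinian_group \<Gamma>" and "jorgensen_group_elliptic_type \<Gamma>"
    and "arithmetic_kleinian_group \<Delta>" and "\<not> cocompact \<Delta>"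
  shows "\<not> commensurable \<Gamma> \<Delta>"
proof
  assume comm1: "commensurable \<Gamma> \<Delta>"
  obtain k \<theta> m a b R \<rho> where ar: "quaternion_order k \<theta> m a b R \<rho>"
    "card (complex_places k) = 1" "\<not> k \<subseteq> \<real>" "\<And>\<sigma>. \<sigma> \<in> field_embeddings k \<Longrightarrow> ramified_at_real_place a b \<sigma>"
    and comm2: "commensurable \<Delta> (psl ` quaternion_order.units1 a b R \<rho>)"
    using arithmetic_kleinian_groupE[OF assms(3)] by metis
  interpret quaternion_order k \<theta> m a b R \<rho> by (rule ar(1))
  have \<Delta>: "kleinian_group \<Delta>" "subgroup \<Delta> PSL2C"
    using assms(3) by (simp_all add: arithmetic_kleinian_group_def kleinian_group_def)
  have \<Gamma>: "subgroup \<Gamma> PSL2C"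
    using assms(1) by (simp add: arithmetic_kleinian_group_def kleinian_group_def)
  obtain x where x: "x \<in> quats" "x \<noteq> 0" "quat_norm a b x = 0"
    using noncocompact_imp_zero_divisor[OF ar(1-3) comm2 \<Delta>(1) assms(4)] by blast
  have conj: "conjugates \<subseteq> {\<theta>, cnj \<theta>}"
    using zero_divisor_imp_no_real_conjugates[OF x ar(4)] one_complex_place[OF ar(2,3)] by blast
  obtain X where X: "det X = 1" "psl X \<in> \<Gamma>" "(trace X)\<^sup>2 \<in> \<real>" "(trace X)\<^sup>2 \<notin> \<int>"
    using elliptic_generator_trace_sq_nonintegral[OF assms(2)] by blast
  obtain f where f: "det f = 1"
    and to_units: "\<And>A. A \<in> lift_set \<Gamma> \<Longrightarrow> \<exists>n>0. mpow (conjugate_by f A) n \<in> units1"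
    and from_units: "\<And>U. U \<in> units1 \<Longrightarrow> \<exists>n>0. \<exists>A\<in>lift_set \<Gamma>. conjugate_by f A = mpow U n"
    using commensurable_chain[OF \<Gamma> \<Delta>(2) unit_group_subgroup comm1 comm2] unfolding lift_unit_group by blast
  note cf = conjugate_by_simps[OF f]
  define Z where "Z = conjugate_by f X"
  have Z: "det Z = 1" using cf(4) X(1) by (simp add: Z_def)
  have XL: "X \<in> lift_set \<Gamma>" using X by (simp add: lift_set_def)
  obtain n where n: "n > 0" "mpow Z n \<in> units1" using to_units[OF XL] by (auto simp: Z_def)
  have H: "\<exists>n>0. conjugate_by Z (mpow U n) \<in> units1" if U: "U \<in> units1" for U
  proof -
    obtain n1 A where A: "n1 > 0" "A \<in> lift_set \<Gamma>" "conjugate_by f A = mpow U n1" using from_units[OF U] by blast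
    interpret \<Gamma>: subgroup \<Gamma> PSL2C by (rule \<Gamma>)
    have dA: "det A = 1" "psl A \<in> \<Gamma>" using A(2) by (auto simp: lift_set_def)
    have "psl X \<otimes>\<^bsub>PSL2C\<^esub> psl A \<otimes>\<^bsub>PSL2C\<^esub> inv\<^bsub>PSL2C\<^esub> psl X \<in> \<Gamma>"
      using X(2) dA(2) by (intro \<Gamma>.m_closed \<Gamma>.m_inv_closed)
    then have "conjugate_by X A \<in> lift_set \<Gamma>"
      using X(1) dA(1) by (simp add: lift_set_def conjugate_by_def psl_mult psl_inv det_mul det_adj2)
    then obtain n2 where n2: "n2 > 0" "mpow (conjugate_by f (conjugate_by X A)) n2 \<in> units1" using to_units by blast
    have "mpow (conjugate_by f (conjugate_by X A)) n2 = conjugate_by Z (mpow U (n1 * n2))"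
      using conjugate_by_mult(2)[OF f X(1), of A] conjugate_by_simps(6)[OF Z] by (simp add: A(3) Z_def mpow_mult)
    then show ?thesis using n2 A(1) by (intro exI[of _ "n1 * n2"]) simp
  qed
  have "(trace Z)\<^sup>2 \<in> ring_of_integers k" by (rule commensurator_trace_sq[OF Z H n x])
  moreover have "trace Z = trace X" unfolding Z_def by (rule cf(7))
  ultimately have "(trace X)\<^sup>2 \<in> \<int>"
    using real_integers_imaginary_quadratic[OF theta_not_real[OF ar(3)] conj] X(3) by simp
  then show False using X(4) by simp
qed

end
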